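(* Work in $\mathsf{RCA}_0$. Let $X$ be a well-order. Then the following are equivalent: (a) $\mathsf{SETR}_X$ (Strong Effective Transfinite Recursion along $X$); (b) transfinite $\Pi^0_2$-induction along $X$; (c) the map $\alpha \mapsto \alpha^X$ preserves well-orders, i.e., for every well-order $\alpha$, the order $\alpha^X$ is a well-order.
   Context: We work in second-order arithmetic over the base system $\mathsf{RCA}_0$. Pairs of natural numbers are coded by natural numbers. A well-order is a linear order (given as a set) without infinite descending sequences. For a well-order $X$ and $x \in X$, let $X|_x = \{x' \in X : x' <_X x\}$. For a formula $\varphi(n,x,Z)$ and sets $X, Y$, $H_\varphi(X,Y)$ means $Y = \{(x,n) : x \in X \text{ and } \varphi(n,x,Y^x)\}$, where $Y^x = \{(x',m) \in Y : x' <_X x\}$. $\mathsf{SETR}_X$ is the scheme: for all $\Sigma^0_1$-formulas $\varphi(n,x,Z)$ and $\psi(n,x,Z)$ (possibly with parameters), if $\forall n \in \mathbb{N}\ \forall x \in X\ \forall Z \subseteq \mathbb{N}\ \big(H_\varphi(X|_x, Z) \to (\varphi(n,x,Z) \leftrightarrow \neg\psi(n,x,Z))\big)$, then there exists a set $Y$ with $H_\varphi(X,Y)$. Transfinite $\Pi^0_2$-induction along $X$: for every $\Pi^0_2$-formula $Q(x)$ (possibly with parameters), if $\forall x \in X\,(\forall y <_X x\, Q(y) \to Q(x))$, then $\forall x \in X\, Q(x)$. For a linear order $\alpha$ (with least element $0_\alpha$, if it exists) and a well-order $\beta$, $\alpha^\beta$ is the set of finite sequences $\langle (b_0,a_0),\dots,(b_{n-1},a_{n-1})\rangle$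 with $n \in \mathbb{N}$, $a_i \in \alpha$, $a_i \neq 0_\alpha$, $b_i \in \beta$ and $b_i >_\beta b_{i+1}$ for all $i < n-1$. It is ordered by: $\sigma <_{\alpha^\beta} \tau$ iff either $\tau$ strictly extends $\sigma$, or for the least index $i$ with $\sigma_i \neq \tau_i$, writing $\sigma_i = (b,a)$ and $\tau_i = (b',a')$, we have $b <_\beta b'$, or $b = b'$ and $a <_\alpha a'$. *)

theory Defs
  imports Main
begin

text \<open>
  Second-order arithmetic is treated semantically: provability in \<open>RCA\<^sub>0\<close> is truth in all models of
  \<open>RCA\<^sub>0\<close>.  A model has an arbitrary (possibly nonstandard) number domain, the type \<open>'m\<close>, and an
  arbitrary collection \<open>S :: 'm set set\<close> of subsets of it as its sets.  Internal notions quantify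
  over \<open>'m\<close> and \<open>S\<close>; only formulas (with standard syntax) are deeply embedded.
\<close>

text \<open>
  The basic axioms: nonnegative parts of discretely ordered rings.  The operation \<open>-\<close> inherited
  from the library class is not part of the language of arithmetic; truncated subtraction always
  satisfies its axioms, so it does not restrict the class of models.
\<close>

class discrete_ordered_semiring = discrete_linordered_semidom +
  assumes zero_least: "0 \<le> a"

instance nat :: discrete_ordered_semiring
  by standard simp


section \<open>Arithmetical formulas\<close>

text \<open>
  Number variables are de Bruijn indices.  Set variables are never bound and are
  plain indices into the set environment.  The bound of a bounded quantifier is evaluated outside
  its scope.
\<close>

datatype tm = Var nat | Zero | One | Add tm tm | Mul tm tm

datatype fm =
    Eq tm tm | Less tm tm | Mem tm nat
  | Neg fm | Conj fm fm | Disj fm fm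
  | BForall tm fm | BExists tm fm
  | Forall fm | Exists fm

abbreviation push :: "'a \<Rightarrow> (nat \<Rightarrow> 'a) \<Rightarrow> nat \<Rightarrow> 'a" where
  "push x e \<equiv> case_nat x e"

primrec tm_val :: "(nat \<Rightarrow> 'm::discrete_ordered_semiring) \<Rightarrow> tm \<Rightarrow> 'm" where
  "tm_val e (Var i) = e i"
| "tm_val e Zero = 0"
| "tm_val e One = 1"
| "tm_val e (Add s t) = tm_val e s + tm_val e t"
| "tm_val e (Mul s t) = tm_val e s * tm_val e t"

primrec sat :: "(nat \<Rightarrow> 'm::discrete_ordered_semiring) \<Rightarrow> (nat \<Rightarrow> 'm set) \<Rightarrow> fm \<Rightarrow> bool" where
  "sat e E (Eq s t) \<longleftrightarrow> tm_val e s = tm_val e t"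
| "sat e E (Less s t) \<longleftrightarrow> tm_val e s < tm_val e t"
| "sat e E (Mem t i) \<longleftrightarrow> tm_val e t \<in> E i"
| "sat e E (Neg \<phi>) \<longleftrightarrow> \<not> sat e E \<phi>"
| "sat e E (Conj \<phi> \<psi>) \<longleftrightarrow> sat e E \<phi> \<and> sat e E \<psi>"
| "sat e E (Disj \<phi> \<psi>) \<longleftrightarrow> sat e E \<phi> \<or> sat e E \<psi>"
| "sat e E (BForall t \<phi>) \<longleftrightarrow> (\<forall>x < tm_val e t. sat (push x e) E \<phi>)"
| "sat e E (BExists t \<phi>) \<longleftrightarrow> (\<exists>x < tm_val e t. sat (push x e) E \<phi>)"
| "sat e E (Forall \<phi>) \<longleftrightarrow> (\<forall>x. sat (push x e) E \<phi>)"
| "sat e E (Exists \<phi>) \<longleftrightarrow> (\<exists>x. sat (push x e) E \<phi>)"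

primrec bounded_fm :: "fm \<Rightarrow> bool" where
  "bounded_fm (Eq s t) \<longleftrightarrow> True"
| "bounded_fm (Less s t) \<longleftrightarrow> True"
| "bounded_fm (Mem t i) \<longleftrightarrow> True"
| "bounded_fm (Neg \<phi>) \<longleftrightarrow> bounded_fm \<phi>"
| "bounded_fm (Conj \<phi> \<psi>) \<longleftrightarrow> bounded_fm \<phi> \<and> bounded_fm \<psi>"
| "bounded_fm (Disj \<phi> \<psi>) \<longleftrightarrow> bounded_fm \<phi> \<and> bounded_fm \<psi>"
| "bounded_fm (BForall t \<phi>) \<longleftrightarrow> bounded_fm \<phi>"
| "bounded_fm (BExists t \<phi>) \<longleftrightarrow> bounded_fm \<phi>"
| "bounded_fm (Forall \<phi>) \<longleftrightarrow> False"
| "bounded_fm (Exists \<phi>) \<longleftrightarrow> False"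

definition Sigma01 :: "fm \<Rightarrow> bool" where
  "Sigma01 \<phi> \<longleftrightarrow> (\<exists>\<theta>. bounded_fm \<theta> \<and> \<phi> = Exists \<theta>)"

definition Pi01 :: "fm \<Rightarrow> bool" where
  "Pi01 \<phi> \<longleftrightarrow> (\<exists>\<theta>. bounded_fm \<theta> \<and> \<phi> = Forall \<theta>)"

definition Pi02 :: "fm \<Rightarrow> bool" where
  "Pi02 \<phi> \<longleftrightarrow> (\<exists>\<theta>. bounded_fm \<theta> \<and> \<phi> = Forall (Exists \<theta>))"


section \<open>Models of \<open>RCA\<^sub>0\<close>\<close>

text \<open>The environments \<open>e\<close> and \<open>E\<close> supply the number and set parameters.\<close>

definition Sigma01_induction :: "'m::discrete_ordered_semiring set set \<Rightarrow> bool" where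
  "Sigma01_induction S \<longleftrightarrow>
    (\<forall>\<phi> e E. Sigma01 \<phi> \<and> range E \<subseteq> S \<and>
      sat (push 0 e) E \<phi> \<and> (\<forall>n. sat (push n e) E \<phi> \<longrightarrow> sat (push (n + 1) e) E \<phi>)
      \<longrightarrow> (\<forall>n. sat (push n e) E \<phi>))"

definition Delta01_comprehension :: "'m::discrete_ordered_semiring set set \<Rightarrow> bool" where
  "Delta01_comprehension S \<longleftrightarrow>
    (\<forall>\<phi> \<psi> e E. Sigma01 \<phi> \<and> Pi01 \<psi> \<and> range E \<subseteq> S \<and>
      (\<forall>n. sat (push n e) E \<phi> \<longleftrightarrow> sat (push n e) E \<psi>)
      \<longrightarrow> {n. sat (push n e) E \<phi>} \<in> S)"

definition RCA0 :: "'m::discrete_ordered_semiring set set \<Rightarrow> bool" where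
  "RCA0 S \<longleftrightarrow> S \<noteq> {} \<and> Sigma01_induction S \<and> Delta01_comprehension S"


section \<open>Codes for pairs and finite sequences\<close>

definition pair :: "'m::discrete_ordered_semiring \<Rightarrow> 'm \<Rightarrow> 'm" where
  "pair x y = (x + y) * (x + y) + x"

text \<open>
  Codes of finite sets following Simpson: in a model of \<open>RCA\<^sub>0\<close> every bounded set has the form
  \<open>decode k m n\<close>, and its code is the least code of such a triple.
\<close>

definition decode :: "'m::discrete_ordered_semiring \<Rightarrow> 'm \<Rightarrow> 'm \<Rightarrow> 'm set" where
  "decode k m n = {i. i < k \<and> (m * (i + 1) + 1) dvd n}"

definition set_code :: "'m::discrete_ordered_semiring \<Rightarrow> 'm set \<Rightarrow> bool" where
  "set_code c A \<longleftrightarrow>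
    (\<exists>k m n. c = pair (pair k m) n \<and> A = decode k m n) \<and>
    (\<forall>k m n. A = decode k m n \<longrightarrow> c \<le> pair (pair k m) n)"

definition entry :: "'m::discrete_ordered_semiring \<Rightarrow> 'm \<Rightarrow> 'm \<Rightarrow> bool" where
  "entry s i a \<longleftrightarrow> (\<exists>A. set_code s A \<and> pair i a \<in> A)"

text \<open>\<open>s\<close> codes a finite sequence of (possibly nonstandard) length \<open>l\<close>.\<close>

definition seq_code :: "'m::discrete_ordered_semiring \<Rightarrow> 'm \<Rightarrow> bool" where
  "seq_code s l \<longleftrightarrow>
    (\<exists>A. set_code s A \<and> (\<forall>p\<in>A. \<exists>i<l. \<exists>a. p = pair i a) \<and> (\<forall>i<l. \<exists>!a. pair i a \<in> A))"


section \<open>Linear orders and well-orders\<close>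

text \<open>A linear order is given as a single set of codes of pairs, namely its reflexive relation.\<close>

definition rel :: "'m::discrete_ordered_semiring set \<Rightarrow> ('m \<times> 'm) set" where
  "rel X = {(x, y). pair x y \<in> X}"

definition ofield :: "'m::discrete_ordered_semiring set \<Rightarrow> 'm set" where
  "ofield X = Field (rel X)"

definition oless :: "'m::discrete_ordered_semiring set \<Rightarrow> 'm \<Rightarrow> 'm \<Rightarrow> bool" where
  "oless X x y \<longleftrightarrow> (x, y) \<in> rel X \<and> x \<noteq> y"

definition least_in :: "'m::discrete_ordered_semiring set \<Rightarrow> 'm \<Rightarrow> bool" where
  "least_in X x \<longleftrightarrow> x \<in> ofield X \<and> (\<forall>y\<in>ofield X. (x, y) \<in> rel X)"

definition fun_code :: "'m::discrete_ordered_semiring set \<Rightarrow> bool" where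
  "fun_code F \<longleftrightarrow> (\<forall>p\<in>F. \<exists>i y. p = pair i y) \<and> (\<forall>i. \<exists>!y. pair i y \<in> F)"

definition well_ordered :: "'m::discrete_ordered_semiring set set \<Rightarrow> 'm set \<Rightarrow> bool" where
  "well_ordered S X \<longleftrightarrow> X \<in> S \<and> Linear_order (rel X) \<and>
    \<not> (\<exists>F\<in>S. fun_code F \<and>
          (\<forall>i y z. pair i y \<in> F \<and> pair (i + 1) z \<in> F \<longrightarrow> oless X z y))"

definition below :: "'m::discrete_ordered_semiring set \<Rightarrow> 'm \<Rightarrow> 'm set" where
  "below X x = {pair y z | y z. (y, z) \<in> rel X \<and> oless X y x \<and> oless X z x}"


section \<open>Effective transfinite recursion and transfinite induction\<close>

definition restrict_to :: "'m::discrete_ordered_semiring set \<Rightarrow> 'm set \<Rightarrow> 'm \<Rightarrow> 'm set" where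
  "restrict_to X Y x = {pair y m | y m. pair y m \<in> Y \<and> oless X y x}"

text \<open>
  In \<open>\<phi>(n, x, Z)\<close>, the number variables \<open>0\<close> and \<open>1\<close> are \<open>n\<close> and \<open>x\<close>, the set variable \<open>0\<close> is \<open>Z\<close>,
  and the remaining variables are parameters.
\<close>

abbreviation sat3 ::
  "(nat \<Rightarrow> 'm::discrete_ordered_semiring) \<Rightarrow> (nat \<Rightarrow> 'm set) \<Rightarrow> fm \<Rightarrow> 'm \<Rightarrow> 'm \<Rightarrow> 'm set \<Rightarrow> bool" where
  "sat3 e E \<phi> n x Z \<equiv> sat (push n (push x e)) (push Z E) \<phi>"

definition H ::
  "(nat \<Rightarrow> 'm::discrete_ordered_semiring) \<Rightarrow> (nat \<Rightarrow> 'm set) \<Rightarrow> fm \<Rightarrow> 'm set \<Rightarrow> 'm set \<Rightarrow> bool" where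
  "H e E \<phi> X Y \<longleftrightarrow> Y = {pair x n | x n. x \<in> ofield X \<and> sat3 e E \<phi> n x (restrict_to X Y x)}"

definition SETR :: "'m::discrete_ordered_semiring set set \<Rightarrow> 'm set \<Rightarrow> bool" where
  "SETR S X \<longleftrightarrow>
    (\<forall>\<phi> \<psi> e E. Sigma01 \<phi> \<and> Sigma01 \<psi> \<and> range E \<subseteq> S \<and>
      (\<forall>n. \<forall>x\<in>ofield X. \<forall>Z\<in>S. H e E \<phi> (below X x) Z \<longrightarrow>
          (sat3 e E \<phi> n x Z \<longleftrightarrow> \<not> sat3 e E \<psi> n x Z))
      \<longrightarrow> (\<exists>Y\<in>S. H e E \<phi> X Y))"

definition Pi02_transfinite_induction :: "'m::discrete_ordered_semiring set set \<Rightarrow> 'm set \<Rightarrow> bool" where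
  "Pi02_transfinite_induction S X \<longleftrightarrow>
    (\<forall>Q e E. Pi02 Q \<and> range E \<subseteq> S \<and>
      (\<forall>x\<in>ofield X. (\<forall>y. oless X y x \<longrightarrow> sat (push y e) E Q) \<longrightarrow> sat (push x e) E Q)
      \<longrightarrow> (\<forall>x\<in>ofield X. sat (push x e) E Q))"


section \<open>Exponentiation of linear orders\<close>

definition pow_elem ::
  "'m::discrete_ordered_semiring set \<Rightarrow> 'm set \<Rightarrow> 'm \<Rightarrow> bool" where
  "pow_elem \<alpha> \<beta> s \<longleftrightarrow> (\<exists>l. seq_code s l \<and>
    (\<forall>i<l. \<exists>b a. entry s i (pair b a) \<and> b \<in> ofield \<beta> \<and> a \<in> ofield \<alpha> \<and> \<not> least_in \<alpha> a) \<and>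
    (\<forall>i b a b' a'. i + 1 < l \<and> entry s i (pair b a) \<and> entry s (i + 1) (pair b' a')
       \<longrightarrow> oless \<beta> b' b))"

definition pow_less ::
  "'m::discrete_ordered_semiring set \<Rightarrow> 'm set \<Rightarrow> 'm \<Rightarrow> 'm \<Rightarrow> bool" where
  "pow_less \<alpha> \<beta> s t \<longleftrightarrow> (\<exists>k l. seq_code s k \<and> seq_code t l \<and>
    ((k < l \<and> (\<forall>i<k. \<forall>c. entry s i c \<longleftrightarrow> entry t i c)) \<or>
     (\<exists>i. i < k \<and> i < l \<and> (\<forall>j<i. \<forall>c. entry s j c \<longleftrightarrow> entry t j c) \<and>
       (\<exists>b a b' a'. entry s i (pair b a) \<and> entry t i (pair b' a') \<and> (b, a) \<noteq> (b', a') \<and>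
         (oless \<beta> b b' \<or> b = b' \<and> oless \<alpha> a a')))))"

definition opow :: "'m::discrete_ordered_semiring set \<Rightarrow> 'm set \<Rightarrow> 'm set" where
  "opow \<alpha> \<beta> = {pair s t | s t. pow_elem \<alpha> \<beta> s \<and> pow_elem \<alpha> \<beta> t \<and> (s = t \<or> pow_less \<alpha> \<beta> s t)}"

end

theory Submission
  imports Defs
begin

text \<open>
  Recursion yields induction: given a progressive \<open>\<forall>m. \<exists>k. T x m k\<close>, put \<open>\<langle>x, m\<rangle>\<close> into the recursively
  defined set as soon as either a witness \<open>k\<close> or some missing \<open>\<langle>z, m'\<rangle>\<close> with \<open>z < x\<close> is found.  Any
  partial solution is then full, so the recursion is effective, and a full solution is the
  induction statement.

  Induction yields recursion: the required set is approximated by coded finite sets of claims, each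
  confirmed by a finite computation that only consults claims at smaller points.  That every
  instance at \<open>x\<close> is decided by exactly one confirmed claim is a \<open>\<Pi>\<^sup>0\<^sub>2\<close> statement, progressive by
  the hypothesis on the two formulas.

  Induction yields preservation: along a descending sequence in \<open>\<alpha>\<^sup>X\<close> the first entry stabilizes,
  then the second one, and so on.  Being an exponent that stabilizes in such a way is \<open>\<Sigma>\<^sup>0\<^sub>2\<close>, and
  below each such exponent there is another one, so induction shows that there is none.

  Preservation yields induction: if induction fails at \<open>\<langle>x0, m0\<rangle>\<close>, guess at stage \<open>s\<close> a descending
  chain of failures, choosing at each step the least pair not yet refuted at \<open>s\<close>.  With coefficients
  recording the stage at which the guess last changed, these chains descend in \<open>\<alpha>\<^sup>X\<close> as \<open>s\<close> grows.
  Guesses below \<open>x\<close> change only finitely often before \<open>\<langle>x, m\<rangle>\<close> is refuted, which makes \<open>\<alpha>\<close> a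
  well-order.
\<close>


section \<open>Definable predicates\<close>

text \<open>The obstacle throughout is that a model of \<open>RCA0\<close> has only \<Sigma>1
  induction and may be nonstandard. Least elements, common bounds and finite sequences have to come
  from least number principles, collection and coded computations, and each predicate used there
  needs a known complexity. Hence the long bookkeeping before the mathematics.

  The level \<Pi>2 reflects how convergence is expressed: being decided is \<Sigma>1, never being
  contradicted is \<Pi>1, being stable from some stage on is \<Sigma>2. Well-orderedness of
  \<open>X\<close> only forbids descending sequences that are sets, whereas the failures of a \<Pi>2
  induction form a \<Sigma>2 class, in which a descent can only be guessed. A revised guess may
  continue with an arbitrary new chain, so the revision has to be paid for at the node below which
  the guess changed. The coefficient there records a later stage, which makes this payment.\<close>

text \<open>Definability is handled semantically, for predicates of a number environment \<open>e\<close> and one set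
  argument \<open>Z\<close>; model elements and members of \<open>S\<close> may occur as parameters.  In the rule for bounded
  quantifiers the body is a function of the bound value, which becomes variable \<open>0\<close>.\<close>

inductive tm_fun :: "((nat \<Rightarrow> 'm::discrete_ordered_semiring) \<Rightarrow> 'm) \<Rightarrow> bool" where
  tm_fun_var: "tm_fun (\<lambda>e. e i)"
| tm_fun_const: "tm_fun (\<lambda>e. c)"
| tm_fun_add: "tm_fun t \<Longrightarrow> tm_fun u \<Longrightarrow> tm_fun (\<lambda>e. t e + u e)"
| tm_fun_mult: "tm_fun t \<Longrightarrow> tm_fun u \<Longrightarrow> tm_fun (\<lambda>e. t e * u e)"

inductive Delta0 :: "'m::discrete_ordered_semiring set set \<Rightarrow> ((nat \<Rightarrow> 'm) \<Rightarrow> 'm set \<Rightarrow> bool) \<Rightarrow> bool"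
  for S where
  Delta0_eq: "tm_fun t \<Longrightarrow> tm_fun u \<Longrightarrow> Delta0 S (\<lambda>e Z. t e = u e)"
| Delta0_less: "tm_fun t \<Longrightarrow> tm_fun u \<Longrightarrow> Delta0 S (\<lambda>e Z. t e < u e)"
| Delta0_mem: "A \<in> S \<Longrightarrow> tm_fun t \<Longrightarrow> Delta0 S (\<lambda>e Z. t e \<in> A)"
| Delta0_mem_arg: "tm_fun t \<Longrightarrow> Delta0 S (\<lambda>e Z. t e \<in> Z)"
| Delta0_not: "Delta0 S P \<Longrightarrow> Delta0 S (\<lambda>e Z. \<not> P e Z)"
| Delta0_conj: "Delta0 S P \<Longrightarrow> Delta0 S Q \<Longrightarrow> Delta0 S (\<lambda>e Z. P e Z \<and> Q e Z)"
| Delta0_bex: "tm_fun t \<Longrightarrow> Delta0 S (\<lambda>e Z. Q (\<lambda>i. e (Suc i)) (e 0) Z) \<Longrightarrow> Delta0 S (\<lambda>e Z. \<exists>x<t e. Q e x Z)"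

lemma tm_fun_pair: "tm_fun t \<Longrightarrow> tm_fun u \<Longrightarrow> tm_fun (\<lambda>e. pair (t e) (u e))"
  unfolding pair_def by (intro tm_fun.intros)

lemma Delta0_disj: "Delta0 S P \<Longrightarrow> Delta0 S Q \<Longrightarrow> Delta0 S (\<lambda>e Z. P e Z \<or> Q e Z)"
  using Delta0_not[OF Delta0_conj[OF Delta0_not Delta0_not], of S P Q] by simp

lemma Delta0_imp: "Delta0 S P \<Longrightarrow> Delta0 S Q \<Longrightarrow> Delta0 S (\<lambda>e Z. P e Z \<longrightarrow> Q e Z)"
  using Delta0_not[OF Delta0_conj[OF _ Delta0_not], of S P Q] by simp

lemma Delta0_iff: "Delta0 S P \<Longrightarrow> Delta0 S Q \<Longrightarrow> Delta0 S (\<lambda>e Z. P e Z \<longleftrightarrow> Q e Z)"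
  using Delta0_conj[OF Delta0_imp Delta0_imp, of S P Q Q P] by (simp add: iff_conv_conj_imp)

lemma Delta0_True: "Delta0 S (\<lambda>e Z. True)" and Delta0_False: "Delta0 S (\<lambda>e Z. False)"
  using Delta0_eq[OF tm_fun_const tm_fun_const, of S 0 0] Delta0_less[OF tm_fun_const tm_fun_const, of S 0 0] by simp_all

lemma Delta0_const: "Delta0 S (\<lambda>e Z. b)"
  using Delta0_True Delta0_False by (cases b) auto

lemma Delta0_le: "tm_fun t \<Longrightarrow> tm_fun u \<Longrightarrow> Delta0 S (\<lambda>e Z. t e \<le> u e)"
  using Delta0_not[OF Delta0_less, of u t S] by (simp add: not_less)

lemma Delta0_ball: "tm_fun t \<Longrightarrow> Delta0 S (\<lambda>e Z. Q (\<lambda>i. e (Suc i)) (e 0) Z) \<Longrightarrow> Delta0 S (\<lambda>e Z. \<forall>x<t e. Q e x Z)"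
  using Delta0_not[OF Delta0_bex[OF _ Delta0_not], of t S Q] by simp

lemma Delta0_bex_le:
  "tm_fun t \<Longrightarrow> Delta0 S (\<lambda>e Z. Q (\<lambda>i. e (Suc i)) (e 0) Z) \<Longrightarrow> Delta0 S (\<lambda>e Z. \<exists>x\<le>t e. Q e x Z)"
  using Delta0_bex[OF tm_fun_add[OF _ tm_fun_const], of t S Q 1] by (simp add: less_eq_iff_succ_less)

lemma Delta0_ball_le:
  "tm_fun t \<Longrightarrow> Delta0 S (\<lambda>e Z. Q (\<lambda>i. e (Suc i)) (e 0) Z) \<Longrightarrow> Delta0 S (\<lambda>e Z. \<forall>x\<le>t e. Q e x Z)"
  using Delta0_ball[OF tm_fun_add[OF _ tm_fun_const], of t S Q 1] by (simp add: less_eq_iff_succ_less)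

lemmas Delta0_rules = Delta0_const Delta0_eq Delta0_less Delta0_mem Delta0_mem_arg Delta0_not Delta0_conj Delta0_disj Delta0_imp Delta0_iff
  Delta0_le Delta0_bex Delta0_ball Delta0_bex_le Delta0_ball_le tm_fun_pair tm_fun.intros

lemma tm_fun_subst: "tm_fun t \<Longrightarrow> (\<And>i. tm_fun (\<lambda>e. f e i)) \<Longrightarrow> tm_fun (\<lambda>e. t (f e))"
  by (induction rule: tm_fun.induct) (auto intro: tm_fun.intros)

lemma tm_fun_push: "tm_fun t \<Longrightarrow> (\<And>i. tm_fun (\<lambda>e. f e i)) \<Longrightarrow> tm_fun (\<lambda>e. case_nat (t e) (f e) i)"
  by (cases i) auto

lemma push_collapse: "case_nat (e 0) (\<lambda>i. e (Suc i)) = e"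
  by (auto simp: fun_eq_iff split: nat.split)

lemma tm_fun_shift: "(\<And>i. tm_fun (\<lambda>e. f e i)) \<Longrightarrow> tm_fun (\<lambda>e. f (\<lambda>j. e (Suc j)) i)"
  by (rule tm_fun_subst[of "\<lambda>e. f e i" "\<lambda>e j. e (Suc j)"], assumption, rule tm_fun_var)

lemma Delta0_subst: "Delta0 S P \<Longrightarrow> (\<And>i. tm_fun (\<lambda>e. f e i)) \<Longrightarrow> Delta0 S (\<lambda>e. P (f e))"
proof (induction arbitrary: f rule: Delta0.induct)
  case (Delta0_bex t Q)
  have "tm_fun (\<lambda>e. case_nat (e 0) (f (\<lambda>i. e (Suc i))) i)" for i
    by (rule tm_fun_push, rule tm_fun_var, rule tm_fun_shift[of f], rule Delta0_bex.prems)
  from Delta0_bex.IH[of "\<lambda>e. case_nat (e 0) (f (\<lambda>i. e (Suc i)))", OF this] have "Delta0 S (\<lambda>e Z. Q (f (\<lambda>i. e (Suc i))) (e 0) Z)" by simp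
  moreover have "tm_fun (\<lambda>e. t (f e))" by (rule tm_fun_subst) fact+
  ultimately show ?case by (intro Delta0.Delta0_bex)
next
  case (Delta0_eq t u)
  show ?case by (rule Delta0.Delta0_eq[OF tm_fun_subst[OF Delta0_eq(1,3)] tm_fun_subst[OF Delta0_eq(2,3)]])
next
  case (Delta0_less t u)
  show ?case by (rule Delta0.Delta0_less[OF tm_fun_subst[OF Delta0_less(1,3)] tm_fun_subst[OF Delta0_less(2,3)]])
next
  case (Delta0_mem A t)
  show ?case by (rule Delta0.Delta0_mem[OF Delta0_mem(1) tm_fun_subst[OF Delta0_mem(2,3)]])
next
  case (Delta0_mem_arg t)
  show ?case by (rule Delta0.Delta0_mem_arg[OF tm_fun_subst[OF Delta0_mem_arg(1,2)]])
qed (auto intro: Delta0.Delta0_not Delta0.Delta0_conj)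

text \<open>The set argument is consulted only in atoms \<open>t e \<in> Z\<close>, so a
  \<open>Delta0\<close> definition of membership in \<open>A\<close> can be inserted there. In this
  way an approximation read off from coded claims replaces the set variable of a formula.\<close>

lemma Delta0_subst_set:
  assumes "Delta0 S P" and "\<And>i. tm_fun (\<lambda>e. f e i)"
    and "Delta0 S (\<lambda>e Z. e 0 \<in> A (\<lambda>i. e (Suc i)) Z)"
  shows "Delta0 S (\<lambda>e Z. P (f e) (A e Z))"
  using assms
proof (induction arbitrary: f A rule: Delta0.induct)
  case (Delta0_mem_arg t)
  have "tm_fun (\<lambda>e. t (f e))" by (rule tm_fun_subst) fact+
  then have "tm_fun (\<lambda>e. case_nat (t (f e)) e i)" for i by (intro tm_fun_push tm_fun_var)
  from Delta0_subst[where f="\<lambda>e. case_nat (t (f e)) e", OF Delta0_mem_arg(3) this] show ?case by simp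
next
  case (Delta0_bex t Q)
  \<comment> \<open>Under the quantifier, variable 0 is the tested element and variable 1 the bound
    value; \<open>A\<close> does not depend on the latter and skips it.\<close>
  have "tm_fun (\<lambda>e. case_nat (e 0) (\<lambda>i. e (Suc (Suc i))) i)" for i
    by (intro tm_fun_push tm_fun_var)
  from Delta0_subst[where f="\<lambda>e. case_nat (e 0) (\<lambda>i. e (Suc (Suc i)))", OF Delta0_bex.prems(2) this]
  have a: "Delta0 S (\<lambda>e Z. e 0 \<in> A (\<lambda>i. e (Suc (Suc i))) Z)" by simp
  have "tm_fun (\<lambda>e. case_nat (e 0) (f (\<lambda>i. e (Suc i))) i)" for i
    by (rule tm_fun_push, rule tm_fun_var, rule tm_fun_shift[of f], rule Delta0_bex.prems)
  from Delta0_bex.IH[of "\<lambda>e. case_nat (e 0) (f (\<lambda>i. e (Suc i)))" "\<lambda>e. A (\<lambda>i. e (Suc i))", OF this a]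
  have "Delta0 S (\<lambda>e Z. Q (f (\<lambda>i. e (Suc i))) (e 0) (A (\<lambda>i. e (Suc i)) Z))" by simp
  moreover have "tm_fun (\<lambda>e. t (f e))" by (rule tm_fun_subst) fact+
  ultimately show ?case by (intro Delta0.Delta0_bex)
next
  case (Delta0_eq t u)
  show ?case by (rule Delta0.Delta0_eq[OF tm_fun_subst[OF Delta0_eq(1,3)] tm_fun_subst[OF Delta0_eq(2,3)]])
next
  case (Delta0_less t u)
  show ?case by (rule Delta0.Delta0_less[OF tm_fun_subst[OF Delta0_less(1,3)] tm_fun_subst[OF Delta0_less(2,3)]])
next
  case (Delta0_mem B t)
  show ?case by (rule Delta0.Delta0_mem[OF Delta0_mem(1) tm_fun_subst[OF Delta0_mem(2,3)]])
qed (auto intro: Delta0.Delta0_not Delta0.Delta0_conj)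

text \<open>Each notion is shown definable once, with its arguments as the first variables. Such
  instances then cover arbitrary term arguments, which is what \<open>intro\<close> meets after
  quantifiers have shifted the variables.\<close>

lemma Delta0_inst1:
  assumes "Delta0 S (\<lambda>e Z. R (e 0) Z)" "tm_fun t" shows "Delta0 S (\<lambda>e Z. R (t e) Z)"
proof -
  have "tm_fun (\<lambda>e. case_nat (t e) e i)" for i by (intro tm_fun_push tm_fun_var assms)
  from Delta0_subst[where f="\<lambda>e. case_nat (t e) e", OF assms(1) this] show ?thesis by simp
qed

lemma Delta0_inst2:
  assumes "Delta0 S (\<lambda>e Z. R (e 0) (e 1) Z)" "tm_fun t" "tm_fun u"
  shows "Delta0 S (\<lambda>e Z. R (t e) (u e) Z)"
proof -
  have "tm_fun (\<lambda>e. case_nat (t e) (case_nat (u e) e) i)" for i by (intro tm_fun_push tm_fun_var assms)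
  from Delta0_subst[where f="\<lambda>e. case_nat (t e) (case_nat (u e) e)", OF assms(1) this] show ?thesis by simp
qed

lemma Delta0_inst3:
  assumes "Delta0 S (\<lambda>e Z. R (e 0) (e 1) (e 2) Z)" "tm_fun t" "tm_fun u" "tm_fun v"
  shows "Delta0 S (\<lambda>e Z. R (t e) (u e) (v e) Z)"
proof -
  have "tm_fun (\<lambda>e. case_nat (t e) (case_nat (u e) (case_nat (v e) e)) i)" for i
    by (intro tm_fun_push tm_fun_var assms)
  from Delta0_subst[where f="\<lambda>e. case_nat (t e) (case_nat (u e) (case_nat (v e) e))", OF assms(1) this] show ?thesis by (simp add: numeral_2_eq_2)
qed

lemma Delta0_inst4:
  assumes "Delta0 S (\<lambda>e Z. R (e 0) (e 1) (e 2) (e 3) Z)" "tm_fun t" "tm_fun u" "tm_fun v" "tm_fun w"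
  shows "Delta0 S (\<lambda>e Z. R (t e) (u e) (v e) (w e) Z)"
proof -
  have "tm_fun (\<lambda>e. case_nat (t e) (case_nat (u e) (case_nat (v e) (case_nat (w e) e))) i)" for i
    by (intro tm_fun_push tm_fun_var assms)
  from Delta0_subst[where f="\<lambda>e. case_nat (t e) (case_nat (u e) (case_nat (v e) (case_nat (w e) e)))", OF assms(1) this] show ?thesis by (simp add: numeral_2_eq_2 numeral_3_eq_3)
qed

text \<open>Entry point from syntax. The environment \<open>f e\<close> may depend on
  \<open>e\<close>, so that the induction passes through bounded quantifiers and parameters can be
  mixed with arguments. Set variable 0 becomes the set argument.\<close>

lemma Delta0_sat:
  "bounded_fm \<phi> \<Longrightarrow> range E \<subseteq> S \<Longrightarrow> (\<And>i. tm_fun (\<lambda>e. f e i)) \<Longrightarrow> Delta0 S (\<lambda>e Z. sat (f e) (push Z E) \<phi>)"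
proof (induction \<phi> arbitrary: f)
  have tm: "tm_fun (\<lambda>e. tm_val (f e) t)" if f: "\<And>i. tm_fun (\<lambda>e. f e i)"
    for f :: "(nat \<Rightarrow> 'a) \<Rightarrow> nat \<Rightarrow> 'a" and t
    by (induction t) (simp_all add: f tm_fun.intros)
  {
    case (Eq s t)
    show ?case by (simp add: Delta0_eq tm Eq.prems)
  next
    case (Less s t)
    show ?case by (simp add: Delta0_less tm Less.prems)
  next
    case (Mem t i)
    then have "E j \<in> S" for j by auto
    then show ?case by (cases i) (simp_all add: Delta0_mem Delta0_mem_arg tm Mem.prems)
  next
    case (Neg \<phi>)
    then show ?case by (simp add: Delta0_not)
  next
    case (Conj \<phi> \<psi>)
    then show ?case by (simp add: Delta0_conj)
  next
    case (Disj \<phi> \<psi>)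
    then show ?case by (simp add: Delta0_disj)
  next
    case (BForall t \<phi>)
    have "Delta0 S (\<lambda>e Z. sat (push (e 0) (f (\<lambda>i. e (Suc i)))) (push Z E) \<phi>)"
    proof (rule BForall.IH)
      show "tm_fun (\<lambda>e. case_nat (e 0) (f (\<lambda>i. e (Suc i))) i)" for i
        by (rule tm_fun_push, rule tm_fun_var, rule tm_fun_shift[of f], rule BForall.prems)
    qed (use BForall.prems in auto)
    from Delta0_ball[of "\<lambda>e. tm_val (f e) t" S "\<lambda>e x Z. sat (case_nat x (f e)) (push Z E) \<phi>", OF _ this]
    show ?case by (simp add: tm BForall.prems)
  next
    case (BExists t \<phi>)
    have "Delta0 S (\<lambda>e Z. sat (push (e 0) (f (\<lambda>i. e (Suc i)))) (push Z E) \<phi>)"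
    proof (rule BExists.IH)
      show "tm_fun (\<lambda>e. case_nat (e 0) (f (\<lambda>i. e (Suc i))) i)" for i
        by (rule tm_fun_push, rule tm_fun_var, rule tm_fun_shift[of f], rule BExists.prems)
    qed (use BExists.prems in auto)
    from Delta0_bex[of "\<lambda>e. tm_val (f e) t" S "\<lambda>e x Z. sat (case_nat x (f e)) (push Z E) \<phi>", OF _ this]
    show ?case by (simp add: tm BExists.prems)
  }
qed simp_all

section \<open>Renaming of variables and merging of parameters\<close>

primrec rename_tm :: "(nat \<Rightarrow> nat) \<Rightarrow> tm \<Rightarrow> tm" where
  "rename_tm r (Var i) = Var (r i)"
| "rename_tm r Zero = Zero"
| "rename_tm r One = One"
| "rename_tm r (Add s t) = Add (rename_tm r s) (rename_tm r t)"
| "rename_tm r (Mul s t) = Mul (rename_tm r s) (rename_tm r t)"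

primrec rename_fm :: "(nat \<Rightarrow> nat) \<Rightarrow> (nat \<Rightarrow> nat) \<Rightarrow> fm \<Rightarrow> fm" where
  "rename_fm r q (Eq s t) = Eq (rename_tm r s) (rename_tm r t)"
| "rename_fm r q (Less s t) = Less (rename_tm r s) (rename_tm r t)"
| "rename_fm r q (Mem t i) = Mem (rename_tm r t) (q i)"
| "rename_fm r q (Neg \<phi>) = Neg (rename_fm r q \<phi>)"
| "rename_fm r q (Conj \<phi> \<psi>) = Conj (rename_fm r q \<phi>) (rename_fm r q \<psi>)"
| "rename_fm r q (Disj \<phi> \<psi>) = Disj (rename_fm r q \<phi>) (rename_fm r q \<psi>)"
| "rename_fm r q (BForall t \<phi>) = BForall (rename_tm r t) (rename_fm (case_nat 0 (\<lambda>i. Suc (r i))) q \<phi>)"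
| "rename_fm r q (BExists t \<phi>) = BExists (rename_tm r t) (rename_fm (case_nat 0 (\<lambda>i. Suc (r i))) q \<phi>)"
| "rename_fm r q (Forall \<phi>) = Forall (rename_fm (case_nat 0 (\<lambda>i. Suc (r i))) q \<phi>)"
| "rename_fm r q (Exists \<phi>) = Exists (rename_fm (case_nat 0 (\<lambda>i. Suc (r i))) q \<phi>)"

lemma tm_val_rename_tm: "tm_val e (rename_tm r t) = tm_val (\<lambda>i. e (r i)) t"
  by (induction t) auto

lemma push_ren: "(\<lambda>i. case_nat x e (case_nat 0 (\<lambda>i. Suc (r i)) i)) = case_nat x (\<lambda>i. e (r i))"
  by (auto simp: fun_eq_iff split: nat.split)

lemma sat_rename_fm: "sat e E (rename_fm r q \<phi>) \<longleftrightarrow> sat (\<lambda>i. e (r i)) (\<lambda>i. E (q i)) \<phi>"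
  by (induction \<phi> arbitrary: e r) (simp_all add: tm_val_rename_tm push_ren)

lemma bounded_rename_fm: "bounded_fm \<phi> \<Longrightarrow> bounded_fm (rename_fm r q \<phi>)"
  by (induction \<phi> arbitrary: r) auto

definition interleave :: "(nat \<Rightarrow> 'a) \<Rightarrow> (nat \<Rightarrow> 'a) \<Rightarrow> nat \<Rightarrow> 'a" where
  "interleave c e i = (if even i then c (i div 2) else e (i div 2))"

lemma interleave_simps [simp]: "interleave c e (2 * i) = c i" "interleave c e (Suc (2 * i)) = e i"
  by (simp_all add: interleave_def)

text \<open>In \<open>interleave (interleave c d) e\<close> the values of \<open>c\<close> occupy
  the positions \<open>4 * i\<close>, those of \<open>d\<close> the positions
  \<open>4 * i + 2\<close>, and the arguments keep their odd positions.\<close>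

lemma interleave_ren:
  "(\<lambda>i. interleave (interleave c d) e (interleave (\<lambda>i. 4 * i) (\<lambda>i. 2 * i + 1) i)) = interleave c e"
  "(\<lambda>i. interleave (interleave c d) e (interleave (\<lambda>i. 4 * i + 2) (\<lambda>i. 2 * i + 1) i)) = interleave d e"
proof -
  have "interleave (interleave c d) e (interleave (\<lambda>i. 4 * i) (\<lambda>i. 2 * i + 1) i) = interleave c e i \<and>
    interleave (interleave c d) e (interleave (\<lambda>i. 4 * i + 2) (\<lambda>i. 2 * i + 1) i) = interleave d e i" for i
  proof (cases "even i")
    case True
    then obtain j where i: "i = 2 * j" by blast
    have "interleave (interleave c d) e (4 * j) = c j" "interleave (interleave c d) e (4 * j + 2) = d j"
      using interleave_simps(1)[of "interleave c d" e "2 * j"] interleave_simps(1)[of "interleave c d" e "2 * j + 1"] by simp_all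
    then show ?thesis by (simp add: i)
  next
    case False
    then obtain j where i: "i = 2 * j + 1" by (rule oddE)
    then show ?thesis by simp
  qed
  then show "(\<lambda>i. interleave (interleave c d) e (interleave (\<lambda>i. 4 * i) (\<lambda>i. 2 * i + 1) i)) = interleave c e"
    "(\<lambda>i. interleave (interleave c d) e (interleave (\<lambda>i. 4 * i + 2) (\<lambda>i. 2 * i + 1) i)) = interleave d e"
    by blast+
qed

text \<open>Even-numbered variables carry the parameters and odd-numbered ones the arguments, so that
  parameters of two formulas can be merged by renaming.\<close>

definition rep_tm :: "((nat \<Rightarrow> 'm::discrete_ordered_semiring) \<Rightarrow> 'm) \<Rightarrow> tm \<Rightarrow> (nat \<Rightarrow> 'm) \<Rightarrow> bool" where
  "rep_tm t \<tau> c \<longleftrightarrow> (\<forall>e. t e = tm_val (interleave c e) \<tau>)"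

definition rep_fm ::
  "((nat \<Rightarrow> 'm::discrete_ordered_semiring) \<Rightarrow> 'm set \<Rightarrow> bool) \<Rightarrow> fm \<Rightarrow> (nat \<Rightarrow> 'm) \<Rightarrow> (nat \<Rightarrow> 'm set) \<Rightarrow> bool" where
  "rep_fm P \<phi> c E \<longleftrightarrow> bounded_fm \<phi> \<and> (\<forall>e Z. P e Z \<longleftrightarrow> sat (interleave c e) (push Z E) \<phi>)"

lemma rep_tm_extend:
  assumes "rep_tm t \<tau> c" shows "\<exists>\<tau>. rep_tm t \<tau> (interleave c d)" "\<exists>\<tau>. rep_tm t \<tau> (interleave d c)"
proof -
  have "rep_tm t (rename_tm (interleave (\<lambda>i. 4 * i) (\<lambda>i. 2 * i + 1)) \<tau>) (interleave c d)"
    "rep_tm t (rename_tm (interleave (\<lambda>i. 4 * i + 2) (\<lambda>i. 2 * i + 1)) \<tau>) (interleave d c)"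
    using assms by (simp_all only: rep_tm_def tm_val_rename_tm interleave_ren simp_thms)
  then show "\<exists>\<tau>. rep_tm t \<tau> (interleave c d)" "\<exists>\<tau>. rep_tm t \<tau> (interleave d c)" by blast+
qed

lemma rep_tm2:
  assumes "rep_tm t \<tau> c" "rep_tm u \<upsilon> d" shows "\<exists>\<tau> \<upsilon> c. rep_tm t \<tau> c \<and> rep_tm u \<upsilon> c"
  using rep_tm_extend[OF assms(1)] rep_tm_extend[OF assms(2)] by blast

lemma tm_fun_rep: "tm_fun t \<Longrightarrow> \<exists>\<tau> c. rep_tm t \<tau> c"
proof (induction rule: tm_fun.induct)
  case (tm_fun_var i)
  have "rep_tm (\<lambda>e. e i) (Var (Suc (2 * i))) (\<lambda>_. 0)" by (simp add: rep_tm_def)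
  then show ?case by blast
next
  case (tm_fun_const c)
  have "interleave (\<lambda>_. c) e 0 = c" for e by (simp add: interleave_def)
  then have "rep_tm (\<lambda>e. c) (Var 0) (\<lambda>_. c)" by (simp add: rep_tm_def)
  then show ?case by blast
next
  case (tm_fun_add t u)
  then obtain \<tau> \<upsilon> c where "rep_tm t \<tau> c" "rep_tm u \<upsilon> c" using rep_tm2 by blast
  then have "rep_tm (\<lambda>e. t e + u e) (Add \<tau> \<upsilon>) c" by (simp add: rep_tm_def)
  then show ?case by blast
next
  case (tm_fun_mult t u)
  then obtain \<tau> \<upsilon> c where "rep_tm t \<tau> c" "rep_tm u \<upsilon> c" using rep_tm2 by blast
  then have "rep_tm (\<lambda>e. t e * u e) (Mul \<tau> \<upsilon>) c" by (simp add: rep_tm_def)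
  then show ?case by blast
qed

text \<open>Set variable 0 holds the set argument and stays fixed; only the set parameters behind it
  are renumbered when two environments are merged.\<close>

definition shift_ren :: "(nat \<Rightarrow> nat) \<Rightarrow> nat \<Rightarrow> nat" where
  "shift_ren q = case_nat 0 (\<lambda>i. Suc (q i))"

lemma rep_fm_extend:
  assumes "rep_fm P \<phi> c E"
  shows "\<exists>\<phi>. rep_fm P \<phi> (interleave c d) (interleave E F)" "\<exists>\<phi>. rep_fm P \<phi> (interleave d c) (interleave F E)"
proof -
  have 1: "(\<lambda>i. case_nat Z (interleave E F) (shift_ren (\<lambda>i. 2 * i) i)) = case_nat Z E"
    "(\<lambda>i. case_nat Z (interleave F E) (shift_ren (\<lambda>i. Suc (2 * i)) i)) = case_nat Z E" for Z
    by (auto simp: fun_eq_iff shift_ren_def split: nat.split)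
  have "rep_fm P (rename_fm (interleave (\<lambda>i. 4 * i) (\<lambda>i. 2 * i + 1)) (shift_ren (\<lambda>i. 2 * i)) \<phi>) (interleave c d) (interleave E F)"
    "rep_fm P (rename_fm (interleave (\<lambda>i. 4 * i + 2) (\<lambda>i. 2 * i + 1)) (shift_ren (\<lambda>i. Suc (2 * i))) \<phi>) (interleave d c) (interleave F E)"
    using assms by (simp_all only: rep_fm_def sat_rename_fm interleave_ren bounded_rename_fm 1 simp_thms)
  then show "\<exists>\<phi>. rep_fm P \<phi> (interleave c d) (interleave E F)" "\<exists>\<phi>. rep_fm P \<phi> (interleave d c) (interleave F E)" by blast+
qed

lemma range_interleave: "range E \<subseteq> S \<Longrightarrow> range F \<subseteq> S \<Longrightarrow> range (interleave E F) \<subseteq> S"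
  by (auto simp: interleave_def image_subset_iff)

text \<open>Return to syntax: the axioms of the model speak about formulas, so every semantic
  predicate needs one. Conjunction forces the parameters of two representations into a common
  environment.\<close>

lemma Delta0_rep:
  assumes "Delta0 S P" and "S \<noteq> {}"
  shows "\<exists>\<phi> c E. rep_fm P \<phi> c E \<and> range E \<subseteq> S"
  using assms
proof (induction rule: Delta0.induct)
  obtain A where A: "A \<in> S" using assms(2) by blast
  have tmfm: "\<exists>\<tau> \<upsilon> c (E :: nat \<Rightarrow> 'a set). rep_tm t \<tau> c \<and> rep_tm u \<upsilon> c \<and> range E \<subseteq> S"
    if "tm_fun t" "tm_fun u" for t u :: "(nat \<Rightarrow> 'a) \<Rightarrow> 'a"
  proof -
    have "range (\<lambda>_. A) \<subseteq> S" using A by auto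
    then show ?thesis using tm_fun_rep[OF that(1)] tm_fun_rep[OF that(2)] rep_tm2 by meson
  qed
  {
    case (Delta0_eq t u)
    from tmfm[OF this(1,2)] obtain \<tau> \<upsilon> c and E :: "nat \<Rightarrow> 'a set" where "rep_tm t \<tau> c" "rep_tm u \<upsilon> c" and E: "range E \<subseteq> S" by blast
    then have "rep_fm (\<lambda>e Z. t e = u e) (Eq \<tau> \<upsilon>) c E" by (simp add: rep_tm_def rep_fm_def)
    with E show ?case by blast
  next
    case (Delta0_less t u)
    from tmfm[OF this(1,2)] obtain \<tau> \<upsilon> c and E :: "nat \<Rightarrow> 'a set" where "rep_tm t \<tau> c" "rep_tm u \<upsilon> c" and E: "range E \<subseteq> S" by blast
    then have "rep_fm (\<lambda>e Z. t e < u e) (Less \<tau> \<upsilon>) c E" by (simp add: rep_tm_def rep_fm_def)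
    with E show ?case by blast
  next
    case (Delta0_mem B t)
    from tm_fun_rep[OF this(2)] obtain \<tau> c where "rep_tm t \<tau> c" by blast
    then have "rep_fm (\<lambda>e Z. t e \<in> B) (Mem \<tau> 1) c (\<lambda>_. B)" by (simp add: rep_tm_def rep_fm_def)
    with \<open>B \<in> S\<close> show ?case by blast
  next
    case (Delta0_mem_arg t)
    from tmfm[OF this(1) this(1)] obtain \<tau> c and E :: "nat \<Rightarrow> 'a set" where "rep_tm t \<tau> c" and E: "range E \<subseteq> S" by blast
    then have "rep_fm (\<lambda>e Z. t e \<in> Z) (Mem \<tau> 0) c E" by (simp add: rep_tm_def rep_fm_def)
    with E show ?case by blast
  next
    case (Delta0_not P)
    then obtain \<phi> c E where "rep_fm P \<phi> c E" and E: "range E \<subseteq> S" by blast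
    then have "rep_fm (\<lambda>e Z. \<not> P e Z) (Neg \<phi>) c E" by (simp add: rep_fm_def)
    with E show ?case by blast
  next
    case (Delta0_conj P Q)
    from Delta0_conj.IH(1)[OF Delta0_conj.prems] obtain \<phi> c E where 1: "rep_fm P \<phi> c E" "range E \<subseteq> S" by blast
    from Delta0_conj.IH(2)[OF Delta0_conj.prems] obtain \<psi> d F where 2: "rep_fm Q \<psi> d F" "range F \<subseteq> S" by blast
    from rep_fm_extend(1)[OF 1(1), of d F] obtain \<phi> where 3: "rep_fm P \<phi> (interleave c d) (interleave E F)" by blast
    from rep_fm_extend(2)[OF 2(1), of c E] obtain \<psi> where 4: "rep_fm Q \<psi> (interleave c d) (interleave E F)" by blast
    from 3 4 have "rep_fm (\<lambda>e Z. P e Z \<and> Q e Z) (Conj \<phi> \<psi>) (interleave c d) (interleave E F)" by (simp add: rep_fm_def)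
    with range_interleave[OF 1(2) 2(2)] show ?case by blast
  next
    case (Delta0_bex t Q)
    from Delta0_bex.IH[OF Delta0_bex.prems] obtain \<phi> d E
      where 1: "rep_fm (\<lambda>e. Q (\<lambda>i. e (Suc i)) (e 0)) \<phi> d E" "range E \<subseteq> S" by blast
    from tm_fun_rep[OF Delta0_bex.hyps(1)] obtain \<tau> c where 2: "rep_tm t \<tau> c" by blast
    from rep_tm_extend(1)[OF 2, of d] obtain \<tau> where 3: "rep_tm t \<tau> (interleave c d)" by blast
    from rep_fm_extend(2)[OF 1(1), of c E] obtain \<phi>
      where 4: "rep_fm (\<lambda>e. Q (\<lambda>i. e (Suc i)) (e 0)) \<phi> (interleave c d) (interleave E E)" by blast
    \<comment> \<open>The body was represented with the bound value as argument 0, that is, at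
      variable 1. As a de Bruijn variable it has to be 0; parameters and other arguments move
      accordingly.\<close>
    let ?r = "interleave (\<lambda>i. Suc (2 * i)) (case_nat 0 (\<lambda>i. Suc (Suc (2 * i))))"
    have r: "(\<lambda>i. case_nat x (interleave c d) (?r i)) = interleave c (case_nat x d)" for x :: 'a and c d
    proof
      fix i
      show "case_nat x (interleave c d) (?r i) = interleave c (case_nat x d) i"
        by (cases "even i"; cases "i div 2") (auto simp: interleave_def)
    qed
    have q: "sat (case_nat x (interleave (interleave c d) e)) (push Z (interleave E E)) (rename_fm ?r id \<phi>) \<longleftrightarrow> Q e x Z" for e x Z
    proof -
      have "Q (\<lambda>i. case_nat x e (Suc i)) (case_nat x e 0) Z \<longleftrightarrow>
          sat (interleave (interleave c d) (case_nat x e)) (push Z (interleave E E)) \<phi>"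
        using 4 unfolding rep_fm_def by blast
      then show ?thesis unfolding sat_rename_fm r id_apply by simp
    qed
    have b: "bounded_fm (rename_fm ?r id \<phi>)"
      using 4 unfolding rep_fm_def by (intro bounded_rename_fm) blast
    have t: "tm_val (interleave (interleave c d) e) \<tau> = t e" for e using 3 by (simp add: rep_tm_def)
    have "rep_fm (\<lambda>e Z. \<exists>x<t e. Q e x Z) (BExists \<tau> (rename_fm ?r id \<phi>)) (interleave c d) (interleave E E)"
      by (simp only: rep_fm_def bounded_fm.simps sat.simps q b t simp_thms)
    with range_interleave[OF 1(2) 1(2)] show ?case by blast
  }
qed


section \<open>Induction and comprehension\<close>

lemma less_add_one_iff: "a < b + 1 \<longleftrightarrow> a \<le> b" for a b :: "'m::discrete_ordered_semiring"
  by (simp add: less_eq_iff_succ_less)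

lemma add_one_le_iff: "a + 1 \<le> b \<longleftrightarrow> a < b" for a b :: "'m::discrete_ordered_semiring"
  by (simp add: less_iff_succ_less_eq)

lemma not_less_zero: "\<not> a < 0" for a :: "'m::discrete_ordered_semiring"
  by (simp add: not_less zero_least)

lemma zero_or_succ: "a = 0 \<or> (\<exists>b. a = b + 1)" for a :: "'m::discrete_ordered_semiring"
proof (cases "a = 0")
  case False
  then have "0 < a" using zero_least[of a] by simp
  then have "0 + 1 \<le> a" by (simp only: add_one_le_iff)
  then have "a = a - 1 + 1" by simp
  then show ?thesis by blast
qed simp

lemma le_add_same: "a \<le> a + b" "b \<le> a + b" for a b :: "'m::discrete_ordered_semiring"
  by (simp_all add: zero_least)

lemma le_imp_add: "a \<le> b \<Longrightarrow> \<exists>c. b = a + c" for a b :: "'m::discrete_ordered_semiring"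
  by (metis le_add_diff_inverse)

lemma le_square: "a \<le> a * a" for a :: "'m::discrete_ordered_semiring"
  using zero_or_succ[of a] mult_left_mono[of 1 a a] by (auto simp: zero_least algebra_simps)

lemma le_pair1: "x \<le> pair x y" and le_pair2: "y \<le> pair x y"
  unfolding pair_def using le_add_same le_square order_trans by metis+

text \<open>With \<open>s = x + y\<close>, the code lies between the square of \<open>s\<close> and
  the square of \<open>s + 1\<close>, the latter excluded. So it determines the sum and then
  \<open>x\<close>.\<close>

lemma pair_inject: "pair x y = pair x' y' \<longleftrightarrow> x = x' \<and> y = y'"
proof -
  have lt: "pair x y < pair x' y'" if "x + y < x' + y'" for x y x' y' :: 'a
  proof -
    let ?s = "x + y" let ?t = "x' + y'"
    have "pair x y < (?s + 1) * (?s + 1)"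
    proof -
      have "x \<le> ?s + ?s" using le_add_same order_trans by metis
      then have "?s * ?s + x < ?s * ?s + (?s + ?s + 1)"
        by (intro add_strict_left_mono) (simp only: less_add_one_iff)
      also have "\<dots> = (?s + 1) * (?s + 1)" by (simp add: algebra_simps)
      finally show ?thesis unfolding pair_def .
    qed
    also have "\<dots> \<le> ?t * ?t" using that by (intro mult_mono) (simp_all add: add_one_le_iff zero_least)
    also have "\<dots> \<le> pair x' y'" unfolding pair_def by (simp add: zero_least)
    finally show ?thesis .
  qed
  show ?thesis
  proof
    assume eq: "pair x y = pair x' y'"
    then have "x + y = x' + y'" using lt[of x y x' y'] lt[of x' y' x y] by (metis less_irrefl neqE)
    with eq show "x = x' \<and> y = y'" unfolding pair_def by simp
  qed simp
qed

lemma Delta0_rep3: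
  assumes "Delta0 S (\<lambda>e Z. R (e 0) (e 1) (e 2) Z)" and "S \<noteq> {}"
  shows "\<exists>\<theta> c E. bounded_fm \<theta> \<and> range E \<subseteq> S \<and>
    (\<forall>w n x Z. sat (push w (push n (push x c))) (push Z E) \<theta> \<longleftrightarrow> R w n x Z)"
proof -
  obtain \<phi> c E where \<phi>: "rep_fm (\<lambda>e. R (e 0) (e 1) (e 2)) \<phi> c E" "range E \<subseteq> S"
    using Delta0_rep[OF assms] by blast
  \<comment> \<open>The three arguments become variables 0, 1, 2, the order found in
    \<open>sat3\<close> below its quantifier, and the parameters follow from 3 on. All later
    arguments are identified with the third.\<close>
  let ?r = "interleave (\<lambda>i. i + 3) (\<lambda>i. if i = 0 then 0 else if i = 1 then 1 else 2)"
  have r: "(\<lambda>i. push w (push n (push x c)) (?r i)) = interleave c (push w (push n (\<lambda>_. x)))" for w n x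
    by (auto simp: fun_eq_iff interleave_def numeral_3_eq_3 numeral_2_eq_2 split: nat.split)
  have "sat (push w (push n (push x c))) (push Z E) (rename_fm ?r id \<phi>) \<longleftrightarrow> R w n x Z" for w n x Z
  proof -
    have "sat (interleave c (push w (push n (\<lambda>_. x)))) (push Z E) \<phi> \<longleftrightarrow>
        R ((push w (push n (\<lambda>_. x))) 0) ((push w (push n (\<lambda>_. x))) 1) ((push w (push n (\<lambda>_. x))) 2) Z"
      using \<phi> unfolding rep_fm_def by blast
    then show ?thesis unfolding sat_rename_fm r id_apply by (simp add: numeral_2_eq_2)
  qed
  moreover have "bounded_fm (rename_fm ?r id \<phi>)" using \<phi> unfolding rep_fm_def by (intro bounded_rename_fm) blast
  ultimately show ?thesis using \<phi>(2) by blast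
qed

lemma Delta0_inst_shift: "Delta0 S P \<Longrightarrow> Delta0 S (\<lambda>e. P (\<lambda>i. e (Suc i)))"
  by (rule Delta0_subst[where f = "\<lambda>e i. e (Suc i)"]) (simp_all add: tm_fun_var)

section \<open>Closure properties of \<Sigma>1 predicates, induction and least elements\<close>

definition Sigma1 :: "'m::discrete_ordered_semiring set set \<Rightarrow> ((nat \<Rightarrow> 'm) \<Rightarrow> bool) \<Rightarrow> bool" where
  "Sigma1 S P \<longleftrightarrow> (\<exists>Q. Delta0 S (\<lambda>e Z. Q (\<lambda>i. e (Suc i)) (e 0)) \<and> (\<forall>e. P e \<longleftrightarrow> (\<exists>x. Q e x)))"

lemma Sigma1_Delta0: "Delta0 S (\<lambda>e Z. P e) \<Longrightarrow> Sigma1 S P"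
  unfolding Sigma1_def using Delta0_inst_shift[of S "\<lambda>e Z. P e"] by (intro exI[of _ "\<lambda>e x. P e"]) simp

text \<open>Two unbounded witnesses are merged by one common bound for both, which keeps the matrix
  bounded without projections of pairs.\<close>

lemma Sigma1_ex:
  assumes "Sigma1 S (\<lambda>e. P (\<lambda>i. e (Suc i)) (e 0))"
  shows "Sigma1 S (\<lambda>e. \<exists>x. P e x)"
proof -
  obtain Q where Q: "Delta0 S (\<lambda>e Z. Q (\<lambda>i. e (Suc i)) (e 0))"
    and P: "\<And>e. P (\<lambda>i. e (Suc i)) (e 0) \<longleftrightarrow> (\<exists>x. Q e x)"
    using assms unfolding Sigma1_def by blast
  have P': "P e x \<longleftrightarrow> (\<exists>y. Q (case_nat x e) y)" for e x using P[of "case_nat x e"] by simp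
  let ?f = "\<lambda>e::nat \<Rightarrow> 'a. case_nat (e 0) (case_nat (e (Suc 0)) (\<lambda>i. e (Suc (Suc (Suc i)))))"
  have "tm_fun (\<lambda>e. ?f e i)" for i by (intro tm_fun_push tm_fun_var)
  from Delta0_subst[where f = ?f, OF Q this]
  have "Delta0 S (\<lambda>e Z. Q (case_nat (e (Suc 0)) (\<lambda>i. e (Suc (Suc (Suc i))))) (e 0))" by simp
  then have 1: "Delta0 S (\<lambda>e Z. \<exists>x\<le>e 0. \<exists>y\<le>e 0. Q (case_nat x (\<lambda>i. e (Suc i))) y)"
    by (intro Delta0_bex_le tm_fun_var) simp
  show ?thesis unfolding Sigma1_def
  proof (intro exI conjI allI)
    show "Delta0 S (\<lambda>e Z. (\<lambda>e z. \<exists>x\<le>z. \<exists>y\<le>z. Q (case_nat x e) y) (\<lambda>i. e (Suc i)) (e 0))" using 1 by simp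
    fix e
    show "(\<exists>x. P e x) \<longleftrightarrow> (\<exists>z. \<exists>x\<le>z. \<exists>y\<le>z. Q (case_nat x e) y)"
      unfolding P' by (meson le_add_same)
  qed
qed

lemma Sigma1_conj:
  assumes "Sigma1 S P" "Sigma1 S P'" shows "Sigma1 S (\<lambda>e. P e \<and> P' e)"
proof -
  obtain Q where Q: "Delta0 S (\<lambda>e Z. Q (\<lambda>i. e (Suc i)) (e 0))" and P: "\<And>e. P e \<longleftrightarrow> (\<exists>x. Q e x)"
    using assms(1) unfolding Sigma1_def by blast
  obtain Q' where Q': "Delta0 S (\<lambda>e Z. Q' (\<lambda>i. e (Suc i)) (e 0))" and P': "\<And>e. P' e \<longleftrightarrow> (\<exists>x. Q' e x)"
    using assms(2) unfolding Sigma1_def by blast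
  let ?f = "\<lambda>e::nat \<Rightarrow> 'a. case_nat (e 1) (\<lambda>i. e (Suc (Suc i)))"
  have "tm_fun (\<lambda>e. ?f e i)" for i by (intro tm_fun_push tm_fun_var)
  from Delta0_subst[where f = ?f, OF Q this]
  have "Delta0 S (\<lambda>e Z. Q (\<lambda>i. e (Suc (Suc i))) (e 1))" by simp
  moreover
  let ?f = "\<lambda>e::nat \<Rightarrow> 'a. case_nat (e 0) (\<lambda>i. e (Suc (Suc i)))"
  have "tm_fun (\<lambda>e. ?f e i)" for i by (intro tm_fun_push tm_fun_var)
  from Delta0_subst[where f = ?f, OF Q' this]
  have "Delta0 S (\<lambda>e Z. Q' (\<lambda>i. e (Suc (Suc i))) (e 0))" by simp
  ultimately have "Sigma1 S (\<lambda>e. Q (\<lambda>i. e (Suc (Suc i))) (e 1) \<and> Q' (\<lambda>i. e (Suc (Suc i))) (e 0))"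
    by (intro Sigma1_Delta0 Delta0_conj)
  then have "Sigma1 S (\<lambda>e. \<exists>x. \<exists>y. Q e x \<and> Q' e y)"
    by (intro Sigma1_ex) simp
  then show ?thesis unfolding P P' by simp
qed

lemma Sigma1_bex:
  assumes "tm_fun t" "Sigma1 S (\<lambda>e. P (\<lambda>i. e (Suc i)) (e 0))"
  shows "Sigma1 S (\<lambda>e. \<exists>x<t e. P e x)"
proof -
  have "tm_fun (\<lambda>e. t (\<lambda>i. e (Suc i)))" by (rule tm_fun_subst[OF assms(1)]) (rule tm_fun_var)
  then have "Sigma1 S (\<lambda>e. e 0 < t (\<lambda>i. e (Suc i)) \<and> P (\<lambda>i. e (Suc i)) (e 0))"
    by (intro Sigma1_conj assms Sigma1_Delta0 Delta0_less tm_fun_var)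
  then show ?thesis by (rule Sigma1_ex)
qed

lemma Sigma1_disj:
  assumes "Sigma1 S P" "Sigma1 S P'" shows "Sigma1 S (\<lambda>e. P e \<or> P' e)"
proof -
  obtain Q where Q: "Delta0 S (\<lambda>e Z. Q (\<lambda>i. e (Suc i)) (e 0))" and P: "\<And>e. P e \<longleftrightarrow> (\<exists>x. Q e x)"
    using assms(1) unfolding Sigma1_def by blast
  obtain Q' where Q': "Delta0 S (\<lambda>e Z. Q' (\<lambda>i. e (Suc i)) (e 0))" and P': "\<And>e. P' e \<longleftrightarrow> (\<exists>x. Q' e x)"
    using assms(2) unfolding Sigma1_def by blast
  have "Delta0 S (\<lambda>e Z. Q (\<lambda>i. e (Suc i)) (e 0) \<or> Q' (\<lambda>i. e (Suc i)) (e 0))"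
    using Q Q' by (rule Delta0_disj)
  then have "Sigma1 S (\<lambda>e. \<exists>x. Q e x \<or> Q' e x)" unfolding Sigma1_def by (intro exI[of _ "\<lambda>e x. Q e x \<or> Q' e x"]) simp
  then show ?thesis unfolding P P' by (simp add: ex_disj_distrib)
qed

locale rca =
  fixes S :: "'m::discrete_ordered_semiring set set"
  assumes RCA0: "RCA0 S"
begin

lemma S_nonempty: "S \<noteq> {}" using RCA0 by (simp add: RCA0_def)

lemma Sigma1_rep:
  assumes "Sigma1 S (\<lambda>e. P (e 0))"
  shows "\<exists>\<theta> c E. bounded_fm \<theta> \<and> range E \<subseteq> S \<and> (\<forall>n. P n \<longleftrightarrow> sat (push n c) E (Exists \<theta>))"
proof -
  obtain Q where Q: "Delta0 S (\<lambda>e Z. Q (\<lambda>i. e (Suc i)) (e 0))" and P: "\<And>e. P (e 0) \<longleftrightarrow> (\<exists>x. Q e x)"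
    using assms unfolding Sigma1_def by blast
  obtain A where A: "A \<in> S" using S_nonempty by blast
  let ?f = "\<lambda>e::nat \<Rightarrow> 'm. case_nat (e 0) (\<lambda>_. e 1)"
  have "tm_fun (\<lambda>e. ?f e i)" for i by (intro tm_fun_push tm_fun_var)
  note q = Delta0_subst[where f = ?f, OF Q this]
  define R where "R w n x Z \<longleftrightarrow> Q (\<lambda>_. n) w" for w n x :: 'm and Z :: "'m set"
  have "Delta0 S (\<lambda>e Z. R (e 0) (e 1) (e 2) Z)" using q unfolding R_def by simp
  note Delta0_rep3[where R = R, OF this S_nonempty]
  then obtain \<theta> c E where \<theta>: "bounded_fm \<theta>" "range E \<subseteq> S"
    "\<forall>w n x Z. sat (push w (push n (push x c))) (push Z E) \<theta> \<longleftrightarrow> R w n x Z"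
    by (elim exE conjE) (rule that)
  have "range (push A E) \<subseteq> S" using A \<theta>(2) by (auto simp: image_subset_iff split: nat.split)
  moreover have "P n \<longleftrightarrow> sat (push n (push 0 c)) (push A E) (Exists \<theta>)" for n
    using P[of "\<lambda>_. n"] by (simp add: \<theta>(3) R_def)
  ultimately show ?thesis using \<theta>(1) by blast
qed

lemma Sigma1_induct:
  assumes "Sigma1 S (\<lambda>e. P (e 0))" "P 0" "\<And>n. P n \<Longrightarrow> P (n + 1)"
  shows "P n"
proof -
  obtain \<theta> c E where *: "bounded_fm \<theta>" "range E \<subseteq> S" "\<And>n. P n \<longleftrightarrow> sat (push n c) E (Exists \<theta>)"
    using Sigma1_rep[OF assms(1)] by blast
  have "Sigma01 (Exists \<theta>)" unfolding Sigma01_def using *(1) by blast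
  moreover have "Sigma01_induction S" using RCA0 by (simp add: RCA0_def)
  ultimately show ?thesis using *(2) assms(2,3) unfolding Sigma01_induction_def *(3) by blast
qed

text \<open>The axiom asks for both formulas over the same parameters, so the two environments are
  interleaved; the formula for the complement becomes \<Pi>1 by negating its matrix.\<close>

lemma Delta1_comprehension:
  assumes "Sigma1 S (\<lambda>e. P (e 0))" "Sigma1 S (\<lambda>e. \<not> P (e 0))"
  shows "{n. P n} \<in> S"
proof -
  obtain \<theta> c E where 1: "bounded_fm \<theta>" "range E \<subseteq> S" "\<And>n. P n \<longleftrightarrow> sat (push n c) E (Exists \<theta>)"
    using Sigma1_rep[OF assms(1)] by blast
  obtain \<eta> d F where 2: "bounded_fm \<eta>" "range F \<subseteq> S" "\<And>n. \<not> P n \<longleftrightarrow> sat (push n d) F (Exists \<eta>)"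
    using Sigma1_rep[OF assms(2)] by blast
  let ?r = "case_nat 0 (\<lambda>i. Suc (2 * i))" and ?q = "case_nat 0 (\<lambda>i. Suc (Suc (2 * i)))"
  have r: "(\<lambda>i. push n (interleave c d) (?r i)) = push n c" "(\<lambda>i. push n (interleave c d) (?q i)) = push n d" for n
    by (auto simp: fun_eq_iff split: nat.split)
  have q: "(\<lambda>i. interleave E F (2 * i)) = E" "(\<lambda>i. interleave E F (Suc (2 * i))) = F"
    by (auto simp: fun_eq_iff)
  let ?\<phi> = "rename_fm ?r (\<lambda>i. 2 * i) (Exists \<theta>)" and ?\<psi> = "rename_fm ?q (\<lambda>i. Suc (2 * i)) (Forall (Neg \<eta>))"
  have \<phi>: "sat (push n (interleave c d)) (interleave E F) ?\<phi> \<longleftrightarrow> P n" for n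
    unfolding sat_rename_fm r q 1(3) ..
  have \<psi>: "sat (push n (interleave c d)) (interleave E F) ?\<psi> \<longleftrightarrow> P n" for n
    unfolding sat_rename_fm r q using 2(3)[of n] by auto
  have D: "Delta01_comprehension S" using RCA0 by (simp add: RCA0_def)
  have "{n. sat (push n (interleave c d)) (interleave E F) ?\<phi>} \<in> S"
  proof (rule D[unfolded Delta01_comprehension_def, rule_format, where \<psi> = ?\<psi>], intro conjI allI)
    show "Sigma01 ?\<phi>" unfolding Sigma01_def using bounded_rename_fm[OF 1(1)] by auto
    show "Pi01 ?\<psi>" unfolding Pi01_def using bounded_rename_fm[OF 2(1)] by auto
    show "range (interleave E F) \<subseteq> S" using 1(2) 2(2) by (rule range_interleave)
  qed (simp only: \<phi> \<psi>)
  then show ?thesis unfolding \<phi> .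
qed

lemma Delta0_comprehension: "Delta0 S (\<lambda>e Z. P (e 0)) \<Longrightarrow> {n. P n} \<in> S"
  by (intro Delta1_comprehension Sigma1_Delta0 Delta0_not)

text \<open>Induction on the length of the initial segment that already has a common bound. The
  condition \<open>i < k\<close> sits inside the formula because witnesses are promised only below
  \<open>k\<close>, while the induction runs over all numbers.\<close>

lemma collection:
  assumes "Delta0 S (\<lambda>e Z. R (e 0) (e 1))" "\<And>i. i < k \<Longrightarrow> \<exists>w. R i w"
  shows "\<exists>b. \<forall>i<k. \<exists>w<b. R i w"
proof -
  have "\<exists>b. \<forall>i<n. i < k \<longrightarrow> (\<exists>w<b. R i w)" for n
  proof (rule Sigma1_induct[where P = "\<lambda>n. \<exists>b. \<forall>i<n. i < k \<longrightarrow> (\<exists>w<b. R i w)"])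
    have "Delta0 S (\<lambda>e Z. R (e 1) (e 0))" by (rule Delta0_inst2[OF assms(1)]) (rule tm_fun_var)+
    then have "Delta0 S (\<lambda>e Z. R (e (Suc 0)) (e 0))" by simp
    then show "Sigma1 S (\<lambda>e. \<exists>b. \<forall>i<e 0. i < k \<longrightarrow> (\<exists>w<b. R i w))"
      by (intro Sigma1_ex Sigma1_Delta0 Delta0_ball Delta0_imp Delta0_bex Delta0_less tm_fun_var tm_fun_const) (rule Delta0_inst2[OF assms(1)] tm_fun_var)+
  next
    show "\<exists>b. \<forall>i<0. i < k \<longrightarrow> (\<exists>w<b. R i w)" by (simp add: not_less_zero)
  next
    fix n assume "\<exists>b. \<forall>i<n. i < k \<longrightarrow> (\<exists>w<b. R i w)"
    then obtain b where b: "\<And>i. i < n \<Longrightarrow> i < k \<Longrightarrow> \<exists>w<b. R i w" by blast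
    obtain w where w: "n < k \<Longrightarrow> R n w" using assms(2) by blast
    have "\<exists>w'<max b (w + 1). R i w'" if "i < n + 1" "i < k" for i
    proof (cases "i = n")
      case True
      with w that show ?thesis by (intro exI[of _ w]) (simp add: less_max_iff_disj less_add_one_iff)
    next
      case False
      with that have "i < n" by (simp add: less_add_one_iff)
      from b[OF this that(2)] show ?thesis by (auto simp: less_max_iff_disj)
    qed
    then show "\<exists>b. \<forall>i<n + 1. i < k \<longrightarrow> (\<exists>w<b. R i w)" by blast
  qed
  then show ?thesis by blast
qed

text \<open>Collection moves the unbounded witness quantifier in front of the bounded one, as a
  bound for all witnesses at once.\<close>

lemma Sigma1_ball:
  assumes "tm_fun t" "Sigma1 S (\<lambda>e. P (\<lambda>i. e (Suc i)) (e 0))"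
  shows "Sigma1 S (\<lambda>e. \<forall>x<t e. P e x)"
proof -
  obtain Q where Q: "Delta0 S (\<lambda>e Z. Q (\<lambda>i. e (Suc i)) (e 0))"
    and P: "\<And>e. P (\<lambda>i. e (Suc i)) (e 0) \<longleftrightarrow> (\<exists>x. Q e x)"
    using assms(2) unfolding Sigma1_def by blast
  have P': "P e x \<longleftrightarrow> (\<exists>y. Q (case_nat x e) y)" for e x using P[of "case_nat x e"] by simp
  have eq: "(\<forall>x<t e. P e x) \<longleftrightarrow> (\<exists>b. \<forall>x<t e. \<exists>y<b. Q (case_nat x e) y)" for e
  proof
    assume *: "\<forall>x<t e. P e x"
    let ?f = "\<lambda>e'::nat \<Rightarrow> 'm. case_nat (e' 1) (case_nat (e' 0) e)"
    have "tm_fun (\<lambda>e. ?f e i)" for i by (intro tm_fun_push tm_fun_var tm_fun_const)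
    from Delta0_subst[where f = ?f, OF Q this]
    have "Delta0 S (\<lambda>e' Z. Q (case_nat (e' 0) e) (e' 1))" by simp
    then show "\<exists>b. \<forall>x<t e. \<exists>y<b. Q (case_nat x e) y"
      by (rule collection[where R = "\<lambda>x y. Q (case_nat x e) y"]) (use * P' in blast)
  qed (auto simp: P')
  let ?f = "\<lambda>e::nat \<Rightarrow> 'm. case_nat (e 0) (case_nat (e (Suc 0)) (\<lambda>i. e (Suc (Suc (Suc i)))))"
  have "tm_fun (\<lambda>e. ?f e i)" for i by (intro tm_fun_push tm_fun_var)
  from Delta0_subst[where f = ?f, OF Q this]
  have "Delta0 S (\<lambda>e Z. Q (case_nat (e (Suc 0)) (\<lambda>i. e (Suc (Suc (Suc i))))) (e 0))" by simp
  then have "Delta0 S (\<lambda>e Z. \<exists>y<e 1. Q (case_nat (e 0) (\<lambda>i. e (Suc (Suc i)))) y)"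
    by (intro Delta0_bex tm_fun_var)
  moreover have "tm_fun (\<lambda>e. t (\<lambda>i. e (Suc i)))" by (rule tm_fun_subst[OF assms(1)]) (rule tm_fun_var)
  ultimately have "Sigma1 S (\<lambda>e. \<exists>b. \<forall>x<t e. \<exists>y<b. Q (case_nat x e) y)"
    by (intro Sigma1_ex Sigma1_Delta0 Delta0_ball) simp_all
  then show ?thesis unfolding eq .
qed

lemma Sigma1_imp: "Delta0 S (\<lambda>e Z. \<not> P e) \<Longrightarrow> Sigma1 S Q \<Longrightarrow> Sigma1 S (\<lambda>e. P e \<longrightarrow> Q e)"
  unfolding imp_conv_disj by (rule Sigma1_disj[OF Sigma1_Delta0])

lemma Sigma1_less_induct:
  assumes "Sigma1 S (\<lambda>e. P (e 0))" "\<And>n. (\<And>m. m < n \<Longrightarrow> P m) \<Longrightarrow> P n"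
  shows "P n"
proof -
  have "\<forall>m<n. P m" for n
  proof (rule Sigma1_induct[where P = "\<lambda>n. \<forall>m<n. P m"])
    have "Sigma1 S (\<lambda>e. P (e 0))" by fact
    then show "Sigma1 S (\<lambda>e. \<forall>m<e 0. P m)" by (intro Sigma1_ball tm_fun_var)
  next
    fix n assume *: "\<forall>m<n. P m"
    then have "P n" using assms(2) by blast
    with * show "\<forall>m<n + 1. P m" by (metis less_add_one_iff le_less)
  qed (simp add: not_less_zero)
  then show ?thesis using less_add_one by blast
qed

text \<open>Least elements of \<Pi>1 predicates: course-of-values induction applies to the negation,
  which is \<Sigma>1.\<close>

lemma least_not_Sigma1:
  assumes "Sigma1 S (\<lambda>e. \<not> P (e 0))" "P a"
  obtains m where "P m" "\<And>n. n < m \<Longrightarrow> \<not> P n"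
proof -
  have "\<exists>m. P m \<and> (\<forall>n<m. \<not> P n)"
  proof (rule ccontr)
    assume no: "\<not> (\<exists>m. P m \<and> (\<forall>n<m. \<not> P n))"
    have "\<not> P a"
      by (rule Sigma1_less_induct[where P = "\<lambda>n. \<not> P n", OF assms(1)]) (use no in blast)
    then show False using assms(2) by blast
  qed
  then show thesis using that by blast
qed

lemma least_Delta0:
  assumes "Delta0 S (\<lambda>e Z. P (e 0))" "P a"
  obtains m where "P m" "\<And>n. n < m \<Longrightarrow> \<not> P n"
  by (rule least_not_Sigma1[OF Sigma1_Delta0[OF Delta0_not[OF assms(1)]], of a]) (use assms(2) in auto)

lemma least_Sigma1:
  assumes "Sigma1 S (\<lambda>e. P (e 0))" "P a"
  obtains m where "P m" "\<And>n. n < m \<Longrightarrow> \<not> P n"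
proof -
  have "\<exists>m. P m \<and> (\<forall>n<m. \<not> P n)"
  proof (rule ccontr)
    assume no: "\<not> (\<exists>m. P m \<and> (\<forall>n<m. \<not> P n))"
    \<comment> \<open>Here the negation of \<open>P\<close> is only \<Pi>1, so the induction counts
      instead: if every element had a smaller one, then after \<open>i\<close> descents from
      \<open>a\<close> some element would lie at least \<open>i\<close> below \<open>a\<close>,
      which is absurd for \<open>i = a + 1\<close>.\<close>
    have "\<exists>j. P j \<and> j + i \<le> a" for i
    proof (rule Sigma1_induct[where P = "\<lambda>i. \<exists>j. P j \<and> j + i \<le> a"])
      have "Sigma1 S (\<lambda>e. P (e 0))" by fact
      then show "Sigma1 S (\<lambda>e. \<exists>j. P j \<and> j + e 0 \<le> a)"
        by (intro Sigma1_ex Sigma1_conj Sigma1_Delta0[OF Delta0_le] tm_fun_var tm_fun_add tm_fun_const)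
    next
      show "\<exists>j. P j \<and> j + 0 \<le> a" using assms(2) by auto
    next
      fix i assume "\<exists>j. P j \<and> j + i \<le> a"
      then obtain j where j: "P j" "j + i \<le> a" by blast
      with no obtain j' where j': "P j'" "j' < j" by blast
      then have "j' + 1 + i \<le> j + i" by (simp add: add_one_le_iff)
      then have "j' + (i + 1) \<le> a" using j(2) by (simp add: algebra_simps)
      with j' show "\<exists>j. P j \<and> j + (i + 1) \<le> a" by blast
    qed
    then obtain j where "j + (a + 1) \<le> a" by blast
    then have "a + 1 \<le> a" using le_add_same(2)[of "a + 1" j] by (rule order_trans[rotated])
    then show False by (simp only: add_one_le_iff less_irrefl)
  qed
  then show ?thesis using that by blast
qed

end


section \<open>Codes of finite sets and sequences\<close>

lemma dvd_iff_bounded: "a dvd b \<longleftrightarrow> (\<exists>q\<le>b. b = a * q)" for a b :: "'m::discrete_ordered_semiring"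
proof
  assume "a dvd b"
  then obtain q where q: "b = a * q" by (rule dvdE)
  show "\<exists>q\<le>b. b = a * q"
  proof (cases "a = 0")
    case False
    then obtain a' where "a = a' + 1" using zero_or_succ by blast
    then have "b = a' * q + q" using q by (simp add: algebra_simps)
    then show ?thesis using q le_add_same(2) by blast
  qed (use q in auto)
qed auto

lemma Delta0_dvd: "tm_fun t \<Longrightarrow> tm_fun u \<Longrightarrow> Delta0 S (\<lambda>e Z. t e dvd u e)"
proof -
  have "Delta0 S (\<lambda>e Z. e 0 dvd e 1)" unfolding dvd_iff_bounded
    by (intro Delta0_rules)
  then show "tm_fun t \<Longrightarrow> tm_fun u \<Longrightarrow> Delta0 S (\<lambda>e Z. t e dvd u e)" by (rule Delta0_inst2)
qed

text \<open>Goedel's moduli are coprime, in the form of a cancellation law that avoids gcds. A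
  linear combination of two moduli leaves only the difference \<open>d + 1\<close> of their indices;
  this divides \<open>m\<close>, and \<open>m\<close> is invertible modulo each of the
  moduli.\<close>

lemma moduli_coprime:
  fixes m :: "'m::discrete_ordered_semiring"
  assumes m: "\<And>d. d < k \<Longrightarrow> (d + 1) dvd m" and "i < k" "j < k" "i \<noteq> j"
    and dvd: "(m * (i + 1) + 1) dvd n * (m * (j + 1) + 1)"
  shows "(m * (i + 1) + 1) dvd n"
proof -
  let ?p = "m * (i + 1) + 1" and ?q = "m * (j + 1) + 1"
  have "\<exists>d. d < k \<and> ?p dvd n * (d + 1)"
  proof (cases "i < j")
    case True
    then obtain d where "j = i + 1 + d" using le_imp_add[of "i + 1" j] by (auto simp: add_one_le_iff)
    then have d: "j = i + (d + 1)" by (simp add: algebra_simps)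
    \<comment> \<open>The multipliers are chosen so that the terms containing \<open>m\<close>
      cancel.\<close>
    have "n * (i + 1) * ?q + n * (d + 1) = n * (j + 1) * ?p" unfolding d by (simp add: algebra_simps)
    moreover have "?p dvd n * (i + 1) * ?q" using dvd by (metis dvd_mult2 mult.commute mult.left_commute)
    ultimately have "?p dvd n * (d + 1)" by (metis dvd_add_right_iff dvd_triv_right)
    moreover have "d < d + 1 + i" by (metis add_one_le_iff le_add_same(1))
    then have "d < k" using d \<open>j < k\<close> by (metis add.commute less_trans)
    ultimately show ?thesis by blast
  next
    case False
    with \<open>i \<noteq> j\<close> have "j < i" by simp
    then obtain d where "i = j + 1 + d" using le_imp_add[of "j + 1" i] by (auto simp: add_one_le_iff)
    then have d: "i = j + (d + 1)" by (simp add: algebra_simps)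
    have "n * (j + 1) * ?p + n * (d + 1) = n * (i + 1) * ?q" unfolding d by (simp add: algebra_simps)
    moreover have "?p dvd n * (i + 1) * ?q" using dvd by (metis dvd_mult2 mult.commute mult.left_commute)
    ultimately have "?p dvd n * (d + 1)" by (metis dvd_add_right_iff dvd_triv_right)
    moreover have "d < d + 1 + j" by (metis add_one_le_iff le_add_same(1))
    then have "d < k" using d \<open>i < k\<close> by (metis add.commute less_trans)
    ultimately show ?thesis by blast
  qed
  then obtain d where d: "d < k" "?p dvd n * (d + 1)" by blast
  obtain r where "m = (d + 1) * r" using m[OF d(1)] by (rule dvdE)
  then have "?p dvd n * m * (i + 1)" using d(2) by (metis dvd_mult2 mult.assoc)
  moreover have "n * m * (i + 1) + n = n * ?p" by (simp add: algebra_simps)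
  ultimately show ?thesis by (metis dvd_add_right_iff dvd_triv_right)
qed

text \<open>Total decoding: a number that is not a triple codes the empty set. Together with the
  bounded predicate \<open>code\<close> this function replaces the relation
  \<open>set_code\<close>.\<close>

definition coded :: "'m::discrete_ordered_semiring \<Rightarrow> 'm set" where
  "coded c = {i. \<exists>k m n. c = pair (pair k m) n \<and> i \<in> decode k m n}"

definition triple :: "'m::discrete_ordered_semiring \<Rightarrow> bool" where
  "triple c \<longleftrightarrow> (\<exists>k m n. c = pair (pair k m) n)"

definition code :: "'m::discrete_ordered_semiring \<Rightarrow> bool" where
  "code c \<longleftrightarrow> triple c \<and> (\<forall>c'<c. triple c' \<longrightarrow> coded c' \<noteq> coded c)"

lemma coded_pair: "coded (pair (pair k m) n) = decode k m n"
  by (auto simp: coded_def pair_inject)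

lemma triple_bounds:
  "k \<le> pair (pair k m) n" "m \<le> pair (pair k m) n" "n \<le> pair (pair k m) n"
  using le_pair1 le_pair2 order_trans by metis+

lemma coded_less: "i \<in> coded c \<Longrightarrow> i < c"
  using triple_bounds(1) by (auto simp: coded_def decode_def intro: less_le_trans)

lemma Delta0_coded: "tm_fun t \<Longrightarrow> tm_fun u \<Longrightarrow> Delta0 S (\<lambda>e Z. t e \<in> coded (u e))"
proof -
  have *: "i \<in> coded c \<longleftrightarrow>
    (\<exists>k\<le>c. \<exists>m\<le>c. \<exists>n\<le>c. c = pair (pair k m) n \<and> i < k \<and> (m * (i + 1) + 1) dvd n)" for i c :: 'a
  proof
    assume "i \<in> coded c"
    then obtain k m n where "c = pair (pair k m) n" "i < k" "(m * (i + 1) + 1) dvd n"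
      unfolding coded_def decode_def by blast
    then show "\<exists>k\<le>c. \<exists>m\<le>c. \<exists>n\<le>c. c = pair (pair k m) n \<and> i < k \<and> (m * (i + 1) + 1) dvd n"
      using triple_bounds[where k = k and m = m and n = n] by metis
  qed (auto simp: coded_def decode_def)
  have "Delta0 S (\<lambda>e Z. e 0 \<in> coded (e 1))" unfolding *
    by (intro Delta0_rules Delta0_dvd)
  then show "tm_fun t \<Longrightarrow> tm_fun u \<Longrightarrow> Delta0 S (\<lambda>e Z. t e \<in> coded (u e))" by (rule Delta0_inst2)
qed

lemma Delta0_triple: "tm_fun t \<Longrightarrow> Delta0 S (\<lambda>e Z. triple (t e))"
proof -
  have *: "triple c \<longleftrightarrow> (\<exists>k\<le>c. \<exists>m\<le>c. \<exists>n\<le>c. c = pair (pair k m) n)" for c :: 'a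
  proof
    assume "triple c"
    then obtain k m n where "c = pair (pair k m) n" unfolding triple_def by blast
    then show "\<exists>k\<le>c. \<exists>m\<le>c. \<exists>n\<le>c. c = pair (pair k m) n" using triple_bounds[where k = k and m = m and n = n] by metis
  qed (auto simp: triple_def)
  have "Delta0 S (\<lambda>e Z. triple (e 0))" unfolding * by (intro Delta0_rules)
  then show "tm_fun t \<Longrightarrow> Delta0 S (\<lambda>e Z. triple (t e))" by (rule Delta0_inst1)
qed

lemma Delta0_code: "tm_fun t \<Longrightarrow> Delta0 S (\<lambda>e Z. code (t e))"
proof -
  have *: "code c \<longleftrightarrow> triple c \<and> (\<forall>c'<c. triple c' \<longrightarrow> \<not> (\<forall>i<c. i \<in> coded c' \<longleftrightarrow> i \<in> coded c))" for c :: 'a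
    unfolding code_def by (auto simp: set_eq_iff) (meson coded_less less_trans)+
  have "Delta0 S (\<lambda>e Z. code (e 0))" unfolding * by (intro Delta0_rules Delta0_coded Delta0_triple)
  then show "tm_fun t \<Longrightarrow> Delta0 S (\<lambda>e Z. code (t e))" by (rule Delta0_inst1)
qed

lemma set_code_iff: "set_code c A \<longleftrightarrow> code c \<and> A = coded c"
proof -
  have "(\<exists>k m n. c = pair (pair k m) n \<and> A = decode k m n) \<longleftrightarrow> triple c \<and> A = coded c"
    unfolding triple_def using coded_pair by metis
  moreover have "(\<forall>k m n. A = decode k m n \<longrightarrow> c \<le> pair (pair k m) n) \<longleftrightarrow>
      (\<forall>c'<c. triple c' \<longrightarrow> coded c' \<noteq> A)"
    unfolding triple_def using coded_pair by (metis not_le)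
  ultimately show ?thesis unfolding set_code_def code_def by auto
qed

lemma entry_iff: "entry s i a \<longleftrightarrow> code s \<and> pair i a \<in> coded s"
  unfolding entry_def set_code_iff by blast

lemma code_inject: "code c \<Longrightarrow> code c' \<Longrightarrow> coded c = coded c' \<Longrightarrow> c = c'"
  unfolding code_def by (metis neqE)

lemma Delta0_entry: "tm_fun t \<Longrightarrow> tm_fun u \<Longrightarrow> tm_fun v \<Longrightarrow> Delta0 S (\<lambda>e Z. entry (t e) (u e) (v e))"
  unfolding entry_iff by (intro Delta0_rules Delta0_coded Delta0_code)

lemma entry_less: "entry s i a \<Longrightarrow> i < s \<and> a < s"
  unfolding entry_iff using coded_less le_pair1 le_pair2 by (meson le_less_trans)

lemma seq_code_iff:
  "seq_code s l \<longleftrightarrow> code s \<and> (\<forall>p\<in>coded s. \<exists>i<l. \<exists>a. p = pair i a) \<and> (\<forall>i<l. \<exists>!a. entry s i a)"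
  unfolding seq_code_def set_code_iff entry_iff by auto

lemma Delta0_seq_code: "tm_fun t \<Longrightarrow> tm_fun u \<Longrightarrow> Delta0 S (\<lambda>e Z. seq_code (t e) (u e))"
proof -
  have *: "seq_code s l \<longleftrightarrow> code s \<and> (\<forall>p<s. p \<in> coded s \<longrightarrow> (\<exists>i<l. \<exists>a\<le>p. p = pair i a)) \<and>
    (\<forall>i<l. \<exists>a<s. entry s i a \<and> (\<forall>a'<s. entry s i a' \<longrightarrow> a' = a))" for s l :: 'a
  proof -
    have "(\<forall>p\<in>coded s. \<exists>i<l. \<exists>a. p = pair i a) \<longleftrightarrow> (\<forall>p<s. p \<in> coded s \<longrightarrow> (\<exists>i<l. \<exists>a\<le>p. p = pair i a))"
      using coded_less le_pair2 by metis
    moreover have "(\<exists>!a. entry s i a) \<longleftrightarrow> (\<exists>a<s. entry s i a \<and> (\<forall>a'<s. entry s i a' \<longrightarrow> a' = a))" for i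
      using entry_less by (metis (full_types))
    ultimately show ?thesis unfolding seq_code_iff by simp
  qed
  have "Delta0 S (\<lambda>e Z. seq_code (e 0) (e 1))" unfolding *
    by (intro Delta0_rules Delta0_coded Delta0_code Delta0_entry)
  then show "tm_fun t \<Longrightarrow> tm_fun u \<Longrightarrow> Delta0 S (\<lambda>e Z. seq_code (t e) (u e))" by (rule Delta0_inst2)
qed

section \<open>Function graphs, coded computations and sequences\<close>

definition graph :: "('m::discrete_ordered_semiring \<Rightarrow> 'm) \<Rightarrow> 'm set" where
  "graph f = {pair x (f x) | x. True}"

lemma pair_in_graph: "pair x y \<in> graph f \<longleftrightarrow> y = f x"
  by (auto simp: graph_def pair_inject)

lemma fun_code_graph: "fun_code (graph f)"
  by (auto simp: fun_code_def graph_def pair_inject)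

lemma fun_code_imp_graph:
  assumes "fun_code F" shows "\<exists>f. F = graph f"
proof -
  have "\<exists>f. \<forall>i. pair i (f i) \<in> F" using assms unfolding fun_code_def by metis
  then obtain f where f: "\<And>i. pair i (f i) \<in> F" by blast
  have "F = graph f"
  proof (intro set_eqI iffI)
    fix p assume p: "p \<in> F"
    then obtain i y where "p = pair i y" using assms unfolding fun_code_def by blast
    moreover then have "y = f i" using assms p f unfolding fun_code_def by metis
    ultimately show "p \<in> graph f" by (auto simp: graph_def)
  qed (use f in \<open>auto simp: graph_def\<close>)
  then show ?thesis by blast
qed

context rca
begin

text \<open>Plays the part of the factorial in Goedel's coding; positivity keeps the moduli above
  one.\<close>

lemma common_multiple: fixes k :: 'm shows "\<exists>m>0. \<forall>i<k. (i + 1) dvd m"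
proof (rule Sigma1_induct[where P = "\<lambda>k. \<exists>m>0. \<forall>i<k. (i + 1) dvd m"])
  have "Sigma1 S (\<lambda>e. \<exists>m. 0 < m \<and> (\<forall>i<e 0. (i + 1) dvd m))"
    by (rule Sigma1_ex, rule Sigma1_Delta0) (intro Delta0_rules Delta0_dvd)
  then show "Sigma1 S (\<lambda>e. \<exists>m>0. \<forall>i<e 0. (i + 1) dvd m)" by simp
  show "\<exists>m>0. \<forall>i<0. (i + 1) dvd (m :: 'm)" by (intro exI[of _ 1]) (simp add: not_less_zero)
next
  fix n :: 'm assume "\<exists>m>0. \<forall>i<n. (i + 1) dvd m"
  then obtain m where m: "m > 0" "\<And>i. i < n \<Longrightarrow> (i + 1) dvd m" by blast
  have "0 < n + 1" using zero_least[of n] by (simp add: less_add_one_iff)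
  then have "0 < m * (n + 1)" using m(1) by simp
  moreover have "(i + 1) dvd m * (n + 1)" if "i < n + 1" for i
  proof (cases "i = n")
    case False
    with that have "i < n" by (simp add: less_add_one_iff)
    then show ?thesis using m(2) by (simp add: dvd_mult2)
  qed simp
  ultimately show "\<exists>m>0. \<forall>i<n + 1. (i + 1) dvd m" by blast
qed

text \<open>Starting with 1, which no modulus divides, the modulus of each element of
  \<open>A\<close> below \<open>k\<close> is multiplied in; coprimality ensures that no other index
  is switched on.\<close>

lemma ex_decode:
  assumes "A \<in> S" shows "\<exists>m n. decode k m n = {i \<in> A. i < k}"
proof -
  obtain m where m: "m > 0" "\<And>i. i < k \<Longrightarrow> (i + 1) dvd m" using common_multiple by blast
  let ?p = "\<lambda>i. m * (i + 1) + 1"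
  have "\<exists>n. \<forall>i<k. ?p i dvd n \<longleftrightarrow> i < j \<and> i \<in> A" for j
  proof (rule Sigma1_induct[where P = "\<lambda>j. \<exists>n. \<forall>i<k. ?p i dvd n \<longleftrightarrow> i < j \<and> i \<in> A"])
    show "Sigma1 S (\<lambda>e. \<exists>n. \<forall>i<k. ?p i dvd n \<longleftrightarrow> i < e 0 \<and> i \<in> A)"
      by (rule Sigma1_ex, rule Sigma1_Delta0) (intro Delta0_rules Delta0_dvd assms)
    have "\<not> ?p i dvd 1" for i
    proof
      assume "?p i dvd 1"
      then obtain q where "q \<le> 1" "1 = ?p i * q" unfolding dvd_iff_bounded by blast
      moreover have "0 < m * (i + 1)"
        using m(1) zero_least[of i] by (simp add: less_add_one_iff)
      then have "1 < ?p i" by simp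
      moreover have "q \<noteq> 0" using calculation by auto
      then have "1 \<le> q" using zero_least[of q] add_one_le_iff[of 0 q] by simp
      then have "?p i * 1 \<le> ?p i * q" by (intro mult_left_mono zero_least)
      ultimately show False by simp
    qed
    then show "\<exists>n. \<forall>i<k. ?p i dvd n \<longleftrightarrow> i < 0 \<and> i \<in> A" by (intro exI[of _ 1]) (simp add: not_less_zero)
  next
    fix j assume "\<exists>n. \<forall>i<k. ?p i dvd n \<longleftrightarrow> i < j \<and> i \<in> A"
    then obtain n where n: "\<And>i. i < k \<Longrightarrow> ?p i dvd n \<longleftrightarrow> i < j \<and> i \<in> A" by blast
    show "\<exists>n. \<forall>i<k. ?p i dvd n \<longleftrightarrow> i < j + 1 \<and> i \<in> A"
    proof (cases "j \<in> A \<and> j < k")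
      case True
      have "?p i dvd n * ?p j \<longleftrightarrow> i < j + 1 \<and> i \<in> A" if i: "i < k" for i
      proof (cases "i = j")
        case True
        then show ?thesis using \<open>j \<in> A \<and> j < k\<close> by (simp add: less_add_one_iff)
      next
        case False
        then have "?p i dvd n * ?p j \<longleftrightarrow> ?p i dvd n"
          using moduli_coprime[OF m(2) i _ False, of n] \<open>j \<in> A \<and> j < k\<close> by (blast intro: dvd_mult2)
        then show ?thesis using n[OF i] False by (simp add: less_add_one_iff le_less)
      qed
      then show ?thesis by blast
    next
      case False
      then have "?p i dvd n \<longleftrightarrow> i < j + 1 \<and> i \<in> A" if i: "i < k" for i
        using n[OF i] i by (auto simp: less_add_one_iff le_less)
      then show ?thesis by blast
    qed
  qed
  from this[of k] obtain n where "\<forall>i<k. ?p i dvd n \<longleftrightarrow> i < k \<and> i \<in> A" by blast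
  then have "decode k m n = {i \<in> A. i < k}" by (auto simp: decode_def)
  then show ?thesis by blast
qed

lemma coded_in_S: "coded c \<in> S"
  using Delta0_comprehension[where P = "\<lambda>i. i \<in> coded c"] Delta0_coded[OF tm_fun_var tm_fun_const, of S 0 c] by simp

lemma ex_code:
  assumes "A \<in> S" "\<And>i. i \<in> A \<Longrightarrow> i < k"
  shows "\<exists>c. code c \<and> coded c = A"
proof -
  obtain m n where "decode k m n = {i \<in> A. i < k}" using ex_decode[OF assms(1)] by blast
  then have c0: "triple (pair (pair k m) n) \<and> coded (pair (pair k m) n) = A"
    unfolding coded_pair triple_def using assms(2) by auto
  let ?c = "pair (pair k m) n"
  \<comment> \<open>Equality with \<open>A\<close> is expressed by quantifiers bounded by the code
    and by \<open>k\<close>, so that a least code exists.\<close>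
  have "Delta0 S (\<lambda>e Z. triple (e 0) \<and> (\<forall>i<e 0. i \<in> coded (e 0) \<longleftrightarrow> i \<in> A) \<and> (\<forall>i<k. i \<in> A \<longrightarrow> i \<in> coded (e 0)))"
    by (intro Delta0_rules Delta0_coded Delta0_triple assms)
  moreover have "(triple c \<and> (\<forall>i<c. i \<in> coded c \<longleftrightarrow> i \<in> A) \<and> (\<forall>i<k. i \<in> A \<longrightarrow> i \<in> coded c)) \<longleftrightarrow>
      triple c \<and> coded c = A" for c
    using assms(2) coded_less by blast
  ultimately have "Delta0 S (\<lambda>e Z. triple (e 0) \<and> coded (e 0) = A)" by simp
  then obtain c where "triple c \<and> coded c = A" "\<And>c'. c' < c \<Longrightarrow> \<not> (triple c' \<and> coded c' = A)"
    using least_Delta0[where P = "\<lambda>c. triple c \<and> coded c = A", OF _ c0] by blast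
  then show ?thesis unfolding code_def by blast
qed

lemma insert_in_S:
  assumes "A \<in> S" shows "insert a A \<in> S"
proof -
  have "Delta0 S (\<lambda>e Z. e 0 = a \<or> e 0 \<in> A)" by (intro Delta0_rules assms)
  from Delta0_comprehension[where P = "\<lambda>x. x = a \<or> x \<in> A", OF this] show ?thesis
    by (simp only: insert_compr)
qed

text \<open>Computations are finite sets in which every pair is either the initial one or has its
  predecessor in the same set. With sets instead of sequences, prolonging a computation is a mere
  insertion.\<close>

lemma primitive_recursion:
  assumes "graph nx \<in> S"
  shows "\<exists>f. f 0 = a \<and> (\<forall>n. f (n + 1) = nx (f n)) \<and> graph f \<in> S"
proof -
  define bc where "bc c \<longleftrightarrow> (\<forall>q<c. q \<in> coded c \<longrightarrow>
    q = pair 0 a \<or> (\<exists>i<c. \<exists>u<c. \<exists>v<c. q = pair (i + 1) v \<and> pair i u \<in> coded c \<and> pair u v \<in> graph nx))" for c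
  have bc_iff: "bc c \<longleftrightarrow> (\<forall>n y. pair n y \<in> coded c \<longrightarrow>
      n = 0 \<and> y = a \<or> (\<exists>i u. n = i + 1 \<and> y = nx u \<and> pair i u \<in> coded c)) \<and> (\<forall>q\<in>coded c. \<exists>n y. q = pair n y)" for c
  proof
    assume bc: "bc c"
    show "(\<forall>n y. pair n y \<in> coded c \<longrightarrow>
      n = 0 \<and> y = a \<or> (\<exists>i u. n = i + 1 \<and> y = nx u \<and> pair i u \<in> coded c)) \<and> (\<forall>q\<in>coded c. \<exists>n y. q = pair n y)"
    proof (intro conjI allI impI ballI)
      fix n y assume p: "pair n y \<in> coded c"
      then show "n = 0 \<and> y = a \<or> (\<exists>i u. n = i + 1 \<and> y = nx u \<and> pair i u \<in> coded c)"
        using bc[unfolded bc_def, rule_format, OF coded_less[OF p] p] by (auto simp: pair_inject pair_in_graph)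
    next
      fix q assume p: "q \<in> coded c"
      then show "\<exists>n y. q = pair n y"
        using bc[unfolded bc_def, rule_format, OF coded_less[OF p] p] by blast
    qed
  next
    assume *: "(\<forall>n y. pair n y \<in> coded c \<longrightarrow>
      n = 0 \<and> y = a \<or> (\<exists>i u. n = i + 1 \<and> y = nx u \<and> pair i u \<in> coded c)) \<and> (\<forall>q\<in>coded c. \<exists>n y. q = pair n y)"
    show "bc c" unfolding bc_def
    proof (intro allI impI)
      fix q assume q: "q < c" "q \<in> coded c"
      then obtain n y where ny: "q = pair n y" using * by blast
      with q * have "n = 0 \<and> y = a \<or> (\<exists>i u. n = i + 1 \<and> y = nx u \<and> pair i u \<in> coded c)" by blast
      then consider "n = 0" "y = a" | i u where "n = i + 1" "y = nx u" "pair i u \<in> coded c" by blast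
      then show "q = pair 0 a \<or> (\<exists>i<c. \<exists>u<c. \<exists>v<c. q = pair (i + 1) v \<and> pair i u \<in> coded c \<and> pair u v \<in> graph nx)"
      proof cases
        case (2 i u)
        have "pair i u < c" using coded_less[OF 2(3)] .
        then have "i < c" "u < c" using le_pair1 le_pair2 by (meson le_less_trans)+
        moreover have "y < c" using q(1) ny le_pair2 by (meson le_less_trans)
        ultimately show ?thesis using 2 ny pair_in_graph by blast
      qed (simp add: ny)
    qed
  qed
  have Delta0_bc: "tm_fun t \<Longrightarrow> Delta0 S (\<lambda>e Z. bc (t e))" for t
  proof -
    have "Delta0 S (\<lambda>e Z. bc (e 0))" unfolding bc_def by (intro Delta0_rules Delta0_coded assms)
    then show "tm_fun t \<Longrightarrow> Delta0 S (\<lambda>e Z. bc (t e))" by (rule Delta0_inst1)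
  qed
  define R where "R n y \<longleftrightarrow> (\<exists>c. bc c \<and> pair n y \<in> coded c)" for n y
  have Sigma1_R: "Sigma1 S (\<lambda>e. R (t e) (u e))" if "tm_fun t" "tm_fun u" for t u
  proof -
    have "tm_fun (\<lambda>e. t (\<lambda>i. e (Suc i)))" "tm_fun (\<lambda>e. u (\<lambda>i. e (Suc i)))"
      by (rule tm_fun_subst[OF that(1)] tm_fun_subst[OF that(2)], rule tm_fun_var)+
    then show ?thesis unfolding R_def
      by (intro Sigma1_ex Sigma1_Delta0 Delta0_conj Delta0_bc Delta0_coded tm_fun_pair tm_fun_var)
  qed
  have unique: "\<forall>y<c. \<forall>y'<c'. pair n y \<in> coded c \<longrightarrow> pair n y' \<in> coded c' \<longrightarrow> y = y'" if c: "bc c" "bc c'" for n c c'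
  proof (rule Sigma1_induct[where P = "\<lambda>n. \<forall>y<c. \<forall>y'<c'. pair n y \<in> coded c \<longrightarrow> pair n y' \<in> coded c' \<longrightarrow> y = y'"])
    show "Sigma1 S (\<lambda>e. \<forall>y<c. \<forall>y'<c'. pair (e 0) y \<in> coded c \<longrightarrow> pair (e 0) y' \<in> coded c' \<longrightarrow> y = y')"
      by (rule Sigma1_Delta0) (intro Delta0_rules Delta0_coded coded_in_S)
    have "0 \<noteq> i + 1" for i :: 'm using less_add_one_iff[of 0 i] zero_least[of i] by auto
    then show "\<forall>y<c. \<forall>y'<c'. pair 0 y \<in> coded c \<longrightarrow> pair 0 y' \<in> coded c' \<longrightarrow> y = y'"
      using c unfolding bc_iff by metis
  next
    fix n assume IH: "\<forall>y<c. \<forall>y'<c'. pair n y \<in> coded c \<longrightarrow> pair n y' \<in> coded c' \<longrightarrow> y = y'"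
    have ne: "i + 1 \<noteq> 0" for i :: 'm using less_add_one_iff[of 0 i] zero_least[of i] by auto
    show "\<forall>y<c. \<forall>y'<c'. pair (n + 1) y \<in> coded c \<longrightarrow> pair (n + 1) y' \<in> coded c' \<longrightarrow> y = y'"
    proof (intro allI impI)
      fix y y' assume "pair (n + 1) y \<in> coded c" "pair (n + 1) y' \<in> coded c'"
      then obtain i u i' u' where *: "n + 1 = i + 1" "y = nx u" "pair i u \<in> coded c"
        "n + 1 = i' + 1" "y' = nx u'" "pair i' u' \<in> coded c'"
        using c ne unfolding bc_iff by meson
      then have "i = n" "i' = n" by simp_all
      moreover have "u < c" "u' < c'" using coded_less[OF *(3)] coded_less[OF *(6)] le_pair2 by (meson le_less_trans)+
      ultimately show "y = y'" using IH * by blast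
    qed
  qed
  have uniq: "y = y'" if yy: "R n y" "R n y'" for n y y'
  proof -
    obtain c c' where c: "bc c" "pair n y \<in> coded c" "bc c'" "pair n y' \<in> coded c'" using yy unfolding R_def by blast
    have "y < c" "y' < c'" using coded_less[OF c(2)] coded_less[OF c(4)] le_pair2 by (meson le_less_trans)+
    then show ?thesis using unique[OF c(1,3)] c(2,4) by blast
  qed
  have step: "R (n + 1) (nx y)" if R: "R n y" for n y
  proof -
    obtain c where c: "bc c" "pair n y \<in> coded c" using R unfolding R_def by blast
    let ?p = "pair (n + 1) (nx y)"
    have "insert ?p (coded c) \<in> S" by (intro insert_in_S coded_in_S)
    moreover have "i < max c (?p + 1)" if "i \<in> insert ?p (coded c)" for i
      using that coded_less[of i c] by (auto simp: less_max_iff_disj less_add_one_iff)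
    ultimately obtain c' where c': "coded c' = insert ?p (coded c)" using ex_code by blast
    have "bc c'" using c unfolding bc_iff c' by (auto simp: pair_inject)
    then show ?thesis unfolding R_def c'[symmetric] using c' by blast
  qed
  have start: "R 0 a"
  proof -
    obtain c where c: "coded c = {pair 0 a}"
    proof -
      have "Delta0 S (\<lambda>e Z. e 0 = pair 0 a)" by (intro Delta0_rules)
      from Delta0_comprehension[where P = "\<lambda>x. x = pair 0 a", OF this] have "{pair 0 a} \<in> S" by simp
      then have "\<exists>c. code c \<and> coded c = {pair 0 a}"
        by (rule ex_code[of _ "pair 0 a + 1"]) (simp add: less_add_one_iff)
      then show thesis using that by blast
    qed
    then have "bc c" unfolding bc_iff c by (auto simp: pair_inject)
    then show ?thesis unfolding R_def using c by blast
  qed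
  have total: "\<exists>y. R n y" for n
  proof (rule Sigma1_induct[where P = "\<lambda>n. \<exists>y. R n y"])
    show "Sigma1 S (\<lambda>e. \<exists>y. R (e 0) y)" by (intro Sigma1_ex Sigma1_R tm_fun_var)
  qed (use start step in blast)+
  define f where "f n = (THE y. R n y)" for n
  have f: "R n y \<longleftrightarrow> y = f n" for n y
    unfolding f_def using uniq total by (metis the_equality)
  have "{p. \<exists>n y. p = pair n y \<and> R n y} \<in> S"
  proof (rule Delta1_comprehension)
    show "Sigma1 S (\<lambda>e. \<exists>n y. e 0 = pair n y \<and> R n y)"
      by (intro Sigma1_ex Sigma1_conj Sigma1_R Sigma1_Delta0[OF Delta0_eq] tm_fun_var tm_fun_pair)
    \<comment> \<open>Totality and uniqueness make the complement \<Sigma>1: a number outside the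
      graph is no pair, or its first component has a different value.\<close>
    have "(\<not> (\<exists>n y. p = pair n y \<and> R n y)) \<longleftrightarrow>
      \<not> (\<exists>n\<le>p. \<exists>y\<le>p. p = pair n y) \<or> (\<exists>n y y'. p = pair n y \<and> R n y' \<and> y \<noteq> y')" for p
      using le_pair1 le_pair2 uniq total pair_inject by metis
    moreover have "Sigma1 S (\<lambda>e. \<not> (\<exists>n\<le>e 0. \<exists>y\<le>e 0. e 0 = pair n y) \<or> (\<exists>n y y'. e 0 = pair n y \<and> R n y' \<and> y \<noteq> y'))"
      by (rule Sigma1_disj, rule Sigma1_Delta0, intro Delta0_rules)
        (intro Sigma1_ex Sigma1_conj Sigma1_R Sigma1_Delta0[OF Delta0_eq] Sigma1_Delta0[OF Delta0_not[OF Delta0_eq]] tm_fun_var tm_fun_pair)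
    ultimately show "Sigma1 S (\<lambda>e. \<not> (\<exists>n y. e 0 = pair n y \<and> R n y))" by simp
  qed
  also have "{p. \<exists>n y. p = pair n y \<and> R n y} = graph f" by (auto simp: graph_def f)
  finally have "graph f \<in> S" .
  moreover have "f 0 = a" using start f by simp
  moreover have "f (n + 1) = nx (f n)" for n using step[of n "f n"] f by simp
  ultimately show ?thesis by blast
qed

text \<open>Every set in \<open>S\<close> that is bounded has a code, so only a bound is missing;
  collection supplies it, since each of the first \<open>l\<close> pairs is bounded
  individually.\<close>

lemma seq_from_graph:
  assumes "{pair i (f i) | i. i < l} \<in> S"
  shows "\<exists>s. seq_code s l \<and> (\<forall>i a. entry s i a \<longleftrightarrow> i < l \<and> a = f i)"
proof -
  define A where "A = {pair i (f i) | i. i < l}"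
  have A_in: "A \<in> S" using assms by (simp add: A_def)
  have A: "pair i a \<in> A \<longleftrightarrow> i < l \<and> a = f i" for i a by (auto simp: A_def pair_inject)
  have 1: "Delta0 S (\<lambda>e Z. \<exists>p\<le>e 1. p \<in> A \<and> (\<exists>a\<le>p. p = pair (e 0) a))" by (intro Delta0_rules A_in)
  have 2: "\<exists>w. \<exists>p\<le>w. p \<in> A \<and> (\<exists>a\<le>p. p = pair i a)" if "i < l" for i
    using that A le_pair2[of "f i" i] by (intro exI[of _ "pair i (f i)"]) auto
  obtain b where b: "\<And>i. i < l \<Longrightarrow> \<exists>w<b. \<exists>p\<le>w. p \<in> A \<and> (\<exists>a\<le>p. p = pair i a)"
    using collection[where R = "\<lambda>i w. \<exists>p\<le>w. p \<in> A \<and> (\<exists>a\<le>p. p = pair i a)", OF 1 2] by blast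
  have "p < b" if p: "p \<in> A" for p
  proof -
    obtain i where i: "i < l" "p = pair i (f i)" using p unfolding A_def by blast
    obtain w q a where "w < b" "q \<le> w" "q \<in> A" "q = pair i a"
      using b[OF i(1)] by (elim exE conjE) (rule that)
    then have "q = p" using i A by simp
    then show ?thesis using \<open>w < b\<close> \<open>q \<le> w\<close> by simp
  qed
  then obtain s where s: "code s" "coded s = A" using ex_code[OF A_in] by blast
  have e: "entry s i a \<longleftrightarrow> i < l \<and> a = f i" for i a unfolding entry_iff using s A by simp
  moreover have "seq_code s l" unfolding seq_code_iff e using s by (auto simp: A_def)
  ultimately show ?thesis by blast
qed

end

lemma seq_code_entry: "seq_code s l \<Longrightarrow> entry s i a \<Longrightarrow> i < l"
  unfolding seq_code_iff entry_iff by (metis pair_inject)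

lemma seq_code_ex: "seq_code s l \<Longrightarrow> i < l \<Longrightarrow> \<exists>a. entry s i a"
  unfolding seq_code_iff by blast

lemma seq_code_unique: "seq_code s l \<Longrightarrow> entry s i a \<Longrightarrow> entry s i b \<Longrightarrow> a = b"
  using seq_code_entry unfolding seq_code_iff by blast

lemma seq_code_length: "seq_code s l \<Longrightarrow> seq_code s l' \<Longrightarrow> l = l'"
  by (metis neqE less_irrefl seq_code_entry seq_code_ex)

text \<open>Codes are least codes, hence extensional. Linearity of the exponential order depends on
  this.\<close>

lemma seq_code_eqI:
  assumes "seq_code s l" "seq_code t k" "\<And>i a. entry s i a \<longleftrightarrow> entry t i a"
  shows "s = t"
proof (rule code_inject)
  show c: "code s" "code t" using assms seq_code_iff by blast+
  have "p \<in> coded s \<longleftrightarrow> p \<in> coded t" for p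
  proof -
    have "\<exists>i a. p = pair i a" if "p \<in> coded s \<or> p \<in> coded t"
      using that assms(1,2) unfolding seq_code_iff by blast
    then show ?thesis using assms(3) c unfolding entry_iff by blast
  qed
  then show "coded s = coded t" by blast
qed

lemma seq_code_le: "seq_code s l \<Longrightarrow> l \<le> s"
  by (metis entry_less not_le less_irrefl seq_code_ex)


section \<open>From recursion to induction\<close>

text \<open>\<open>Delta0_sat\<close> reserves set variable 0 for the argument; here the argument is
  replaced by the parameter \<open>E 0\<close>.\<close>

lemma Delta0_sat_fixed:
  assumes "bounded_fm \<phi>" "range E \<subseteq> S" "\<And>i. tm_fun (\<lambda>e. f e i)"
  shows "Delta0 S (\<lambda>e Z. sat (f e) E \<phi>)"
proof -
  have E: "push (E 0) (\<lambda>i. E (Suc i)) = E" by (rule push_collapse)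
  have "range (\<lambda>i. E (Suc i)) \<subseteq> S" using assms(2) by auto
  from Delta0_sat[OF assms(1) this, where f = "\<lambda>e. e"]
  have 1: "Delta0 S (\<lambda>e Z. sat e (push Z (\<lambda>i. E (Suc i))) \<phi>)" by (simp add: tm_fun_var)
  have "E 0 \<in> S" using assms(2) by auto
  then have 2: "Delta0 S (\<lambda>e Z. e 0 \<in> E 0)" by (intro Delta0_mem tm_fun_var)
  from Delta0_subst_set[where f = f and A = "\<lambda>_ _. E 0", OF 1 assms(3) 2]
  show ?thesis unfolding E .
qed

section \<open>Linear orders and their initial segments\<close>

lemma rel_iff: "(x, y) \<in> rel X \<longleftrightarrow> pair x y \<in> X"
  by (simp add: rel_def)

lemma oless_iff: "oless X x y \<longleftrightarrow> pair x y \<in> X \<and> x \<noteq> y"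
  by (simp add: oless_def rel_iff)

lemma Delta0_oless: "X \<in> S \<Longrightarrow> tm_fun t \<Longrightarrow> tm_fun u \<Longrightarrow> Delta0 S (\<lambda>e Z. oless X (t e) (u e))"
  unfolding oless_iff by (intro Delta0_rules)

lemma oless_ofield: "oless X x y \<Longrightarrow> x \<in> ofield X" "oless X x y \<Longrightarrow> y \<in> ofield X"
  unfolding oless_def ofield_def by (auto intro: FieldI1 FieldI2)

context
  fixes X :: "'m::discrete_ordered_semiring set"
  assumes lo: "Linear_order (rel X)"
begin

lemma lo_facts: "refl_on (Field (rel X)) (rel X)" "trans (rel X)" "antisym (rel X)" "total_on (Field (rel X)) (rel X)"
  using lo unfolding linear_order_on_def partial_order_on_def preorder_on_def by auto

lemma ofield_iff: "x \<in> ofield X \<longleftrightarrow> pair x x \<in> X"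
proof
  assume "x \<in> ofield X"
  then show "pair x x \<in> X"
    using refl_onD[OF lo_facts(1)] unfolding ofield_def rel_iff[symmetric] by blast
next
  assume "pair x x \<in> X"
  then show "x \<in> ofield X" unfolding ofield_def rel_iff[symmetric] by (rule FieldI1)
qed

lemma oless_trans: "oless X x y \<Longrightarrow> oless X y z \<Longrightarrow> oless X x z"
  unfolding oless_def using transD[OF lo_facts(2)] antisymD[OF lo_facts(3)] by blast

lemma oless_linear: "x \<in> ofield X \<Longrightarrow> y \<in> ofield X \<Longrightarrow> x \<noteq> y \<Longrightarrow> oless X x y \<or> oless X y x"
  using lo_facts(4) unfolding oless_def ofield_def total_on_def by blast

lemma rel_below_iff: "pair y z \<in> below X x \<longleftrightarrow> pair y z \<in> X \<and> oless X y x \<and> oless X z x"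
  by (auto simp: below_def pair_inject rel_iff)

lemma ofield_below: "ofield (below X x) = {y. oless X y x}"
proof (intro set_eqI iffI)
  fix y assume "y \<in> ofield (below X x)"
  then show "y \<in> {y. oless X y x}"
    unfolding ofield_def Field_def by (auto simp: rel_iff rel_below_iff)
next
  fix y assume "y \<in> {y. oless X y x}"
  then have y: "oless X y x" by simp
  then have "(y, y) \<in> rel (below X x)"
    using oless_ofield(1)[OF y] by (simp add: rel_iff rel_below_iff ofield_iff)
  then show "y \<in> ofield (below X x)" unfolding ofield_def by (rule FieldI1)
qed

lemma oless_below: "oless X y x \<Longrightarrow> oless (below X x) z y \<longleftrightarrow> oless X z y"
  unfolding oless_iff[of "below X x"] rel_below_iff by (metis oless_iff oless_trans)

end

text \<open>\<open>X'\<close> is the restriction of \<open>X\<close> to the initial segment \<open>D\<close>; covers both \<open>X\<close> itself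
  and \<open>below X x\<close>.\<close>

definition segment :: "'m::discrete_ordered_semiring set \<Rightarrow> 'm set \<Rightarrow> 'm set \<Rightarrow> bool" where
  "segment X D X' \<longleftrightarrow> ofield X' = D \<and> (\<forall>y\<in>D. \<forall>z. (oless X' z y \<longleftrightarrow> oless X z y) \<and> (oless X z y \<longrightarrow> z \<in> D))"

lemma segment_whole: "segment X (ofield X) X"
  unfolding segment_def using oless_ofield(1) by metis

lemma segment_below:
  assumes lo: "Linear_order (rel X)" shows "segment X {y. oless X y x} (below X x)"
  unfolding segment_def
proof (intro conjI ballI allI impI)
  show "ofield (below X x) = {y. oless X y x}" by (rule ofield_below[OF lo])
next
  fix y z assume y: "y \<in> {y. oless X y x}"
  then show "oless (below X x) z y \<longleftrightarrow> oless X z y" by (intro oless_below[OF lo]) simp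
  show "z \<in> {y. oless X y x}" if "oless X z y" using oless_trans[OF lo that] y by simp
qed

lemma pair_set_eq:
  "Y = {pair y n | y n. P y n} \<longleftrightarrow> (\<forall>p\<in>Y. \<exists>y n. p = pair y n) \<and> (\<forall>y n. pair y n \<in> Y \<longleftrightarrow> P y n)"
proof
  assume "Y = {pair y n | y n. P y n}"
  then show "(\<forall>p\<in>Y. \<exists>y n. p = pair y n) \<and> (\<forall>y n. pair y n \<in> Y \<longleftrightarrow> P y n)"
    by (auto simp only: pair_inject mem_Collect_eq)
next
  assume *: "(\<forall>p\<in>Y. \<exists>y n. p = pair y n) \<and> (\<forall>y n. pair y n \<in> Y \<longleftrightarrow> P y n)"
  show "Y = {pair y n | y n. P y n}"
  proof (intro set_eqI iffI)
    fix p assume p: "p \<in> Y"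
    then obtain y n where "p = pair y n" using * by blast
    with p * show "p \<in> {pair y n | y n. P y n}" by auto
  next
    fix p assume "p \<in> {pair y n | y n. P y n}"
    then obtain y n where "p = pair y n" "P y n" by auto
    with * show "p \<in> Y" by simp
  qed
qed

lemma restrict_to_segment:
  assumes "segment X D X'" "y \<in> D" shows "restrict_to X' Y y = restrict_to X Y y"
  using assms unfolding restrict_to_def segment_def by blast

lemma H_segment:
  assumes "segment X D X'"
  shows "H e E \<phi> X' Y \<longleftrightarrow> (\<forall>p\<in>Y. \<exists>y n. p = pair y n) \<and>
    (\<forall>y n. pair y n \<in> Y \<longleftrightarrow> y \<in> D \<and> sat3 e E \<phi> n y (restrict_to X Y y))"
proof -
  have "ofield X' = D" using assms by (simp add: segment_def)
  then show ?thesis unfolding H_def pair_set_eq using restrict_to_segment[OF assms] by metis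
qed

lemma pair_in_restrict_to: "pair z m \<in> restrict_to X Y y \<longleftrightarrow> pair z m \<in> Y \<and> oless X z y"
  by (auto simp: restrict_to_def pair_inject)

context rca
begin

theorem SETR_imp_induction:
  assumes X: "X \<in> S" and SETR: "SETR S X"
  assumes lo: "Linear_order (rel X)"
  shows "Pi02_transfinite_induction S X"
  unfolding Pi02_transfinite_induction_def
proof (intro allI impI, elim conjE)
  fix Q e E
  assume "Pi02 Q" and E: "range E \<subseteq> S"
    and "\<forall>x\<in>ofield X. (\<forall>y. oless X y x \<longrightarrow> sat (push y e) E Q) \<longrightarrow> sat (push x e) E Q"
  then obtain \<theta> where \<theta>: "bounded_fm \<theta>" "Q = Forall (Exists \<theta>)" unfolding Pi02_def by blast
  define T where "T y m k = sat (push k (push m (push y e))) E \<theta>" for y m k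
  have sat_Q: "sat (push y e) E Q \<longleftrightarrow> (\<forall>m. \<exists>k. T y m k)" for y by (simp add: \<theta>(2) T_def)
  have prog: "\<forall>m. \<exists>k. T x m k" if "x \<in> ofield X" "\<And>y. oless X y x \<Longrightarrow> \<forall>m. \<exists>k. T y m k" for x
    using \<open>\<forall>x\<in>ofield X. _\<close> that unfolding sat_Q by blast
  have T: "Delta0 S (\<lambda>e Z. T (e 2) (e 1) (e 0))" unfolding T_def
  proof (rule Delta0_sat_fixed[OF \<theta>(1) E])
    show "tm_fun (\<lambda>e'. push (e' 0) (push (e' 1) (push (e' 2) e)) i)" for i by (intro tm_fun_push tm_fun_var tm_fun_const)
  qed
  \<comment> \<open>The number \<open>w\<close> acts both as the witness of \<open>T\<close> and as
    a bound for the missing pair, which keeps the matrix bounded.\<close>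
  define R where "R w n y Z \<longleftrightarrow> T y n w \<or> (\<exists>z\<le>w. \<exists>m\<le>w. oless X z y \<and> pair z m \<notin> Z)" for w n y Z
  have "Delta0 S (\<lambda>e Z. R (e 0) (e 1) (e 2) Z)" unfolding R_def
    by (intro Delta0_disj T Delta0_rules Delta0_oless X)
  from Delta0_rep3[where R = R, OF this S_nonempty] obtain \<eta> c F where \<eta>: "bounded_fm \<eta>" "range F \<subseteq> S"
    "\<forall>w n x Z. sat (push w (push n (push x c))) (push Z F) \<eta> \<longleftrightarrow> R w n x Z"
    by (elim exE conjE) (rule that)
  \<comment> \<open>\<open>?\<psi>\<close> is a false formula: on every solution below a point,
    \<open>?\<phi>\<close> turns out to be true.\<close>
  let ?\<phi> = "Exists \<eta>" and ?\<psi> = "Exists (Less Zero Zero)"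
  have \<phi>: "sat3 c F ?\<phi> n x Z \<longleftrightarrow> (\<exists>w. T x n w) \<or> (\<exists>z m. oless X z x \<and> pair z m \<notin> Z)" for n x Z
  proof -
    have "sat3 c F ?\<phi> n x Z \<longleftrightarrow> (\<exists>w. R w n x Z)" using \<eta>(3) by simp
    also have "\<dots> \<longleftrightarrow> (\<exists>w. T x n w) \<or> (\<exists>z m. oless X z x \<and> pair z m \<notin> Z)"
      unfolding R_def using le_pair1 le_pair2 by metis
    finally show ?thesis .
  qed
  \<comment> \<open>Serves twice: on \<open>below X x\<close> it verifies the premise of the
    recursion scheme, on \<open>X\<close> it gives the conclusion.\<close>
  have full: "\<forall>m. \<exists>k. T y m k" if H: "H c F ?\<phi> X' Z" and D: "segment X D X'" and sub: "D \<subseteq> ofield X" and y: "y \<in> D" for X' D Z y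
  proof -
    have seg: "z \<in> D" if "y \<in> D" "oless X z y" for z y using D that unfolding segment_def by blast
    have Z: "pair y m \<in> Z \<longleftrightarrow> y \<in> D \<and> sat3 c F ?\<phi> m y (restrict_to X Z y)" for y m
      using H[unfolded H_segment[OF D]] by blast
    \<comment> \<open>If a pair at \<open>y\<close> is missing, then nothing below \<open>y\<close>
      is missing, for any missing pair there would have put it in. So each pair below
      \<open>y\<close> entered because of a true witness, and progressivity yields a witness at
      \<open>y\<close> after all.\<close>
    have Z_full: "pair y m \<in> Z" if y: "y \<in> D" for y m
    proof (rule ccontr)
      assume "pair y m \<notin> Z"
      then have "\<not> sat3 c F ?\<phi> m y (restrict_to X Z y)" using Z y by blast
      then have no: "\<not> T y m w" "oless X z y \<Longrightarrow> pair z m' \<in> Z" for w z m'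
        unfolding \<phi> pair_in_restrict_to by metis+
      have "\<exists>k. T z m' k" if z: "oless X z y" for z m'
      proof -
        have "sat3 c F ?\<phi> m' z (restrict_to X Z z)" using no(2)[OF z] Z by blast
        then show ?thesis unfolding \<phi> pair_in_restrict_to using no(2) oless_trans[OF lo _ z] by blast
      qed
      then show False using prog[of y] no(1) sub y by blast
    qed
    have "sat3 c F ?\<phi> m y (restrict_to X Z y)" for m using Z_full[OF y] Z by blast
    then show ?thesis unfolding \<phi> pair_in_restrict_to using Z_full seg[OF y] by blast
  qed
  have ex: "\<exists>Y\<in>S. H c F ?\<phi> X Y"
  proof (rule SETR[unfolded SETR_def, rule_format, of ?\<phi> ?\<psi> F c], intro conjI ballI allI impI)
    show "Sigma01 ?\<phi>" unfolding Sigma01_def using \<eta>(1) by blast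
    show "Sigma01 ?\<psi>" unfolding Sigma01_def by simp
    show "range F \<subseteq> S" by fact
  next
    fix n x Z assume x: "x \<in> ofield X" and H: "H c F ?\<phi> (below X x) Z"
    have "\<forall>m. \<exists>k. T x m k"
      by (rule prog[OF x]) (rule full[OF H segment_below[OF lo]], use oless_ofield(1) in auto)
    then show "sat3 c F ?\<phi> n x Z \<longleftrightarrow> \<not> sat3 c F ?\<psi> n x Z" unfolding \<phi> by simp
  qed
  then obtain Y where "H c F ?\<phi> X Y" by blast
  from full[OF this segment_whole subset_refl] show "\<forall>x\<in>ofield X. sat (push x e) E Q" unfolding sat_Q by blast
qed

lemma Pi02_induct:
  assumes TI: "Pi02_transfinite_induction S X" and A: "Sigma1 S (\<lambda>e. A (e 0) (e 1))"
    and prog: "\<And>x. x \<in> ofield X \<Longrightarrow> (\<And>y. oless X y x \<Longrightarrow> \<forall>n. A y n) \<Longrightarrow> \<forall>n. A x n"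
    and x: "x \<in> ofield X"
  shows "\<forall>n. A x n"
proof -
  obtain Q where Q: "Delta0 S (\<lambda>e Z. Q (\<lambda>i. e (Suc i)) (e 0))" and AQ: "\<And>e. A (e 0) (e 1) \<longleftrightarrow> (\<exists>k. Q e k)"
    using A unfolding Sigma1_def by blast
  let ?f = "\<lambda>e::nat \<Rightarrow> 'm. case_nat (e 0) (case_nat (e 2) (\<lambda>_. e (Suc 0)))"
  have "tm_fun (\<lambda>e. ?f e i)" for i by (intro tm_fun_push tm_fun_var)
  note q = Delta0_subst[where f = ?f, OF Q this]
  define R where "R k n x Z \<longleftrightarrow> Q (case_nat x (\<lambda>_. n)) k" for k n x :: 'm and Z :: "'m set"
  have "Delta0 S (\<lambda>e Z. R (e 0) (e 1) (e 2) Z)" using q unfolding R_def by simp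
  from Delta0_rep3[where R = R, OF this S_nonempty] obtain \<theta> c E where \<theta>: "bounded_fm \<theta>" "range E \<subseteq> S"
    "\<forall>w n x Z. sat (push w (push n (push x c))) (push Z E) \<theta> \<longleftrightarrow> R w n x Z"
    by (elim exE conjE) (rule that)
  obtain B where B: "B \<in> S" using S_nonempty by blast
  have sat: "sat (push x c) (push B E) (Forall (Exists \<theta>)) \<longleftrightarrow> (\<forall>n. A x n)" for x
  proof -
    have "A x n \<longleftrightarrow> (\<exists>k. R k n x B)" for n using AQ[of "case_nat x (\<lambda>_. n)"] by (simp add: R_def)
    then show ?thesis using \<theta>(3) by simp
  qed
  have "Pi02 (Forall (Exists \<theta>))" unfolding Pi02_def using \<theta>(1) by blast
  moreover have "range (push B E) \<subseteq> S" using B \<theta>(2) by (auto simp: image_subset_iff split: nat.split)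
  ultimately show ?thesis
    using TI[unfolded Pi02_transfinite_induction_def, rule_format, of "Forall (Exists \<theta>)" "push B E" c x] x prog
    unfolding sat by blast
qed

end


section \<open>From induction to recursion\<close>

lemma tm_fun_inst3:
  assumes "tm_fun (\<lambda>e. U (e 0) (e 1) (e 2))" "tm_fun t" "tm_fun u" "tm_fun v"
  shows "tm_fun (\<lambda>e. U (t e) (u e) (v e))"
proof -
  have "tm_fun (\<lambda>e. case_nat (t e) (case_nat (u e) (case_nat (v e) e)) i)" for i
    by (intro tm_fun_push tm_fun_var assms)
  from tm_fun_subst[where f = "\<lambda>e. case_nat (t e) (case_nat (u e) (case_nat (v e) e))", OF assms(1) this]
  show ?thesis by (simp add: numeral_2_eq_2)
qed

lemma tm_fun_mono: "tm_fun t \<Longrightarrow> (\<And>i. e i \<le> e' i) \<Longrightarrow> t e \<le> t e'"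
  by (induction rule: tm_fun.induct) (auto intro!: add_mono mult_mono simp: zero_least)

text \<open>The use principle. Since term functions are monotone, the use over all values of a
  bounded variable is dominated by the use at the bound itself.\<close>

lemma Delta0_use:
  assumes "Delta0 S P"
  shows "\<exists>B. tm_fun B \<and> (\<forall>e Z Z'. (\<forall>q<B e. q \<in> Z \<longleftrightarrow> q \<in> Z') \<longrightarrow> (P e Z \<longleftrightarrow> P e Z'))"
  using assms
proof (induction rule: Delta0.induct)
  case (Delta0_mem_arg t)
  have "tm_fun (\<lambda>e. t e + 1)" by (intro tm_fun_add tm_fun_const Delta0_mem_arg)
  then show ?case by (intro exI[of _ "\<lambda>e. t e + 1"]) (simp add: less_add_one_iff)
next
  case (Delta0_not P)
  then show ?case by metis
next
  case (Delta0_conj P Q)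
  from Delta0_conj.IH(1) obtain B where B: "tm_fun B" "\<forall>e Z Z'. (\<forall>q<B e. q \<in> Z \<longleftrightarrow> q \<in> Z') \<longrightarrow> (P e Z \<longleftrightarrow> P e Z')"
    by (elim exE conjE) (rule that)
  from Delta0_conj.IH(2) obtain C where C: "tm_fun C" "\<forall>e Z Z'. (\<forall>q<C e. q \<in> Z \<longleftrightarrow> q \<in> Z') \<longrightarrow> (Q e Z \<longleftrightarrow> Q e Z')"
    by (elim exE conjE) (rule that)
  have "tm_fun (\<lambda>e. B e + C e)" by (intro tm_fun_add B C)
  moreover have "(P e Z \<and> Q e Z) \<longleftrightarrow> (P e Z' \<and> Q e Z')"
    if "\<forall>q<B e + C e. q \<in> Z \<longleftrightarrow> q \<in> Z'" for e Z Z'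
  proof -
    have "\<forall>q<B e. q \<in> Z \<longleftrightarrow> q \<in> Z'" "\<forall>q<C e. q \<in> Z \<longleftrightarrow> q \<in> Z'"
      using that le_add_same[where a = "B e" and b = "C e"] by (meson less_le_trans)+
    then show ?thesis using B(2) C(2) by metis
  qed
  ultimately show ?case by (intro exI[of _ "\<lambda>e. B e + C e"]) blast
next
  case (Delta0_bex t Q)
  from Delta0_bex.IH obtain B where B: "tm_fun B"
    "\<forall>e Z Z'. (\<forall>q<B e. q \<in> Z \<longleftrightarrow> q \<in> Z') \<longrightarrow> (Q (\<lambda>i. e (Suc i)) (e 0) Z \<longleftrightarrow> Q (\<lambda>i. e (Suc i)) (e 0) Z')"
    by (elim exE conjE) (rule that)
  have tm: "tm_fun (\<lambda>e. case_nat (t e) e i)" for i by (intro tm_fun_push tm_fun_var Delta0_bex.hyps)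
  note tm_fun_subst[where f = "\<lambda>e. case_nat (t e) e", OF B(1) tm]
  moreover have "Q e x Z \<longleftrightarrow> Q e x Z'"
    if "\<forall>q<B (case_nat (t e) e). q \<in> Z \<longleftrightarrow> q \<in> Z'" "x < t e" for e Z Z' x
  proof -
    have "B (case_nat x e) \<le> B (case_nat (t e) e)"
      using that(2) by (intro tm_fun_mono[OF B(1)]) (auto split: nat.split)
    then have "\<forall>q<B (case_nat x e). q \<in> Z \<longleftrightarrow> q \<in> Z'" using that(1) by (meson less_le_trans)
    then show ?thesis using B(2)[rule_format, of "case_nat x e" Z Z'] by simp
  qed
  ultimately show ?case
    by (intro exI[of _ "\<lambda>e. B (case_nat (t e) e)"] conjI) (assumption, metis)
qed (use tm_fun_const in blast)+

text \<open>The stages of the recursion are approximated by coded finite sets of claims: \<open>claim c b y n\<close>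
  asserts that \<open>\<langle>y, n\<rangle>\<close> belongs (\<open>b\<close>) or does not belong (\<open>\<not> b\<close>) to the set under construction.
  \<open>R b\<close> is the matrix of the formula confirming such a claim and \<open>U\<close> bounds the part of the set
  variable it inspects.\<close>

definition tag :: "bool \<Rightarrow> 'm::discrete_ordered_semiring" where
  "tag b = (if b then 1 else 0)"

definition claim :: "'m::discrete_ordered_semiring \<Rightarrow> bool \<Rightarrow> 'm \<Rightarrow> 'm \<Rightarrow> bool" where
  "claim c b y n \<longleftrightarrow> pair (pair y n) (tag b) \<in> coded c"

lemma claim_less: "claim c b y n \<Longrightarrow> y < c \<and> n < c"
  unfolding claim_def using coded_less le_pair1 le_pair2 by (meson le_less_trans)

lemma Delta0_claim: "tm_fun t \<Longrightarrow> tm_fun u \<Longrightarrow> tm_fun v \<Longrightarrow> Delta0 S (\<lambda>e Z. claim (t e) b (u e) (v e))"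
  unfolding claim_def by (intro Delta0_coded tm_fun_pair tm_fun_const)

locale recursion = rca S for S :: "'m::discrete_ordered_semiring set set" +
  fixes X :: "'m set" and R :: "bool \<Rightarrow> 'm \<Rightarrow> 'm \<Rightarrow> 'm \<Rightarrow> 'm set \<Rightarrow> bool" and U :: "'m \<Rightarrow> 'm \<Rightarrow> 'm \<Rightarrow> 'm"
  assumes X: "X \<in> S" and lo: "Linear_order (rel X)"
    and Delta0_R: "Delta0 S (\<lambda>e Z. R b (e 0) (e 1) (e 2) Z)"
    and tm_fun_U: "tm_fun (\<lambda>e. U (e 0) (e 1) (e 2))"
    and use_bound: "(\<And>q. q < U w n y \<Longrightarrow> q \<in> Z \<longleftrightarrow> q \<in> Z') \<Longrightarrow> R b w n y Z \<longleftrightarrow> R b w n y Z'"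
begin

definition answers :: "'m \<Rightarrow> 'm \<Rightarrow> 'm set" where
  "answers c y = {q. \<exists>z\<le>q. \<exists>m\<le>q. q = pair z m \<and> oless X z y \<and> claim c True z m}"

text \<open>All pairs below the use bound must be decided, since the absence of a claim carries no
  information: only then do the positive answers fix the part of the set that \<open>R\<close>
  inspects. The bound \<open>k\<close> on witnesses keeps support bounded.\<close>

definition supp :: "bool \<Rightarrow> 'm \<Rightarrow> 'm \<Rightarrow> 'm \<Rightarrow> 'm \<Rightarrow> bool" where
  "supp b k c y n \<longleftrightarrow> (\<exists>w<k. (\<forall>q<U w n y. \<forall>z\<le>q. \<forall>m\<le>q. q = pair z m \<and> oless X z y \<longrightarrow>
      claim c True z m \<or> claim c False z m) \<and> R b w n y (answers c y))"

text \<open>The claims need no order of derivation, because support consults only claims at smaller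
  points. Consistency is not demanded either; it becomes part of \<open>good\<close>.\<close>

definition cert :: "'m \<Rightarrow> 'm \<Rightarrow> bool" where
  "cert k c \<longleftrightarrow> (\<forall>y<c. \<forall>n<c. (claim c True y n \<longrightarrow> supp True k c y n) \<and>
    (claim c False y n \<longrightarrow> supp False k c y n))"

definition G :: "bool \<Rightarrow> 'm \<Rightarrow> 'm \<Rightarrow> bool" where
  "G b y n \<longleftrightarrow> (\<exists>k c. cert k c \<and> claim c b y n)"

lemma cert_iff: "cert k c \<longleftrightarrow> (\<forall>b y n. claim c b y n \<longrightarrow> supp b k c y n)"
  unfolding cert_def using claim_less by (metis (full_types))

lemma pair_in_answers: "pair z m \<in> answers c y \<longleftrightarrow> oless X z y \<and> claim c True z m"
  unfolding answers_def using le_pair1 le_pair2 by (auto simp: pair_inject)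

lemma answers_pair: "q \<in> answers c y \<Longrightarrow> \<exists>z m. q = pair z m"
  unfolding answers_def by blast

lemma suppI:
  assumes "w < k" "\<And>z m. pair z m < U w n y \<Longrightarrow> oless X z y \<Longrightarrow> claim c True z m \<or> claim c False z m"
    "R b w n y (answers c y)"
  shows "supp b k c y n"
  unfolding supp_def using assms by blast

lemma suppE:
  assumes "supp b k c y n"
  obtains w where "w < k" "\<And>z m. pair z m < U w n y \<Longrightarrow> oless X z y \<Longrightarrow> claim c True z m \<or> claim c False z m"
    "R b w n y (answers c y)"
  using assms le_pair1 le_pair2 unfolding supp_def by metis

lemma Delta0_answers: "tm_fun t \<Longrightarrow> tm_fun u \<Longrightarrow> tm_fun v \<Longrightarrow> Delta0 S (\<lambda>e Z. t e \<in> answers (u e) (v e))"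
proof -
  have "Delta0 S (\<lambda>e Z. e 0 \<in> answers (e 1) (e 2))" unfolding answers_def mem_Collect_eq
    by (intro Delta0_claim Delta0_oless X Delta0_rules)
  then show "tm_fun t \<Longrightarrow> tm_fun u \<Longrightarrow> tm_fun v \<Longrightarrow> Delta0 S (\<lambda>e Z. t e \<in> answers (u e) (v e))"
    by (rule Delta0_inst3)
qed

lemma Delta0_R_answers:
  assumes "tm_fun t" "tm_fun u" "tm_fun v" "tm_fun c"
  shows "Delta0 S (\<lambda>e Z. R b (t e) (u e) (v e) (answers (c e) (v e)))"
proof -
  let ?f = "\<lambda>e. case_nat (t e) (case_nat (u e) (case_nat (v e) e))"
  have f: "tm_fun (\<lambda>e. ?f e i)" for i by (intro tm_fun_push tm_fun_var assms)
  have "tm_fun (\<lambda>e. c (\<lambda>i. e (Suc i)))" "tm_fun (\<lambda>e. v (\<lambda>i. e (Suc i)))"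
    by (rule tm_fun_subst[OF assms(4)] tm_fun_subst[OF assms(3)], rule tm_fun_var)+
  then have a: "Delta0 S (\<lambda>e Z. e 0 \<in> answers (c (\<lambda>i. e (Suc i))) (v (\<lambda>i. e (Suc i))))"
    by (intro Delta0_answers tm_fun_var)
  from Delta0_subst_set[where f = ?f and A = "\<lambda>e Z. answers (c e) (v e)", OF Delta0_R f a]
  show ?thesis by (simp add: numeral_2_eq_2)
qed

lemma Delta0_supp:
  assumes "tm_fun k" "tm_fun c" "tm_fun y" "tm_fun n" shows "Delta0 S (\<lambda>e Z. supp b (k e) (c e) (y e) (n e))"
proof -
  have "Delta0 S (\<lambda>e Z. supp b (e 0) (e 1) (e 2) (e 3))" unfolding supp_def
    by (intro Delta0_R_answers Delta0_claim Delta0_oless X tm_fun_inst3[OF tm_fun_U] Delta0_rules)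
  then show ?thesis using assms by (rule Delta0_inst4)
qed

lemma Delta0_cert: "tm_fun k \<Longrightarrow> tm_fun c \<Longrightarrow> Delta0 S (\<lambda>e Z. cert (k e) (c e))"
proof -
  have "Delta0 S (\<lambda>e Z. cert (e 0) (e 1))" unfolding cert_def
    by (intro Delta0_claim Delta0_supp Delta0_rules)
  then show "tm_fun k \<Longrightarrow> tm_fun c \<Longrightarrow> Delta0 S (\<lambda>e Z. cert (k e) (c e))" by (rule Delta0_inst2)
qed

lemma Sigma1_G: "tm_fun t \<Longrightarrow> tm_fun u \<Longrightarrow> Sigma1 S (\<lambda>e. G b (t e) (u e))"
proof -
  assume *: "tm_fun t" "tm_fun u"
  have "tm_fun (\<lambda>e. t (\<lambda>i. e (Suc (Suc i))))" "tm_fun (\<lambda>e. u (\<lambda>i. e (Suc (Suc i))))"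
    by (rule tm_fun_subst[OF *(1)] tm_fun_subst[OF *(2)], rule tm_fun_var)+
  then show ?thesis unfolding G_def by (intro Sigma1_ex Sigma1_Delta0 Delta0_conj Delta0_cert Delta0_claim tm_fun_var)
qed

text \<open>Support survives a larger set of claims if no new positive claim contradicts an old
  negative one, for then the answers agree on everything that was inspected.\<close>

lemma supp_mono:
  assumes "supp b k c y n" "k \<le> k'"
    and incl: "\<And>b z m. oless X z y \<Longrightarrow> claim c b z m \<Longrightarrow> claim c' b z m"
    and cons: "\<And>z m. oless X z y \<Longrightarrow> claim c' True z m \<Longrightarrow> \<not> claim c False z m"
  shows "supp b k' c' y n"
proof -
  obtain w where w: "w < k" "\<And>z m. pair z m < U w n y \<Longrightarrow> oless X z y \<Longrightarrow> claim c True z m \<or> claim c False z m"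
    "R b w n y (answers c y)" using suppE[OF assms(1)] by blast
  have "q \<in> answers c y \<longleftrightarrow> q \<in> answers c' y" if q: "q < U w n y" for q
  proof (cases "\<exists>z m. q = pair z m")
    case True
    then obtain z m where "q = pair z m" by blast
    then show ?thesis using w(2)[of z m] q incl cons by (auto simp: pair_in_answers)
  qed (use answers_pair in blast)
  then have "R b w n y (answers c' y)" using use_bound w(3) by blast
  moreover have "w < k'" using w(1) assms(2) by simp
  moreover have "claim c' True z m \<or> claim c' False z m" if "pair z m < U w n y" "oless X z y" for z m
    using w(2)[OF that] incl[OF that(2)] by blast
  ultimately show ?thesis by (intro suppI)
qed

text \<open>Being decided is \<Sigma>1 and being consistent is \<Pi>1; together, for all
  \<open>n\<close>, this is the \<Pi>2 property to which transfinite induction is applied.\<close>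

definition good :: "'m \<Rightarrow> bool" where
  "good y \<longleftrightarrow> (\<forall>n. (G True y n \<or> G False y n) \<and> \<not> (G True y n \<and> G False y n))"

definition covers :: "'m \<Rightarrow> 'm \<Rightarrow> 'm \<Rightarrow> bool" where
  "covers L y c \<longleftrightarrow> (\<forall>z<c. \<forall>m<c. claim c True z m \<or> claim c False z m \<longrightarrow> oless X z y) \<and>
    (\<forall>q<L. \<forall>z\<le>q. \<forall>m\<le>q. q = pair z m \<and> oless X z y \<longrightarrow> claim c True z m \<or> claim c False z m)"

lemma covers_iff:
  "covers L y c \<longleftrightarrow> (\<forall>b z m. claim c b z m \<longrightarrow> oless X z y) \<and>
    (\<forall>z m. pair z m < L \<and> oless X z y \<longrightarrow> claim c True z m \<or> claim c False z m)"
proof -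
  have "(\<forall>z<c. \<forall>m<c. claim c True z m \<or> claim c False z m \<longrightarrow> oless X z y) \<longleftrightarrow>
      (\<forall>b z m. claim c b z m \<longrightarrow> oless X z y)"
    using claim_less by (metis (full_types))
  moreover have "(\<forall>q<L. \<forall>z\<le>q. \<forall>m\<le>q. q = pair z m \<and> oless X z y \<longrightarrow> claim c True z m \<or> claim c False z m) \<longleftrightarrow>
      (\<forall>z m. pair z m < L \<and> oless X z y \<longrightarrow> claim c True z m \<or> claim c False z m)"
    using le_pair1 le_pair2 by blast
  ultimately show ?thesis unfolding covers_def by simp
qed

text \<open>Here \<open>D\<close> is an initial segment of good points. It is instantiated with the
  points below \<open>x\<close> to show that goodness is progressive, and with the whole field to
  obtain the solution.\<close>

context
  fixes D Z
  assumes D: "D \<in> S" "\<forall>y\<in>D. \<forall>z. oless X z y \<longrightarrow> z \<in> D" and good: "\<forall>y\<in>D. good y"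
    and Z_def: "Z = {pair y n | y n. y \<in> D \<and> G True y n}"
begin

lemma pair_in_Z: "pair y n \<in> Z \<longleftrightarrow> y \<in> D \<and> G True y n"
  by (auto simp: Z_def pair_inject)

lemma not_G_False: "y \<in> D \<Longrightarrow> G False y n \<longleftrightarrow> \<not> G True y n"
  using good unfolding good_def by blast

text \<open>On good points \<open>G False\<close> is a \<Sigma>1 definition of the complement of
  \<open>G True\<close>, so \<open>Z\<close> is obtained by \<Delta>1 comprehension.\<close>

lemma Z_in_S: "Z \<in> S"
proof -
  have Z: "p \<in> Z \<longleftrightarrow> (\<exists>y n. p = pair y n \<and> y \<in> D \<and> G True y n)" for p
    unfolding Z_def by blast
  have notZ: "p \<notin> Z \<longleftrightarrow> \<not> (\<exists>y\<le>p. \<exists>n\<le>p. p = pair y n \<and> y \<in> D) \<or> (\<exists>y n. p = pair y n \<and> y \<in> D \<and> G False y n)" for p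
  proof (cases "\<exists>y n. p = pair y n \<and> y \<in> D")
    case True
    then obtain y n where p: "p = pair y n" "y \<in> D" by blast
    then have "\<exists>y\<le>p. \<exists>n\<le>p. p = pair y n \<and> y \<in> D" using le_pair1 le_pair2 by metis
    then show ?thesis unfolding Z using p not_G_False pair_inject by metis
  next
    case False
    then show ?thesis unfolding Z by metis
  qed
  have "{p. p \<in> Z} \<in> S"
  proof (rule Delta1_comprehension)
    show "Sigma1 S (\<lambda>e. e 0 \<in> Z)" unfolding Z
      by (intro Sigma1_ex Sigma1_conj Sigma1_G Sigma1_Delta0[OF Delta0_eq] Sigma1_Delta0[OF Delta0_mem] D tm_fun_pair tm_fun_var)
    show "Sigma1 S (\<lambda>e. e 0 \<notin> Z)" unfolding notZ
      by (intro Sigma1_disj Sigma1_Delta0[OF Delta0_not[OF Delta0_bex_le]] Delta0_rules D)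
        (intro Sigma1_ex Sigma1_conj Sigma1_G Sigma1_Delta0[OF Delta0_eq] Sigma1_Delta0[OF Delta0_mem] D tm_fun_pair tm_fun_var)
  qed
  then show ?thesis by simp
qed

lemma answers_eq:
  assumes pre: "\<forall>z. oless X z y \<longrightarrow> z \<in> D" and c: "cert k c"
    and dec: "\<And>z m. pair z m < L \<Longrightarrow> oless X z y \<Longrightarrow> claim c True z m \<or> claim c False z m"
    and q: "q < L"
  shows "q \<in> answers c y \<longleftrightarrow> q \<in> restrict_to X Z y"
proof (cases "\<exists>z m. q = pair z m")
  case True
  then obtain z m where [simp]: "q = pair z m" by blast
  have "claim c True z m \<longleftrightarrow> pair z m \<in> Z" if z: "oless X z y"
  proof
    assume "claim c True z m"
    then show "pair z m \<in> Z" unfolding pair_in_Z G_def using c pre[rule_format, OF z] by blast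
  next
    assume "pair z m \<in> Z"
    then have "\<not> claim c False z m"
      using c not_G_False[OF pre[rule_format, OF z], of m] unfolding pair_in_Z G_def by blast
    then show "claim c True z m" using dec z q by auto
  qed
  then show ?thesis by (auto simp: pair_in_answers pair_in_restrict_to)
next
  case False
  then show ?thesis using answers_pair unfolding restrict_to_def by blast
qed

lemma G_imp_R:
  assumes pre: "\<forall>z. oless X z y \<longrightarrow> z \<in> D" and "G b y n"
  shows "\<exists>w. R b w n y (restrict_to X Z y)"
proof -
  obtain k c where c: "cert k c" "claim c b y n" using assms(2) unfolding G_def by blast
  then have "supp b k c y n" unfolding cert_iff by blast
  then obtain w where w: "\<And>z m. pair z m < U w n y \<Longrightarrow> oless X z y \<Longrightarrow> claim c True z m \<or> claim c False z m"
    "R b w n y (answers c y)" using suppE by blast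
  have "R b w n y (answers c y) \<longleftrightarrow> R b w n y (restrict_to X Z y)"
    by (rule use_bound, rule answers_eq[OF pre c(1) w(1)])
  then show ?thesis using w(2) by blast
qed

lemma ex_claims:
  assumes "\<forall>p\<in>A. p < k" "A \<in> S"
  shows "\<exists>c. \<forall>b y n. claim c b y n \<longleftrightarrow> pair (pair y n) (tag b) \<in> A"
proof -
  obtain c where "coded c = A" using ex_code[OF assms(2), of k] assms(1) by blast
  then show ?thesis unfolding claim_def by blast
qed

text \<open>Each pair below \<open>y\<close> has a certificate of its own; a single one for all
  pairs below the bound \<open>L\<close> is assembled by \<Sigma>1 induction on
  \<open>L\<close>.\<close>

lemma pre_certificate:
  assumes pre: "\<forall>z. oless X z y \<longrightarrow> z \<in> D"
  shows "\<exists>k c. cert k c \<and> covers L y c"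
proof (rule Sigma1_induct[where P = "\<lambda>L. \<exists>k c. cert k c \<and> covers L y c"])
  show "Sigma1 S (\<lambda>e. \<exists>k c. cert k c \<and> covers (e 0) y c)" unfolding covers_def
    by (rule Sigma1_ex, rule Sigma1_ex, rule Sigma1_Delta0) (intro Delta0_cert Delta0_claim Delta0_oless X Delta0_rules)
next
  have "{} \<in> S" using Delta0_comprehension[where P = "\<lambda>_. False", OF Delta0_const] by simp
  then obtain c :: 'm where "\<forall>b y n. \<not> claim c b y n" using ex_claims[of "{}" 0] by auto
  then show "\<exists>k c. cert k c \<and> covers 0 y c"
    unfolding cert_iff covers_iff using not_less_zero by (intro exI[of _ 0] exI[of _ c]) auto
next
  fix j assume "\<exists>k c. cert k c \<and> covers j y c"
  then obtain k c where c: "cert k c" and cov: "covers j y c" by blast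
  show "\<exists>k c. cert k c \<and> covers (j + 1) y c"
  proof (cases "\<exists>z m. j = pair z m \<and> oless X z y")
    case False
    then have "covers (j + 1) y c" using cov unfolding covers_iff less_add_one_iff le_less by blast
    then show ?thesis using c by blast
  next
    case True
    then obtain z0 m0 where j: "j = pair z0 m0" and z0: "oless X z0 y" by blast
    have "good z0" using good pre z0 by blast
    then obtain b0 where "G b0 z0 m0" unfolding good_def by blast
    then obtain k' c' where c': "cert k' c'" "claim c' b0 z0 m0" unfolding G_def by blast
    \<comment> \<open>The two certificates are united and cut down to points below \<open>y\<close>.
      The cut preserves support, which only looks downwards, and the union creates no conflict,
      since all remaining points are good.\<close>
    let ?A = "{p. (p \<in> coded c \<or> p \<in> coded c') \<and> (\<exists>q\<le>p. \<exists>z\<le>q. \<exists>m\<le>q. \<exists>t\<le>p. p = pair q t \<and> q = pair z m \<and> oless X z y)}"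
    have A: "?A \<in> S" by (rule Delta0_comprehension) (intro Delta0_coded coded_in_S Delta0_oless X Delta0_rules)
    have bound: "\<forall>p\<in>?A. p < max c c'" using coded_less by (auto simp: less_max_iff_disj)
    from ex_claims[of ?A, OF bound A] obtain d
      where "\<forall>b z m. claim d b z m \<longleftrightarrow> pair (pair z m) (tag b) \<in> ?A" by (elim exE) (rule that)
    note d = this[rule_format]
    have d: "claim d b z m \<longleftrightarrow> (claim c b z m \<or> claim c' b z m) \<and> oless X z y" for b z m
    proof -
      have "(\<exists>q\<le>pair (pair z m) (tag b). \<exists>z'\<le>q. \<exists>m'\<le>q. \<exists>t\<le>pair (pair z m) (tag b).
          pair (pair z m) (tag b) = pair q t \<and> q = pair z' m' \<and> oless X z' y) \<longleftrightarrow> oless X z y"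
      proof
        assume z: "oless X z y"
        show "\<exists>q\<le>pair (pair z m) (tag b). \<exists>z'\<le>q. \<exists>m'\<le>q. \<exists>t\<le>pair (pair z m) (tag b).
          pair (pair z m) (tag b) = pair q t \<and> q = pair z' m' \<and> oless X z' y"
          by (rule exI[of _ "pair z m"], rule conjI[OF le_pair1], rule exI[of _ z], rule conjI[OF le_pair1],
              rule exI[of _ m], rule conjI[OF le_pair2], rule exI[of _ "tag b"], rule conjI[OF le_pair2])
            (simp add: z)
      qed (auto simp: pair_inject)
      then show ?thesis
        by (simp only: d[of b z m] mem_Collect_eq claim_def[of c b z m] claim_def[of c' b z m])
    qed
    have sound: "G b z m" if "claim d b z m" for b z m
      using that c c'(1) unfolding d G_def by blast
    have "supp b (max k k') d z m" if dz: "claim d b z m" for b z m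
    proof -
      have z: "oless X z y" and cc: "claim c b z m \<or> claim c' b z m" using dz unfolding d by blast+
      have up: "oless X z' y" if "oless X z' z" for z' using oless_trans[OF lo that z] .
      have no: "\<not> G False z' m'" if "oless X z' z" "claim d True z' m'" for z' m'
        using not_G_False[OF pre[rule_format, OF up[OF that(1)]]] sound[OF that(2)] by blast
      from cc show ?thesis
      proof
        assume "claim c b z m"
        then have "supp b k c z m" using c unfolding cert_iff by blast
        then show ?thesis
          by (rule supp_mono) (use d up no c in \<open>auto simp: G_def\<close>)
      next
        assume "claim c' b z m"
        then have "supp b k' c' z m" using c'(1) unfolding cert_iff by blast
        then show ?thesis
          by (rule supp_mono) (use d up no c' in \<open>auto simp: G_def\<close>)
      qed
    qed
    then have "cert (max k k') d" unfolding cert_iff by blast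
    moreover have "claim d True z m \<or> claim d False z m" if "pair z m < j + 1" "oless X z y" for z m
    proof (cases "pair z m = j")
      case True
      then have "z = z0" "m = m0" using j pair_inject by metis+
      then show ?thesis using c'(2) d z0 by (cases b0) auto
    next
      case False
      then have "pair z m < j" using that(1) unfolding less_add_one_iff by simp
      then have "claim c True z m \<or> claim c False z m" using cov that(2) unfolding covers_iff by blast
      then show ?thesis unfolding d using that(2) by blast
    qed
    then have "covers (j + 1) y d" unfolding covers_iff using d by blast
    ultimately show ?thesis by blast
  qed
qed

text \<open>A certificate covering the use gives the same answers as the true set. The confirmed
  claim at \<open>y\<close> can then be added; the old claims lie strictly below \<open>y\<close>,
  so their support is not affected.\<close>

lemma R_imp_G:
  assumes pre: "\<forall>z. oless X z y \<longrightarrow> z \<in> D" and R: "R b w n y (restrict_to X Z y)"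
  shows "G b y n"
proof -
  obtain k c where c: "cert k c" and "covers (U w n y) y c"
    using pre_certificate[OF pre, of "U w n y"] by blast
  then have below: "claim c b z m \<Longrightarrow> oless X z y"
    and dec: "pair z m < U w n y \<Longrightarrow> oless X z y \<Longrightarrow> claim c True z m \<or> claim c False z m" for b z m
    unfolding covers_iff by blast+
  let ?A = "insert (pair (pair y n) (tag b)) (coded c)"
  have A: "?A \<in> S" by (intro insert_in_S coded_in_S)
  have bound: "\<forall>p\<in>?A. p < max c (pair (pair y n) (tag b) + 1)"
    using coded_less[of _ c] by (auto simp: less_max_iff_disj less_add_one_iff)
  from ex_claims[of ?A, OF bound A] obtain d
    where "\<forall>b z m. claim d b z m \<longleftrightarrow> pair (pair z m) (tag b) \<in> ?A" by (elim exE) (rule that)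
  note d = this[rule_format]
  have tag: "tag b = (tag b' :: 'm) \<longleftrightarrow> b = b'" for b b' by (auto simp: tag_def)
  have d: "claim d b' z m \<longleftrightarrow> claim c b' z m \<or> b' = b \<and> z = y \<and> m = n" for b' z m
    unfolding d insert_iff pair_inject tag claim_def[symmetric] by blast
  have irr: "\<not> oless X y y" unfolding oless_def by simp
  have old: "supp b' (max k (w + 1)) d z m" if cz: "claim c b' z m" for b' z m
  proof -
    have z: "oless X z y" using below cz .
    have up: "oless X z' y" if "oless X z' z" for z' using oless_trans[OF lo that z] .
    have "supp b' k c z m" using c cz unfolding cert_iff by blast
    then show ?thesis
    proof (rule supp_mono)
      fix z' m' assume z': "oless X z' z" and "claim d True z' m'"
      then have "claim c True z' m'" using d up irr by blast
      then show "\<not> claim c False z' m'"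
        using c not_G_False[OF pre[rule_format, OF up[OF z']], of m'] unfolding G_def by blast
    qed (use d in auto)
  qed
  \<comment> \<open>The added claim is at \<open>y\<close> itself and hence not among the answers
    below \<open>y\<close>.\<close>
  have ora: "answers d y = answers c y"
    unfolding answers_def d using irr by blast
  have "R b w n y (answers c y) \<longleftrightarrow> R b w n y (restrict_to X Z y)"
    by (rule use_bound, rule answers_eq[OF pre c dec])
  then have "R b w n y (answers c y)" using R by blast
  then have "supp b (max k (w + 1)) d y n"
    using dec d by (intro suppI[of w]) (auto simp: ora less_max_iff_disj less_add_one_iff)
  then have "cert (max k (w + 1)) d" unfolding cert_iff using old d by blast
  then show ?thesis unfolding G_def using d by blast
qed

end

theorem recursion_solution:
  assumes TI: "Pi02_transfinite_induction S X"
    and hyp: "\<And>n x Z. x \<in> ofield X \<Longrightarrow> Z \<in> S \<Longrightarrow> (\<forall>p\<in>Z. \<exists>y n. p = pair y n) \<Longrightarrow>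
      (\<And>y n. pair y n \<in> Z \<longleftrightarrow> oless X y x \<and> (\<exists>w. R True w n y (restrict_to X Z y))) \<Longrightarrow>
      (\<exists>w. R True w n x Z) \<longleftrightarrow> \<not> (\<exists>w. R False w n x Z)"
  shows "\<exists>Y\<in>S. (\<forall>p\<in>Y. \<exists>y n. p = pair y n) \<and>
    (\<forall>y n. pair y n \<in> Y \<longleftrightarrow> y \<in> ofield X \<and> (\<exists>w. R True w n y (restrict_to X Y y)))"
proof -
  have pairs: "\<forall>p\<in>{pair y n | y n. P y n}. \<exists>y n. p = pair y n" for P :: "'m \<Rightarrow> 'm \<Rightarrow> bool" by blast
  \<comment> \<open>The effectivity hypothesis concerns sets in \<open>S\<close> solving the
    recursion below \<open>x\<close>. Goodness below \<open>x\<close> provides such a set, so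
    exactly one of the two searches at \<open>x\<close> succeeds.\<close>
  have prog: "good x" if x: "x \<in> ofield X" and IH: "\<And>y. oless X y x \<Longrightarrow> good y" for x
  proof -
    define D where "D = {y. oless X y x}"
    define Z where "Z = {pair y n | y n. y \<in> D \<and> G True y n}"
    have D: "D \<in> S" unfolding D_def by (rule Delta0_comprehension) (intro Delta0_oless X tm_fun_var tm_fun_const)
    have D2: "\<forall>y\<in>D. \<forall>z. oless X z y \<longrightarrow> z \<in> D" "\<forall>y\<in>D. good y"
      unfolding D_def using oless_trans[OF lo] IH by blast+
    note ctx = D D2 Z_def
    have GR: "G b y n \<longleftrightarrow> (\<exists>w. R b w n y (restrict_to X Z y))" if "\<forall>z. oless X z y \<longrightarrow> z \<in> D" for b y n
      using G_imp_R[OF ctx that] R_imp_G[OF ctx that] by blast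
    have ZR: "pair y n \<in> Z \<longleftrightarrow> oless X y x \<and> (\<exists>w. R True w n y (restrict_to X Z y))" for y n
      using GR[of y True n] D2(1) pair_in_Z[OF ctx, of y n] unfolding D_def by blast
    have restr: "restrict_to X Z x = Z"
      unfolding restrict_to_def using pair_in_Z[OF ctx] unfolding Z_def D_def by blast
    have "(\<exists>w. R True w n x Z) \<longleftrightarrow> \<not> (\<exists>w. R False w n x Z)" for n
      by (rule hyp[OF x Z_in_S[OF ctx] _ ZR]) (unfold Z_def, rule pairs)
    moreover have "G b x n \<longleftrightarrow> (\<exists>w. R b w n x Z)" for b n
      using GR[of x b n] restr by (simp add: D_def)
    ultimately show ?thesis unfolding good_def by blast
  qed
  \<comment> \<open>A common bound \<open>j\<close> for two contradictory certificates makes a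
    conflict bounded and its absence \<Pi>1.\<close>
  define bad where "bad j y n \<longleftrightarrow> (\<exists>k\<le>j. \<exists>c\<le>j. \<exists>k'\<le>j. \<exists>c'\<le>j. cert k c \<and> claim c True y n \<and>
    cert k' c' \<and> claim c' False y n)" for j y n
  have bad: "G True y n \<and> G False y n \<longleftrightarrow> (\<exists>j. bad j y n)" for y n
  proof
    assume "G True y n \<and> G False y n"
    then obtain k c k' c' where *: "cert k c \<and> claim c True y n \<and> cert k' c' \<and> claim c' False y n"
      unfolding G_def by blast
    moreover have "k \<le> k + c + k' + c'" "c \<le> k + c + k' + c'" "k' \<le> k + c + k' + c'" "c' \<le> k + c + k' + c'"
      by (simp_all add: zero_least add_increasing add_increasing2)
    ultimately show "\<exists>j. bad j y n" unfolding bad_def by blast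
  qed (auto simp: bad_def G_def)
  \<comment> \<open>One number \<open>i\<close> codes both the instance \<open>n\<close> and the
    stage \<open>j\<close> at which no conflict is visible, so that goodness takes the form of one
    universal quantifier over a \<Sigma>1 predicate.\<close>
  define A where "A y i \<longleftrightarrow> (\<forall>n\<le>i. \<forall>j\<le>i. i = pair n j \<longrightarrow> (G True y n \<or> G False y n) \<and> \<not> bad j y n)" for y i
  have good: "good y \<longleftrightarrow> (\<forall>i. A y i)" for y
  proof
    assume "good y"
    then show "\<forall>i. A y i" unfolding A_def good_def bad by blast
  next
    assume *: "\<forall>i. A y i"
    have "(G True y n \<or> G False y n) \<and> \<not> bad j y n" for n j
      using *[rule_format, of "pair n j"] le_pair1 le_pair2 unfolding A_def by blast
    then show "good y" unfolding good_def bad by blast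
  qed
  have "Delta0 S (\<lambda>e Z. bad (e 0) (e 1) (e 2))" unfolding bad_def
    by (intro Delta0_cert Delta0_claim Delta0_rules)
  note Delta0_bad = Delta0_inst3[OF this]
  have "Sigma1 S (\<lambda>e. \<forall>n<e 1 + 1. \<forall>j<e 1 + 1. e 1 = pair n j \<longrightarrow> (G True (e 0) n \<or> G False (e 0) n) \<and> \<not> bad j (e 0) n)"
    by (rule Sigma1_ball, intro Delta0_rules, rule Sigma1_ball, intro Delta0_rules, rule Sigma1_imp, intro Delta0_rules)
      (intro Sigma1_conj Sigma1_disj Sigma1_G Sigma1_Delta0[OF Delta0_not] Delta0_bad tm_fun_var)
  then have "Sigma1 S (\<lambda>e. A (e 0) (e 1))" unfolding A_def less_add_one_iff .
  from Pi02_induct[where A = A, OF TI this] prog have all: "good x" if "x \<in> ofield X" for x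
    unfolding good using that by blast
  define Y where "Y = {pair y n | y n. y \<in> ofield X \<and> G True y n}"
  have "{x. pair x x \<in> X} \<in> S" by (rule Delta0_comprehension) (intro Delta0_mem X tm_fun_pair tm_fun_var)
  moreover have "ofield X = {x. pair x x \<in> X}" by (intro set_eqI) (simp add: ofield_iff[OF lo])
  ultimately have D: "ofield X \<in> S" by simp
  have D2: "\<forall>y\<in>ofield X. \<forall>z. oless X z y \<longrightarrow> z \<in> ofield X" "\<forall>y\<in>ofield X. good y"
    using oless_ofield(1) all by blast+
  note ctx = D D2 Y_def
  have "pair y n \<in> Y \<longleftrightarrow> y \<in> ofield X \<and> (\<exists>w. R True w n y (restrict_to X Y y))" for y n
    using G_imp_R[OF ctx, of y True n] R_imp_G[OF ctx, of y True _ n] D2 pair_in_Z[OF ctx, of y n] by blast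
  moreover have "\<forall>p\<in>Y. \<exists>y n. p = pair y n" unfolding Y_def by (rule pairs)
  ultimately show ?thesis using Z_in_S[OF ctx] by (intro bexI[of _ Y] conjI allI)
qed

end

theorem (in rca) induction_imp_SETR:
  assumes X: "X \<in> S" and lo: "Linear_order (rel X)" and TI: "Pi02_transfinite_induction S X"
  shows "SETR S X"
  unfolding SETR_def
proof (intro allI impI, elim conjE)
  fix \<phi> \<psi> e E
  assume "Sigma01 \<phi>" "Sigma01 \<psi>" and E: "range E \<subseteq> S"
    and hyp: "\<forall>n. \<forall>x\<in>ofield X. \<forall>Z\<in>S. H e E \<phi> (below X x) Z \<longrightarrow> (sat3 e E \<phi> n x Z \<longleftrightarrow> \<not> sat3 e E \<psi> n x Z)"
  then obtain \<theta> \<eta> where \<theta>: "bounded_fm \<theta>" "\<phi> = Exists \<theta>" and \<eta>: "bounded_fm \<eta>" "\<psi> = Exists \<eta>"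
    unfolding Sigma01_def by blast
  define R where "R b w n x Z \<longleftrightarrow> sat (push w (push n (push x e))) (push Z E) (if b then \<theta> else \<eta>)" for b w n x Z
  have tm: "tm_fun (\<lambda>e'. push (e' 0) (push (e' 1) (push (e' 2) e)) i)" for i
    by (intro tm_fun_push tm_fun_var tm_fun_const)
  have Delta0_R: "Delta0 S (\<lambda>e Z. R b (e 0) (e 1) (e 2) Z)" for b unfolding R_def
    using \<theta>(1) \<eta>(1) by (intro Delta0_sat[where f = "\<lambda>e'. push (e' 0) (push (e' 1) (push (e' 2) e))"] E tm) auto
  from Delta0_use[OF Delta0_R[of True]] obtain B where B: "tm_fun B"
    "\<forall>e Z Z'. (\<forall>q<B e. q \<in> Z \<longleftrightarrow> q \<in> Z') \<longrightarrow> (R True (e 0) (e 1) (e 2) Z \<longleftrightarrow> R True (e 0) (e 1) (e 2) Z')"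
    by (elim exE conjE) (rule that)
  from Delta0_use[OF Delta0_R[of False]] obtain C where C: "tm_fun C"
    "\<forall>e Z Z'. (\<forall>q<C e. q \<in> Z \<longleftrightarrow> q \<in> Z') \<longrightarrow> (R False (e 0) (e 1) (e 2) Z \<longleftrightarrow> R False (e 0) (e 1) (e 2) Z')"
    by (elim exE conjE) (rule that)
  let ?f = "\<lambda>w n y. case_nat w (case_nat n (case_nat y (\<lambda>_. 0::'m)))"
  \<comment> \<open>Adding both use bounds lets one \<open>U\<close> serve both formulas. The actual
    parameters are already inside \<open>R\<close>, so the environment is filled up with 0.\<close>
  define U where "U w n y = B (?f w n y) + C (?f w n y)" for w n y
  have f: "tm_fun (\<lambda>e. ?f (e 0) (e 1) (e 2) i)" for i by (intro tm_fun_push tm_fun_var tm_fun_const)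
  have "tm_fun (\<lambda>e. U (e 0) (e 1) (e 2))" unfolding U_def
    by (intro tm_fun_add tm_fun_subst[where f = "\<lambda>e. ?f (e 0) (e 1) (e 2)", OF B(1) f]
        tm_fun_subst[where f = "\<lambda>e. ?f (e 0) (e 1) (e 2)", OF C(1) f])
  note tm_fun_U = this
  have use_bound: "R b w n y Z \<longleftrightarrow> R b w n y Z'" if q: "\<And>q. q < U w n y \<Longrightarrow> q \<in> Z \<longleftrightarrow> q \<in> Z'" for b w n y Z Z'
  proof -
    have "\<forall>q<B (?f w n y). q \<in> Z \<longleftrightarrow> q \<in> Z'" "\<forall>q<C (?f w n y). q \<in> Z \<longleftrightarrow> q \<in> Z'"
      using q le_add_same[where a = "B (?f w n y)" and b = "C (?f w n y)"] unfolding U_def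
      by (meson less_le_trans)+
    then show ?thesis
      using B(2)[rule_format, of "?f w n y" Z Z'] C(2)[rule_format, of "?f w n y" Z Z']
      by (cases b) (simp_all add: numeral_2_eq_2)
  qed
  interpret recursion S X R U
  proof unfold_locales
    show "R b w n y Z \<longleftrightarrow> R b w n y Z'" if "\<And>q. q < U w n y \<Longrightarrow> q \<in> Z \<longleftrightarrow> q \<in> Z'" for b w n y Z Z'
      using that by (rule use_bound)
  qed (fact X lo Delta0_R tm_fun_U)+
  have sat: "sat3 e E \<phi> n x Z \<longleftrightarrow> (\<exists>w. R True w n x Z)" "sat3 e E \<psi> n x Z \<longleftrightarrow> (\<exists>w. R False w n x Z)" for n x Z
    by (simp_all add: R_def \<theta>(2) \<eta>(2))
  have "\<exists>Y\<in>S. (\<forall>p\<in>Y. \<exists>y n. p = pair y n) \<and>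
    (\<forall>y n. pair y n \<in> Y \<longleftrightarrow> y \<in> ofield X \<and> (\<exists>w. R True w n y (restrict_to X Y y)))"
  proof (rule recursion_solution[OF TI])
    fix n x Z
    assume "x \<in> ofield X" "Z \<in> S" "\<forall>p\<in>Z. \<exists>y n. p = pair y n"
      "\<And>y n. pair y n \<in> Z \<longleftrightarrow> oless X y x \<and> (\<exists>w. R True w n y (restrict_to X Z y))"
    then show "(\<exists>w. R True w n x Z) \<longleftrightarrow> \<not> (\<exists>w. R False w n x Z)"
      using hyp unfolding H_segment[OF segment_below[OF lo]] sat by simp
  qed
  then show "\<exists>Y\<in>S. H e E \<phi> X Y" unfolding H_segment[OF segment_whole] sat .
qed


section \<open>The exponential order\<close>

context rca
begin

lemma ex_least_Delta0:
  assumes "Delta0 S (\<lambda>e Z. P (e 0))" "P a" shows "\<exists>m. P m \<and> (\<forall>n<m. \<not> P n)"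
proof -
  from least_Delta0[OF assms] obtain m where "P m" "\<And>n. n < m \<Longrightarrow> \<not> P n" by blast
  then show ?thesis by blast
qed

text \<open>A total function with a \<Sigma>1 graph has a \<Delta>1 graph: a pair is refuted by
  exhibiting a different value.\<close>

lemma graph_in_S:
  assumes "Sigma1 S (\<lambda>e. f (e 0) = e 1)" shows "graph f \<in> S"
proof -
  have S1f: "Sigma1 S (\<lambda>e. f (t e) = u e)" if "tm_fun t" "tm_fun u" for t u
  proof -
    obtain Q where Q: "Delta0 S (\<lambda>e Z. Q (\<lambda>i. e (Suc i)) (e 0))" and f: "\<And>e. f (e 0) = e 1 \<longleftrightarrow> (\<exists>x. Q e x)"
      using assms unfolding Sigma1_def by blast
    let ?f = "\<lambda>e. case_nat (e 0) (case_nat (t (\<lambda>i. e (Suc i))) (\<lambda>_. u (\<lambda>i. e (Suc i))))"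
    have "tm_fun (\<lambda>e. t (\<lambda>i. e (Suc i)))" "tm_fun (\<lambda>e. u (\<lambda>i. e (Suc i)))"
      by (rule tm_fun_subst[OF that(1)] tm_fun_subst[OF that(2)], rule tm_fun_var)+
    then have "tm_fun (\<lambda>e. ?f e i)" for i by (intro tm_fun_push tm_fun_var)
    note q = Delta0_subst[where f = ?f, OF Q this]
    have "Sigma1 S (\<lambda>e. \<exists>x. Q (case_nat (t e) (\<lambda>_. u e)) x)"
      by (rule Sigma1_ex, rule Sigma1_Delta0) (use q in simp)
    moreover have "f (t e) = u e \<longleftrightarrow> (\<exists>x. Q (case_nat (t e) (\<lambda>_. u e)) x)" for e
      using f[of "case_nat (t e) (\<lambda>_. u e)"] by simp
    ultimately show ?thesis by simp
  qed
  have "{p. \<exists>x y. p = pair x y \<and> f x = y} \<in> S"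
  proof (rule Delta1_comprehension)
    show "Sigma1 S (\<lambda>e. \<exists>x y. e 0 = pair x y \<and> f x = y)"
      by (intro Sigma1_ex Sigma1_conj S1f Sigma1_Delta0[OF Delta0_eq] tm_fun_var tm_fun_pair)
    have "(\<not> (\<exists>x y. p = pair x y \<and> f x = y)) \<longleftrightarrow>
      \<not> (\<exists>x\<le>p. \<exists>y\<le>p. p = pair x y) \<or> (\<exists>x y y'. p = pair x y \<and> f x = y' \<and> y \<noteq> y')" for p
      using le_pair1 le_pair2 pair_inject by metis
    moreover have "Sigma1 S (\<lambda>e. \<not> (\<exists>x\<le>e 0. \<exists>y\<le>e 0. e 0 = pair x y) \<or>
        (\<exists>x y y'. e 0 = pair x y \<and> f x = y' \<and> y \<noteq> y'))"
      by (rule Sigma1_disj, rule Sigma1_Delta0, intro Delta0_rules)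
        (intro Sigma1_ex Sigma1_conj S1f Sigma1_Delta0[OF Delta0_eq] Sigma1_Delta0[OF Delta0_not[OF Delta0_eq]] tm_fun_var tm_fun_pair)
    ultimately show "Sigma1 S (\<lambda>e. \<not> (\<exists>x y. e 0 = pair x y \<and> f x = y))" by simp
  qed
  moreover have "{p. \<exists>x y. p = pair x y \<and> f x = y} = graph f" by (auto simp: graph_def)
  ultimately show ?thesis by simp
qed

text \<open>Function values are eliminated by an existential quantifier over the value, which
  becomes variable 0. Nested values are removed one at a time, each shifting the other
  variables.\<close>

lemma Sigma1_graph:
  assumes "graph f \<in> S" "tm_fun t" "Sigma1 S (\<lambda>e. P (\<lambda>i. e (Suc i)) (e 0))"
  shows "Sigma1 S (\<lambda>e. P e (f (t e)))"
proof -
  have "tm_fun (\<lambda>e. t (\<lambda>i. e (Suc i)))" by (rule tm_fun_subst[OF assms(2)]) (rule tm_fun_var)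
  then have "Sigma1 S (\<lambda>e. \<exists>u. pair (t e) u \<in> graph f \<and> P e u)"
    by (intro Sigma1_ex Sigma1_conj Sigma1_Delta0[OF Delta0_mem] assms tm_fun_pair tm_fun_var)
  then show ?thesis by (simp add: pair_in_graph)
qed

lemma graph_comp:
  assumes "graph f \<in> S" "graph g \<in> S" shows "graph (\<lambda>x. f (g x)) \<in> S"
proof (rule graph_in_S)
  show "Sigma1 S (\<lambda>e. f (g (e 0)) = e 1)"
    by (rule Sigma1_graph[OF assms(2) tm_fun_var, where P = "\<lambda>e u. f u = e 1"],
        rule Sigma1_graph[OF assms(1) tm_fun_var, where P = "\<lambda>e u. u = e (Suc 1)"]) (intro Sigma1_Delta0 Delta0_rules)
qed

lemma graph_shift: "graph f \<in> S \<Longrightarrow> graph (\<lambda>x. f (n + x)) \<in> S"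
  by (rule graph_comp, assumption, rule graph_in_S) (intro Sigma1_Delta0 Delta0_rules)

lemma well_orderedD:
  assumes "well_ordered S X" "graph f \<in> S" shows "\<exists>i. \<not> oless X (f (i + 1)) (f i)"
proof (rule ccontr)
  assume no: "\<not> (\<exists>i. \<not> oless X (f (i + 1)) (f i))"
  then have "\<forall>i y z. pair i y \<in> graph f \<and> pair (i + 1) z \<in> graph f \<longrightarrow> oless X z y"
    by (simp add: pair_in_graph)
  with assms fun_code_graph[of f] show False unfolding well_ordered_def by blast
qed

text \<open>Otherwise every position is followed by a change. The distance to the next change is
  computable from \<open>g\<close>, and iterating it by primitive recursion selects a strictly
  descending subsequence in \<open>S\<close>.\<close>

lemma weakly_descending_stabilizes:
  assumes wo: "well_ordered S X" and g: "graph g \<in> S"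
    and desc: "\<And>i. g (i + 1) = g i \<or> oless X (g (i + 1)) (g i)"
  shows "\<exists>n. \<forall>i. g (n + i) = g n"
proof (rule ccontr)
  assume "\<not> (\<exists>n. \<forall>i. g (n + i) = g n)"
  then have ex: "\<exists>i. g (n + i) \<noteq> g n" for n by blast
  have lo: "Linear_order (rel X)" and X: "X \<in> S" using wo by (simp_all add: well_ordered_def)
  have weak: "g (n + i) = g n \<or> oless X (g (n + i)) (g n)" for n i
  proof (rule Sigma1_induct[where P = "\<lambda>i. g (n + i) = g n \<or> oless X (g (n + i)) (g n)"])
    show "Sigma1 S (\<lambda>e. g (n + e 0) = g n \<or> oless X (g (n + e 0)) (g n))"
      by (rule Sigma1_graph[OF g, where P = "\<lambda>e u. u = g n \<or> oless X u (g n)"], intro Delta0_rules)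
        (intro Sigma1_Delta0 Delta0_oless X Delta0_rules)
  next
    fix i assume "g (n + i) = g n \<or> oless X (g (n + i)) (g n)"
    then show "g (n + (i + 1)) = g n \<or> oless X (g (n + (i + 1))) (g n)"
      using desc[of "n + i"] oless_trans[OF lo] by (metis add.assoc)
  qed simp
  have D: "Sigma1 S (\<lambda>e. g (t e) \<noteq> g (u e))" "Sigma1 S (\<lambda>e. g (t e) = g (u e))" if tu: "tm_fun t" "tm_fun u" for t u
  proof -
    have u': "tm_fun (\<lambda>e. u (\<lambda>i. e (Suc i)))" by (rule tm_fun_subst[OF tu(2)], rule tm_fun_var)
    show "Sigma1 S (\<lambda>e. g (t e) \<noteq> g (u e))"
      by (rule Sigma1_graph[OF g tu(1), where P = "\<lambda>e v. v \<noteq> g (u e)"],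
          rule Sigma1_graph[OF g u', where P = "\<lambda>e v. e 0 \<noteq> v"]) (intro Sigma1_Delta0 Delta0_rules)
    show "Sigma1 S (\<lambda>e. g (t e) = g (u e))"
      by (rule Sigma1_graph[OF g tu(1), where P = "\<lambda>e v. v = g (u e)"],
          rule Sigma1_graph[OF g u', where P = "\<lambda>e v. e 0 = v"]) (intro Sigma1_Delta0 Delta0_rules)
  qed
  define nx where "nx n = (THE i. g (n + i) \<noteq> g n \<and> (\<forall>i'<i. g (n + i') = g n))" for n
  have ex1: "\<exists>!i. g (n + i) \<noteq> g n \<and> (\<forall>i'<i. g (n + i') = g n)" for n
  proof -
    obtain i0 where i0: "g (n + i0) \<noteq> g n" using ex by blast
    have "Sigma1 S (\<lambda>e. \<not> g (n + e 0) \<noteq> g n)" unfolding not_not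
      by (rule D) (intro tm_fun.intros)+
    from least_not_Sigma1[where P = "\<lambda>i. g (n + i) \<noteq> g n", OF this i0]
    obtain m where "g (n + m) \<noteq> g n" "\<And>i'. i' < m \<Longrightarrow> \<not> g (n + i') \<noteq> g n" by blast
    note m = this
    show ?thesis
    proof (rule ex1I[of _ m])
      show "g (n + m) \<noteq> g n \<and> (\<forall>i'<m. g (n + i') = g n)" using m by blast
      fix i assume "g (n + i) \<noteq> g n \<and> (\<forall>i'<i. g (n + i') = g n)"
      then show "i = m" using m by (metis neqE)
    qed
  qed
  have nx: "nx n = i \<longleftrightarrow> g (n + i) \<noteq> g n \<and> (\<forall>i'<i. g (n + i') = g n)" for n i
  proof -
    have N: "g (n + nx n) \<noteq> g n \<and> (\<forall>i'<nx n. g (n + i') = g n)"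
      using theI'[OF ex1[of n]] unfolding nx_def .
    show ?thesis
    proof
      assume "nx n = i"
      then show "g (n + i) \<noteq> g n \<and> (\<forall>i'<i. g (n + i') = g n)" using N by simp
    next
      assume i: "g (n + i) \<noteq> g n \<and> (\<forall>i'<i. g (n + i') = g n)"
      show "nx n = i" by (rule ex1E[OF ex1[of n]]) (use N i in metis)
    qed
  qed
  have "Sigma1 S (\<lambda>e. nx (e 0) = e 1)" unfolding nx
    by (rule Sigma1_conj, rule D, intro tm_fun.intros, intro tm_fun.intros, rule Sigma1_ball, rule tm_fun_var, rule D)
      (intro tm_fun.intros)+
  then have gnx: "graph nx \<in> S" by (rule graph_in_S)
  have "Sigma1 S (\<lambda>e. e 0 + nx (e 0) = e 1)"
    by (rule Sigma1_graph[OF gnx tm_fun_var, where P = "\<lambda>e u. e 0 + u = e 1"]) (intro Sigma1_Delta0 Delta0_rules)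
  then have "graph (\<lambda>n. n + nx n) \<in> S" by (rule graph_in_S)
  then obtain h where h: "\<forall>n. h (n + 1) = h n + nx (h n)" "graph h \<in> S"
    using primitive_recursion[of "\<lambda>n. n + nx n" 0] by blast
  have "graph (\<lambda>n. g (h n)) \<in> S" by (rule graph_comp[OF g h(2)])
  moreover have "oless X (g (h (n + 1))) (g (h n))" for n
    using weak[of "h n" "nx (h n)"] nx[of "h n" "nx (h n)"] h(1) by simp
  ultimately show False using well_orderedD[OF wo] by blast
qed

end

text \<open>\<open>None\<close> marks the positions past the end. With \<open>None\<close> as least
  item, the clause for proper extensions and the clause for a differing entry become one comparison
  at the first difference.\<close>

definition item :: "'m::discrete_ordered_semiring \<Rightarrow> 'm \<Rightarrow> 'm option" where
  "item s i = (if \<exists>a. entry s i a then Some (THE a. entry s i a) else None)"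

lemma item_eq_Some: "seq_code s l \<Longrightarrow> item s i = Some a \<longleftrightarrow> entry s i a"
  unfolding item_def using seq_code_unique by (metis (mono_tags, lifting) option.distinct(1) option.inject the_equality)

lemma item_eq_None: "seq_code s l \<Longrightarrow> item s i = None \<longleftrightarrow> l \<le> i"
  unfolding item_def using seq_code_entry seq_code_ex by (metis not_le option.distinct(1))

lemma item_eq_iff:
  assumes "seq_code s k" "seq_code t l"
  shows "item s i = item t i \<longleftrightarrow> (\<forall>c. entry s i c \<longleftrightarrow> entry t i c)"
  unfolding item_eq_Some[OF assms(1), symmetric] item_eq_Some[OF assms(2), symmetric]
  by (metis option.exhaust)

definition entry_lt :: "'m::discrete_ordered_semiring set \<Rightarrow> 'm set \<Rightarrow> 'm \<Rightarrow> 'm \<Rightarrow> bool" where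
  "entry_lt \<alpha> \<beta> c c' \<longleftrightarrow> (\<exists>b a b' a'. c = pair b a \<and> c' = pair b' a' \<and> (oless \<beta> b b' \<or> b = b' \<and> oless \<alpha> a a'))"

definition item_lt :: "'m::discrete_ordered_semiring set \<Rightarrow> 'm set \<Rightarrow> 'm option \<Rightarrow> 'm option \<Rightarrow> bool" where
  "item_lt \<alpha> \<beta> u v \<longleftrightarrow> (\<exists>c'. v = Some c' \<and> (u = None \<or> (\<exists>c. u = Some c \<and> entry_lt \<alpha> \<beta> c c')))"

lemma entry_lt_pair:
  "entry_lt \<alpha> \<beta> (pair b a) (pair b' a') \<longleftrightarrow> oless \<beta> b b' \<or> b = b' \<and> oless \<alpha> a a'"
  by (auto simp: entry_lt_def pair_inject)

lemma oless_irrefl: "\<not> oless X x x"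
  by (simp add: oless_def)

lemma item_lt_irrefl: "\<not> item_lt \<alpha> \<beta> u u"
  by (auto simp: item_lt_def entry_lt_def pair_inject oless_irrefl)

lemma pow_elem_seq: "pow_elem \<alpha> \<beta> s \<Longrightarrow> \<exists>l. seq_code s l"
  by (auto simp: pow_elem_def)

lemma pow_less_iff:
  assumes s: "pow_elem \<alpha> \<beta> s" and t: "pow_elem \<alpha> \<beta> t"
  shows "pow_less \<alpha> \<beta> s t \<longleftrightarrow>
    (\<exists>m. (\<forall>j<m. item s j = item t j) \<and> item_lt \<alpha> \<beta> (item s m) (item t m))"
proof -
  obtain k l where k: "seq_code s k" and l: "seq_code t l" using s t pow_elem_seq by blast
  have [simp]: "seq_code s k' \<longleftrightarrow> k' = k" "seq_code t l' \<longleftrightarrow> l' = l" for k' l'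
    using k l seq_code_length by metis+
  note Some = item_eq_Some[OF k] item_eq_Some[OF l] and None = item_eq_None[OF k] item_eq_None[OF l]
    and eq = item_eq_iff[OF k l]
  show ?thesis
  proof
    assume "pow_less \<alpha> \<beta> s t"
    then consider "k < l" "\<forall>i<k. \<forall>c. entry s i c \<longleftrightarrow> entry t i c"
      | i b a b' a' where "\<forall>j<i. \<forall>c. entry s j c \<longleftrightarrow> entry t j c"
        "entry s i (pair b a)" "entry t i (pair b' a')" "oless \<beta> b b' \<or> b = b' \<and> oless \<alpha> a a'"
      unfolding pow_less_def by auto
    then show "\<exists>m. (\<forall>j<m. item s j = item t j) \<and> item_lt \<alpha> \<beta> (item s m) (item t m)"
    proof cases
      case 1
      have "item s k = None" using None(1) by simp
      moreover obtain c where "item t k = Some c" using None(2)[of k] 1(1) by (cases "item t k") auto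
      ultimately show ?thesis using 1(2) eq unfolding item_lt_def by blast
    next
      case (2 i b a b' a')
      then have "item s i = Some (pair b a)" "item t i = Some (pair b' a')" using Some by blast+
      then have "item_lt \<alpha> \<beta> (item s i) (item t i)" using 2(4) by (simp add: item_lt_def entry_lt_pair)
      then show ?thesis using 2(1) eq by blast
    qed
  next
    assume "\<exists>m. (\<forall>j<m. item s j = item t j) \<and> item_lt \<alpha> \<beta> (item s m) (item t m)"
    then obtain m c' where m: "\<forall>j<m. item s j = item t j" and c': "item t m = Some c'"
      and c: "item s m = None \<or> (\<exists>c. item s m = Some c \<and> entry_lt \<alpha> \<beta> c c')"
      unfolding item_lt_def by blast
    have ml: "m < l" using c' None(2)[of m] by (metis not_le option.distinct(1))
    from c show "pow_less \<alpha> \<beta> s t"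
    proof
      assume "item s m = None"
      then have "k \<le> m" using None(1) by blast
      moreover have "\<not> k < m"
      proof
        assume "k < m"
        then have "item t k = None" using m None(1)[of k] by simp
        then show False using None(2)[of k] \<open>k < m\<close> ml by simp
      qed
      ultimately have "k = m" by simp
      then show ?thesis unfolding pow_less_def using ml m eq by auto
    next
      assume "\<exists>c. item s m = Some c \<and> entry_lt \<alpha> \<beta> c c'"
      then obtain b a b' a' where *: "item s m = Some (pair b a)" "c' = pair b' a'"
        "oless \<beta> b b' \<or> b = b' \<and> oless \<alpha> a a'" unfolding entry_lt_def by blast
      then have "m < k" using None(1)[of m] by (metis not_le option.distinct(1))
      moreover have "(b, a) \<noteq> (b', a')" using *(3) oless_irrefl by auto
      moreover have "entry s m (pair b a)" "entry t m (pair b' a')" using * c' Some by simp_all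
      ultimately have "\<exists>b a b' a'. entry s m (pair b a) \<and> entry t m (pair b' a') \<and> (b, a) \<noteq> (b', a') \<and>
          (oless \<beta> b b' \<or> b = b' \<and> oless \<alpha> a a')" and "m < k" using *(3) by blast+
      moreover have "\<forall>j<m. \<forall>c. entry s j c \<longleftrightarrow> entry t j c" using m eq by blast
      ultimately have "\<exists>i<k. i < l \<and> (\<forall>j<i. \<forall>c. entry s j c \<longleftrightarrow> entry t j c) \<and>
        (\<exists>b a b' a'. entry s i (pair b a) \<and> entry t i (pair b' a') \<and> (b, a) \<noteq> (b', a') \<and>
          (oless \<beta> b b' \<or> b = b' \<and> oless \<alpha> a a'))" using ml by blast
      then show ?thesis unfolding pow_less_def using k l by blast
    qed
  qed
qed

context rca
begin

context
  fixes \<alpha> X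
  assumes \<alpha>: "\<alpha> \<in> S" "Linear_order (rel \<alpha>)" and X: "X \<in> S" "Linear_order (rel X)"
begin

text \<open>Being least involves an unbounded quantifier, but by antisymmetry there is at most one
  least element, which can be used as a parameter.\<close>

lemma least_set_in_S: "{a. least_in \<alpha> a} \<in> S"
proof (cases "\<exists>a. least_in \<alpha> a")
  case True
  then obtain a where a: "least_in \<alpha> a" by blast
  have "least_in \<alpha> x \<longleftrightarrow> x = a" for x
    using a antisymD[OF lo_facts(3)[OF \<alpha>(2)]] unfolding least_in_def by blast
  moreover have "{x. x = a} \<in> S" by (rule Delta0_comprehension) (intro Delta0_rules)
  ultimately show ?thesis by simp
next
  case False
  then show ?thesis using Delta0_comprehension[where P = "\<lambda>_. False", OF Delta0_const] by simp
qed

lemma entry_pair_less: "entry s i (pair b a) \<Longrightarrow> b < s \<and> a < s"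
  using entry_less le_pair1 le_pair2 by (meson le_less_trans)

lemma Delta0_pow_elem: "tm_fun t \<Longrightarrow> Delta0 S (\<lambda>e Z. pow_elem \<alpha> X (t e))"
proof -
  have eq: "pow_elem \<alpha> X s \<longleftrightarrow> (\<exists>l\<le>s. seq_code s l \<and>
    (\<forall>i<l. \<exists>b<s. \<exists>a<s. entry s i (pair b a) \<and> pair b b \<in> X \<and> pair a a \<in> \<alpha> \<and> a \<notin> {a. least_in \<alpha> a}) \<and>
    (\<forall>i<l. \<forall>b<s. \<forall>a<s. \<forall>b'<s. \<forall>a'<s. i + 1 < l \<and> entry s i (pair b a) \<and> entry s (i + 1) (pair b' a')
       \<longrightarrow> oless X b' b))" for s
  proof -
    have 1: "(\<exists>b a. entry s i (pair b a) \<and> P b a) \<longleftrightarrow> (\<exists>b<s. \<exists>a<s. entry s i (pair b a) \<and> P b a)" for i P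
      by (metis entry_pair_less)
    have 2: "(\<forall>i b a b' a'. i + 1 < l \<and> entry s i (pair b a) \<and> entry s (i + 1) (pair b' a') \<longrightarrow> oless X b' b) \<longleftrightarrow>
      (\<forall>i<l. \<forall>b<s. \<forall>a<s. \<forall>b'<s. \<forall>a'<s. i + 1 < l \<and> entry s i (pair b a) \<and> entry s (i + 1) (pair b' a')
       \<longrightarrow> oless X b' b)" if "seq_code s l" for l
    proof
      assume R: "\<forall>i<l. \<forall>b<s. \<forall>a<s. \<forall>b'<s. \<forall>a'<s. i + 1 < l \<and> entry s i (pair b a) \<and>
        entry s (i + 1) (pair b' a') \<longrightarrow> oless X b' b"
      show "\<forall>i b a b' a'. i + 1 < l \<and> entry s i (pair b a) \<and> entry s (i + 1) (pair b' a') \<longrightarrow> oless X b' b"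
      proof (intro allI impI)
        fix i b a b' a' assume h: "i + 1 < l \<and> entry s i (pair b a) \<and> entry s (i + 1) (pair b' a')"
        then show "oless X b' b"
          using R[rule_format, of i b a b' a'] entry_pair_less[of s i b a] entry_pair_less[of s "i + 1" b' a']
            seq_code_entry[OF that] by blast
      qed
    next
      assume L: "\<forall>i b a b' a'. i + 1 < l \<and> entry s i (pair b a) \<and> entry s (i + 1) (pair b' a') \<longrightarrow> oless X b' b"
      show "\<forall>i<l. \<forall>b<s. \<forall>a<s. \<forall>b'<s. \<forall>a'<s. i + 1 < l \<and> entry s i (pair b a) \<and>
        entry s (i + 1) (pair b' a') \<longrightarrow> oless X b' b"
        by (intro allI impI, rule L[rule_format], assumption)
    qed
    show ?thesis unfolding pow_elem_def 1 ofield_iff[OF \<alpha>(2)] ofield_iff[OF X(2)] mem_Collect_eq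
    proof (rule ex_cong1)
      fix l
      show "(seq_code s l \<and>
         (\<forall>i<l. \<exists>b<s. \<exists>a<s. entry s i (pair b a) \<and> pair b b \<in> X \<and> pair a a \<in> \<alpha> \<and> \<not> least_in \<alpha> a) \<and>
         (\<forall>i b a b' a'. i + 1 < l \<and> entry s i (pair b a) \<and> entry s (i + 1) (pair b' a') \<longrightarrow> oless X b' b)) \<longleftrightarrow>
        (l \<le> s \<and> seq_code s l \<and>
         (\<forall>i<l. \<exists>b<s. \<exists>a<s. entry s i (pair b a) \<and> pair b b \<in> X \<and> pair a a \<in> \<alpha> \<and> \<not> least_in \<alpha> a) \<and>
         (\<forall>i<l. \<forall>b<s. \<forall>a<s. \<forall>b'<s. \<forall>a'<s. i + 1 < l \<and> entry s i (pair b a) \<and> entry s (i + 1) (pair b' a') \<longrightarrow>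
           oless X b' b))"
      proof (cases "seq_code s l")
        case True
        show ?thesis by (simp only: 2[OF True] True seq_code_le[OF True] simp_thms)
      next
        case False
        then show ?thesis by (simp only: False simp_thms)
      qed
    qed
  qed
  have "Delta0 S (\<lambda>e Z. pow_elem \<alpha> X (e 0))" unfolding eq
    by (intro Delta0_seq_code Delta0_entry Delta0_oless least_set_in_S \<alpha> X Delta0_rules)
  then show "tm_fun t \<Longrightarrow> Delta0 S (\<lambda>e Z. pow_elem \<alpha> X (t e))" by (rule Delta0_inst1)
qed

lemma entry_agree_bounded:
  "(\<forall>c. entry s i c \<longleftrightarrow> entry t i c) \<longleftrightarrow> (\<forall>c<s + t. entry s i c \<longleftrightarrow> entry t i c)"
proof
  assume *: "\<forall>c<s + t. entry s i c \<longleftrightarrow> entry t i c"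
  show "\<forall>c. entry s i c \<longleftrightarrow> entry t i c"
  proof
    fix c
    show "entry s i c \<longleftrightarrow> entry t i c"
    proof (cases "c < s + t")
      case False
      then have "\<not> c < s" "\<not> c < t" using le_add_same[where a = s and b = t] by (meson less_le_trans)+
      then show ?thesis using entry_less by blast
    qed (use * in blast)
  qed
qed blast

lemma Delta0_pow_less: "tm_fun t \<Longrightarrow> tm_fun u \<Longrightarrow> Delta0 S (\<lambda>e Z. pow_less \<alpha> X (t e) (u e))"
proof -
  have eq: "pow_less \<alpha> X s t \<longleftrightarrow> (\<exists>k\<le>s. \<exists>l\<le>t. seq_code s k \<and> seq_code t l \<and>
    ((k < l \<and> (\<forall>i<k. \<forall>c<s + t. entry s i c \<longleftrightarrow> entry t i c)) \<or>
     (\<exists>i<k. i < l \<and> (\<forall>j<i. \<forall>c<s + t. entry s j c \<longleftrightarrow> entry t j c) \<and>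
       (\<exists>b<s. \<exists>a<s. \<exists>b'<t. \<exists>a'<t. entry s i (pair b a) \<and> entry t i (pair b' a') \<and> \<not> (b = b' \<and> a = a') \<and>
         (oless X b b' \<or> b = b' \<and> oless \<alpha> a a')))))" for s t
  proof -
    note 1 = entry_agree_bounded[of s _ t]
    have 2: "(\<exists>b a b' a'. entry s i (pair b a) \<and> entry t i (pair b' a') \<and> P b a b' a') \<longleftrightarrow>
      (\<exists>b<s. \<exists>a<s. \<exists>b'<t. \<exists>a'<t. entry s i (pair b a) \<and> entry t i (pair b' a') \<and> P b a b' a')" for i P
      using entry_pair_less by blast
    show ?thesis unfolding pow_less_def 1 2 prod.inject using seq_code_le by blast
  qed
  have "Delta0 S (\<lambda>e Z. pow_less \<alpha> X (e 0) (e 1))" unfolding eq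
    by (intro Delta0_seq_code Delta0_entry Delta0_oless \<alpha> X Delta0_rules)
  then show "tm_fun t \<Longrightarrow> tm_fun u \<Longrightarrow> Delta0 S (\<lambda>e Z. pow_less \<alpha> X (t e) (u e))" by (rule Delta0_inst2)
qed

lemma pair_in_opow: "pair s t \<in> opow \<alpha> X \<longleftrightarrow> pow_elem \<alpha> X s \<and> pow_elem \<alpha> X t \<and> (s = t \<or> pow_less \<alpha> X s t)"
  by (auto simp: opow_def pair_inject)

lemma opow_in_S: "opow \<alpha> X \<in> S"
proof -
  have "opow \<alpha> X = {p. \<exists>s\<le>p. \<exists>t\<le>p. p = pair s t \<and> pow_elem \<alpha> X s \<and> pow_elem \<alpha> X t \<and> (s = t \<or> pow_less \<alpha> X s t)}"
    unfolding opow_def using le_pair1 le_pair2 by blast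
  also have "\<dots> \<in> S" by (rule Delta0_comprehension) (intro Delta0_pow_elem Delta0_pow_less Delta0_rules)
  finally show ?thesis .
qed

lemma item_lt_trans: "item_lt \<alpha> X u v \<Longrightarrow> item_lt \<alpha> X v w \<Longrightarrow> item_lt \<alpha> X u w"
proof -
  have "entry_lt \<alpha> X c d \<Longrightarrow> entry_lt \<alpha> X d e \<Longrightarrow> entry_lt \<alpha> X c e" for c d e
    unfolding entry_lt_def using oless_trans[OF X(2)] oless_trans[OF \<alpha>(2)] pair_inject by metis
  then show "item_lt \<alpha> X u v \<Longrightarrow> item_lt \<alpha> X v w \<Longrightarrow> item_lt \<alpha> X u w"
    unfolding item_lt_def by (metis option.distinct(1) option.inject)
qed

lemma pow_less_trans:
  assumes "pow_elem \<alpha> X s" "pow_elem \<alpha> X t" "pow_elem \<alpha> X u" "pow_less \<alpha> X s t" "pow_less \<alpha> X t u"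
  shows "pow_less \<alpha> X s u"
proof -
  obtain m where m: "\<forall>j<m. item s j = item t j" "item_lt \<alpha> X (item s m) (item t m)"
    using assms(4) unfolding pow_less_iff[OF assms(1,2)] by blast
  obtain n where n: "\<forall>j<n. item t j = item u j" "item_lt \<alpha> X (item t n) (item u n)"
    using assms(5) unfolding pow_less_iff[OF assms(2,3)] by blast
  have "\<forall>j<min m n. item s j = item u j" using m(1) n(1) by simp
  moreover have "item_lt \<alpha> X (item s (min m n)) (item u (min m n))"
  proof (cases m n rule: linorder_cases)
    case less then show ?thesis using m(2) n(1) by (simp add: min_def less_imp_le)
  next
    case equal then show ?thesis using m(2) n(2) item_lt_trans by simp
  next
    case greater
    then have "min m n = n" by simp
    then show ?thesis using m(1) n(2) greater by simp
  qed
  ultimately show ?thesis unfolding pow_less_iff[OF assms(1,3)] by blast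
qed

lemma pow_less_irrefl: "pow_elem \<alpha> X s \<Longrightarrow> \<not> pow_less \<alpha> X s s"
  using pow_less_iff item_lt_irrefl by blast

lemma pow_elem_item:
  assumes "pow_elem \<alpha> X s" "item s i = Some c"
  shows "\<exists>b a. c = pair b a \<and> b \<in> ofield X \<and> a \<in> ofield \<alpha>"
proof -
  obtain l where l: "seq_code s l"
    "\<forall>i<l. \<exists>b a. entry s i (pair b a) \<and> b \<in> ofield X \<and> a \<in> ofield \<alpha> \<and> \<not> least_in \<alpha> a"
    using assms(1) unfolding pow_elem_def by blast
  have e: "entry s i c" using assms(2) item_eq_Some[OF l(1)] by blast
  then have "i < l" using seq_code_entry[OF l(1)] by blast
  then show ?thesis using l(2) seq_code_unique[OF l(1) e] by blast
qed

lemma pow_less_linear: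
  assumes s: "pow_elem \<alpha> X s" and t: "pow_elem \<alpha> X t" and "s \<noteq> t"
  shows "pow_less \<alpha> X s t \<or> pow_less \<alpha> X t s"
proof -
  obtain k l where k: "seq_code s k" and l: "seq_code t l" using s t pow_elem_seq by blast
  obtain i0 where i0: "item s i0 \<noteq> item t i0"
  proof (rule ccontr)
    assume "\<not> thesis"
    then have "item s i = item t i" for i using that by metis
    then have "entry s i c \<longleftrightarrow> entry t i c" for i c unfolding item_eq_iff[OF k l] by metis
    then have "s = t" by (rule seq_code_eqI[OF k l])
    with \<open>s \<noteq> t\<close> show False ..
  qed
  have "item s i \<noteq> item t i \<longleftrightarrow> \<not> (\<forall>c<s + t. entry s i c \<longleftrightarrow> entry t i c)" for i
    unfolding item_eq_iff[OF k l] entry_agree_bounded ..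
  moreover have "Delta0 S (\<lambda>e Z. \<not> (\<forall>c<s + t. entry s (e 0) c \<longleftrightarrow> entry t (e 0) c))" by (intro Delta0_entry Delta0_rules)
  ultimately have "Delta0 S (\<lambda>e Z. item s (e 0) \<noteq> item t (e 0))" by simp
  from ex_least_Delta0[where P = "\<lambda>i. item s i \<noteq> item t i", OF this i0]
  obtain m where "item s m \<noteq> item t m \<and> (\<forall>j<m. \<not> item s j \<noteq> item t j)" ..
  then have m: "item s m \<noteq> item t m" "\<And>j. j < m \<Longrightarrow> item s j = item t j" by simp_all
  have "item_lt \<alpha> X (item s m) (item t m) \<or> item_lt \<alpha> X (item t m) (item s m)"
  proof (cases "item s m = None \<or> item t m = None")
    case True
    then show ?thesis using m(1) unfolding item_lt_def by (cases "item s m"; cases "item t m") auto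
  next
    case False
    then obtain c c' where c: "item s m = Some c" "item t m = Some c'" by auto
    obtain b a where ba: "c = pair b a" "b \<in> ofield X" "a \<in> ofield \<alpha>" using pow_elem_item[OF s c(1)] by blast
    obtain b' a' where ba': "c' = pair b' a'" "b' \<in> ofield X" "a' \<in> ofield \<alpha>" using pow_elem_item[OF t c(2)] by blast
    have "b \<noteq> b' \<or> a \<noteq> a'" using m(1) c ba ba' by auto
    then have "entry_lt \<alpha> X c c' \<or> entry_lt \<alpha> X c' c"
      using oless_linear[OF X(2) ba(2) ba'(2)] oless_linear[OF \<alpha>(2) ba(3) ba'(3)]
      unfolding ba(1) ba'(1) entry_lt_pair by blast
    then show ?thesis unfolding item_lt_def c by blast
  qed
  then show ?thesis
  proof
    assume "item_lt \<alpha> X (item s m) (item t m)"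
    then have "pow_less \<alpha> X s t" unfolding pow_less_iff[OF s t] using m(2) by blast
    then show ?thesis ..
  next
    assume "item_lt \<alpha> X (item t m) (item s m)"
    moreover have "\<forall>j<m. item t j = item s j" using m(2) by simp
    ultimately have "pow_less \<alpha> X t s" unfolding pow_less_iff[OF t s] by blast
    then show ?thesis ..
  qed
qed

lemma rel_opow: "(s, t) \<in> rel (opow \<alpha> X) \<longleftrightarrow> pow_elem \<alpha> X s \<and> pow_elem \<alpha> X t \<and> (s = t \<or> pow_less \<alpha> X s t)"
  unfolding rel_iff by (rule pair_in_opow)

lemma Linear_order_opow: "Linear_order (rel (opow \<alpha> X))"
proof -
  have F: "x \<in> Field (rel (opow \<alpha> X)) \<longleftrightarrow> pow_elem \<alpha> X x" for x
    unfolding Field_def using rel_opow by blast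
  show ?thesis unfolding linear_order_on_def partial_order_on_def preorder_on_def
  proof (intro conjI)
    show "rel (opow \<alpha> X) \<subseteq> Field (rel (opow \<alpha> X)) \<times> Field (rel (opow \<alpha> X))"
      by (auto intro: FieldI1 FieldI2)
    show "refl_on (Field (rel (opow \<alpha> X))) (rel (opow \<alpha> X))"
      by (rule refl_onI) (simp add: F rel_opow)
    show "trans (rel (opow \<alpha> X))"
      by (rule transI) (unfold rel_opow, metis pow_less_trans)
    show "antisym (rel (opow \<alpha> X))"
      by (rule antisymI) (unfold rel_opow, metis pow_less_trans pow_less_irrefl)
    show "total_on (Field (rel (opow \<alpha> X))) (rel (opow \<alpha> X))"
    proof (rule total_onI)
      fix x y assume "x \<in> Field (rel (opow \<alpha> X))" "y \<in> Field (rel (opow \<alpha> X))" "x \<noteq> y"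
      then show "(x, y) \<in> rel (opow \<alpha> X) \<or> (y, x) \<in> rel (opow \<alpha> X)"
        using pow_less_linear[of x y] unfolding F rel_opow by blast
    qed
  qed
qed

lemma oless_opow: "oless (opow \<alpha> X) s t \<longleftrightarrow> pow_elem \<alpha> X s \<and> pow_elem \<alpha> X t \<and> pow_less \<alpha> X s t"
  unfolding oless_def rel_opow using pow_less_irrefl by blast

end

end


section \<open>From induction to preservation of well-orders\<close>

context rca
begin

lemma Sigma1_subst:
  assumes "Sigma1 S P" and "\<And>i. tm_fun (\<lambda>e. f e i)" shows "Sigma1 S (\<lambda>e. P (f e))"
proof -
  obtain Q where Q: "Delta0 S (\<lambda>e Z. Q (\<lambda>i. e (Suc i)) (e 0))" and P: "\<And>e. P e \<longleftrightarrow> (\<exists>x. Q e x)"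
    using assms(1) unfolding Sigma1_def by blast
  have "tm_fun (\<lambda>e. case_nat (e 0) (f (\<lambda>i. e (Suc i))) i)" for i
    by (rule tm_fun_push, rule tm_fun_var, rule tm_fun_shift[of f], rule assms)
  note Delta0_subst[where f = "\<lambda>e. case_nat (e 0) (f (\<lambda>i. e (Suc i)))", OF Q this]
  then have "Delta0 S (\<lambda>e Z. (\<lambda>e. Q (f e)) (\<lambda>i. e (Suc i)) (e 0))" by simp
  then show ?thesis unfolding Sigma1_def P by (intro exI[of _ "\<lambda>e. Q (f e)"] conjI allI refl)
qed

lemma Sigma1_inst3:
  assumes "Sigma1 S (\<lambda>e. R (e 0) (e 1) (e 2))" "tm_fun t" "tm_fun u" "tm_fun v"
  shows "Sigma1 S (\<lambda>e. R (t e) (u e) (v e))"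
proof -
  have "tm_fun (\<lambda>e. case_nat (t e) (case_nat (u e) (case_nat (v e) e)) i)" for i
    by (intro tm_fun_push tm_fun_var assms)
  from Sigma1_subst[where f = "\<lambda>e. case_nat (t e) (case_nat (u e) (case_nat (v e) e))", OF assms(1) this]
  show ?thesis by (simp add: numeral_2_eq_2)
qed

text \<open>The first difference lies at or after \<open>p\<close>, and the larger sequence still
  has an entry there. So it has an entry at \<open>p\<close>, and the smaller one can only have an
  equal or smaller entry at this place.\<close>

lemma pow_less_at:
  assumes s: "pow_elem \<alpha> X s" and t: "pow_elem \<alpha> X t" and less: "pow_less \<alpha> X s t"
    and agree: "\<forall>j<p. \<exists>c. entry s j c \<and> entry t j c"
  shows "\<exists>b a. entry t p (pair b a)"
    and "entry t p (pair b a) \<Longrightarrow> entry s p (pair b' a') \<Longrightarrow>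
      b' = b \<and> a' = a \<or> oless X b' b \<or> b' = b \<and> oless \<alpha> a' a"
proof -
  obtain k l where k: "seq_code s k" and l: "seq_code t l" using s t pow_elem_seq by blast
  note Some = item_eq_Some[OF k] item_eq_Some[OF l]
  obtain m where m: "\<forall>j<m. item s j = item t j" "item_lt \<alpha> X (item s m) (item t m)"
    using less unfolding pow_less_iff[OF s t] by blast
  have pm: "p \<le> m"
  proof (rule ccontr)
    assume "\<not> p \<le> m"
    then obtain c where "entry s m c" "entry t m c" using agree by (meson not_le)
    then have "item s m = item t m" using Some by metis
    then show False using m(2) item_lt_irrefl by metis
  qed
  obtain c where c: "item t m = Some c" using m(2) unfolding item_lt_def by blast
  then have "m < l" using item_eq_None[OF l, of m] by (metis not_le option.distinct(1))
  then have "p < l" using pm by simp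
  then show "\<exists>b a. entry t p (pair b a)" using t seq_code_length[OF l] unfolding pow_elem_def by metis
  assume e: "entry t p (pair b a)" "entry s p (pair b' a')"
  show "b' = b \<and> a' = a \<or> oless X b' b \<or> b' = b \<and> oless \<alpha> a' a"
  proof (cases "p = m")
    case True
    have "item s m = Some (pair b' a')" "item t m = Some (pair b a)" using e Some True by simp_all
    then have "entry_lt \<alpha> X (pair b' a') (pair b a)" using m(2) unfolding item_lt_def by auto
    then show ?thesis unfolding entry_lt_pair by blast
  next
    case False
    then have "item s p = item t p" using m(1) pm by simp
    then have "pair b' a' = pair b a" using e Some by (metis option.inject)
    then show ?thesis by (simp add: pair_inject)
  qed
qed

text \<open>From \<open>N\<close> on, every member has an entry at \<open>p\<close>, because its
  successor is smaller and agrees before \<open>p\<close>. The exponents at \<open>p\<close> descend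
  weakly in \<open>X\<close>; once they are constant, the coefficients descend weakly in
  \<open>\<alpha>\<close>. The shift \<open>d\<close> adds the two stabilization points.\<close>

lemma stable_extension:
  assumes \<alpha>: "well_ordered S \<alpha>" and X: "well_ordered S X" and f: "graph f \<in> S"
    and elem: "\<And>i. pow_elem \<alpha> X (f i)" and desc: "\<And>i. pow_less \<alpha> X (f (i + 1)) (f i)"
    and stable: "\<forall>i. \<forall>j<p. \<exists>c. entry (f N) j c \<and> entry (f (N + i)) j c"
  shows "\<exists>d b a. entry (f (N + d)) p (pair b a) \<and>
    (\<forall>i. \<forall>j<p + 1. \<exists>c. entry (f (N + d)) j c \<and> entry (f (N + d + i)) j c)"
proof -
  have unique: "c = c'" if "entry (f i) j c" "entry (f i) j c'" for i j c c'
    using pow_elem_seq[OF elem[of i]] seq_code_unique that by blast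
  have agree: "\<forall>j<p. \<exists>c. entry (f (N + i')) j c \<and> entry (f (N + i)) j c" for i i'
    using stable unique by metis
  have "\<exists>b a. entry (f (N + i)) p (pair b a)" for i
    using pow_less_at(1)[OF elem[of "N + i + 1"] elem[of "N + i"] desc, of p] agree[of "i + 1" i] by (simp add: add.assoc)
  then obtain bf af where ba: "\<And>i. entry (f (N + i)) p (pair (bf i) (af i))" by metis
  have ba_iff: "entry (f (N + i)) p (pair b a) \<longleftrightarrow> b = bf i \<and> a = af i" for i a b
    using unique[OF ba] ba by (metis pair_inject)
  have step: "bf (i + 1) = bf i \<and> af (i + 1) = af i \<or> oless X (bf (i + 1)) (bf i) \<or>
      bf (i + 1) = bf i \<and> oless \<alpha> (af (i + 1)) (af i)" for i
    using pow_less_at(2)[OF elem[of "N + i + 1"] elem[of "N + i"] desc, of p] agree[of "i + 1" i] ba[of i] ba[of "i + 1"]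
    by (simp add: add.assoc)
  have Sigma1_e: "Sigma1 S (\<lambda>e. entry (f (N + e 0)) p (pair (e 1) (e 2)))"
    by (rule Sigma1_graph[OF f, where P = "\<lambda>e u. entry u p (pair (e 1) (e 2))"], intro Delta0_rules)
      (intro Sigma1_Delta0 Delta0_entry Delta0_rules)
  note Sigma1_e = Sigma1_inst3[where R = "\<lambda>i b a. entry (f (N + i)) p (pair b a)", OF this]
  have "bf i = b \<longleftrightarrow> (\<exists>a. entry (f (N + i)) p (pair b a))" for i b
    unfolding ba_iff by auto
  then have "graph bf \<in> S"
    by (intro graph_in_S) (simp, intro Sigma1_ex Sigma1_e tm_fun_var)
  from weakly_descending_stabilizes[OF X this] obtain n1 where n1: "bf (n1 + i) = bf n1" for i
    using step by blast
  have "af i = a \<longleftrightarrow> (\<exists>b. entry (f (N + i)) p (pair b a))" for i a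
    unfolding ba_iff by auto
  then have "graph af \<in> S"
    by (intro graph_in_S) (simp, intro Sigma1_ex Sigma1_e tm_fun_var)
  then have "graph (\<lambda>i. af (n1 + i)) \<in> S" by (rule graph_shift)
  moreover have "af (n1 + (i + 1)) = af (n1 + i) \<or> oless \<alpha> (af (n1 + (i + 1))) (af (n1 + i))" for i
    using step[of "n1 + i"] n1[of i] n1[of "i + 1"] oless_irrefl by (metis add.assoc)
  ultimately obtain n2 where n2: "af (n1 + (n2 + i)) = af (n1 + n2)" for i
    using weakly_descending_stabilizes[OF \<alpha>, of "\<lambda>i. af (n1 + i)"] by blast
  let ?d = "n1 + n2"
  have "\<exists>c. entry (f (N + ?d)) j c \<and> entry (f (N + ?d + i)) j c" if "j < p + 1" for i j
  proof (cases "j = p")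
    case True
    have "bf (?d + i) = bf ?d" using n1[of "n2 + i"] n1[of n2] by (simp add: add.assoc)
    moreover have "af (?d + i) = af ?d" using n2[of i] by (simp add: add.assoc)
    ultimately show ?thesis using ba[of "?d + i"] ba[of ?d] True by (metis add.assoc)
  next
    case False
    with that have "j < p" by (simp add: less_add_one_iff)
    then show ?thesis using agree[of ?d "?d + i"] by (metis add.assoc)
  qed
  then show ?thesis using ba[of ?d] by blast
qed

lemma pow_elem_descends:
  "pow_elem \<alpha> X s \<Longrightarrow> entry s i (pair b a) \<Longrightarrow> entry s (i + 1) (pair b' a') \<Longrightarrow> oless X b' b"
  unfolding pow_elem_def using seq_code_entry by blast

lemma pow_elem_ofield:
  assumes "pow_elem \<alpha> X s" "entry s i (pair b a)" shows "b \<in> ofield X"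
proof -
  obtain l where l: "seq_code s l"
    "\<forall>i<l. \<exists>b a. entry s i (pair b a) \<and> b \<in> ofield X \<and> a \<in> ofield \<alpha> \<and> \<not> least_in \<alpha> a"
    using assms(1) unfolding pow_elem_def by blast
  have "i < l" using seq_code_entry[OF l(1) assms(2)] .
  then obtain b' a' where "entry s i (pair b' a')" "b' \<in> ofield X" using l(2) by blast
  then have "pair b a = pair b' a'" using seq_code_unique[OF l(1) assms(2)] by blast
  with \<open>b' \<in> ofield X\<close> show ?thesis by (simp add: pair_inject)
qed

theorem induction_imp_preserves_wo:
  assumes TI: "Pi02_transfinite_induction S X" and X: "well_ordered S X" and \<alpha>: "well_ordered S \<alpha>"
  shows "well_ordered S (opow \<alpha> X)"
proof -
  have lo: "\<alpha> \<in> S" "Linear_order (rel \<alpha>)" "X \<in> S" "Linear_order (rel X)"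
    using X \<alpha> by (simp_all add: well_ordered_def)
  have False if F: "F \<in> S" "fun_code F"
    and F_desc: "\<forall>i y z. pair i y \<in> F \<and> pair (i + 1) z \<in> F \<longrightarrow> oless (opow \<alpha> X) z y" for F
  proof -
    obtain f where Ff: "F = graph f" using fun_code_imp_graph[OF F(2)] by blast
    then have f: "graph f \<in> S" using F(1) by simp
    have "oless (opow \<alpha> X) (f (i + 1)) (f i)" for i
      using F_desc unfolding Ff pair_in_graph by blast
    then have elem: "pow_elem \<alpha> X (f i)" and desc: "pow_less \<alpha> X (f (i + 1)) (f i)" for i
      unfolding oless_opow[OF lo] by blast+
    note ext = stable_extension[OF \<alpha> X f elem desc]
    \<comment> \<open>Entries are smaller than their code, so the bound \<open>f x\<close> suffices
      and disagreement becomes a bounded property of two members of the sequence.\<close>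
    define dis where "dis x y j \<longleftrightarrow> (\<forall>c<f x. \<not> (entry (f x) j c \<and> entry (f y) j c))" for x y j
    have dis: "dis x y j \<longleftrightarrow> \<not> (\<exists>c. entry (f x) j c \<and> entry (f y) j c)" for x y j
      unfolding dis_def using entry_less by blast
    have "Sigma1 S (\<lambda>e. \<forall>c<f (e 0). \<not> (entry (f (e 0)) (e 2) c \<and> entry (f (e 1)) (e 2) c))"
      by (rule Sigma1_graph[OF f tm_fun_var, where P = "\<lambda>e u. \<forall>c<u. \<not> (entry u (e 2) c \<and> entry (f (e 1)) (e 2) c)"],
          rule Sigma1_graph[OF f tm_fun_var, where P = "\<lambda>e v. \<forall>c<e 0. \<not> (entry (e 0) (e (Suc 2)) c \<and> entry v (e (Suc 2)) c)"])
        (intro Sigma1_Delta0 Delta0_entry Delta0_rules)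
    then have "Sigma1 S (\<lambda>e. dis (e 0) (e 1) (e 2))" unfolding dis_def .
    note Sigma1_dis = Sigma1_inst3[where R = dis, OF this]
    have "Sigma1 S (\<lambda>e. \<not> entry (f (e 0)) (e 1) (e 2))"
      by (rule Sigma1_graph[OF f tm_fun_var, where P = "\<lambda>e u. \<not> entry u (e 1) (e 2)"]) (intro Sigma1_Delta0 Delta0_entry Delta0_rules)
    note Sigma1_ne = Sigma1_inst3[where R = "\<lambda>i j c. \<not> entry (f i) j c", OF this]
    define stab where "stab p N \<longleftrightarrow> (\<forall>i. \<forall>j<p. \<exists>c. entry (f N) j c \<and> entry (f (N + i)) j c)" for p N
    \<comment> \<open>The number \<open>n\<close> codes a position \<open>p\<close>, a starting
      point \<open>N\<close> and a coefficient. Over all \<open>n\<close>, this says that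
      \<open>x\<close> never occurs as a stable exponent.\<close>
    define A :: "'m \<Rightarrow> 'm \<Rightarrow> bool" where "A x n \<longleftrightarrow> (\<forall>p<n + 1. \<forall>N<n + 1. \<forall>a<n + 1. n = pair (pair p N) a \<longrightarrow>
      \<not> entry (f N) p (pair x a) \<or> (\<exists>i. \<exists>j<p + 1. dis N (N + i) j))" for x n
    have A: "(\<forall>n. A x n) \<longleftrightarrow> (\<forall>p N a. entry (f N) p (pair x a) \<longrightarrow> \<not> stab (p + 1) N)" for x
    proof
      assume *: "\<forall>n. A x n"
      show "\<forall>p N a. entry (f N) p (pair x a) \<longrightarrow> \<not> stab (p + 1) N"
      proof (intro allI impI)
        fix p N a :: 'm assume "entry (f N) p (pair x a)"
        then have "\<exists>i. \<exists>j<p + 1. dis N (N + i) j"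
          using *[rule_format, of "pair (pair p N) a"] triple_bounds[where k = p and m = N and n = a]
          unfolding A_def less_add_one_iff by blast
        then show "\<not> stab (p + 1) N" unfolding stab_def dis by blast
      qed
    next
      assume *: "\<forall>p N a. entry (f N) p (pair x a) \<longrightarrow> \<not> stab (p + 1) N"
      show "\<forall>n. A x n" unfolding A_def
      proof (intro allI impI)
        fix n p N a :: 'm assume "n = pair (pair p N) a"
        show "\<not> entry (f N) p (pair x a) \<or> (\<exists>i. \<exists>j<p + 1. dis N (N + i) j)"
          using *[rule_format, of N p a] unfolding stab_def dis by blast
      qed
    qed
    have Sigma1_A: "Sigma1 S (\<lambda>e. A (e 0) (e 1))" unfolding A_def
      apply (rule Sigma1_ball, (intro Delta0_rules)+)
      apply (rule Sigma1_ball, (intro Delta0_rules)+)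
      apply (rule Sigma1_ball, (intro Delta0_rules)+)
      apply (rule Sigma1_imp, (intro Delta0_rules)+)
      apply (rule Sigma1_disj)
      apply (rule Sigma1_ne, (intro Delta0_rules)+)
      apply (rule Sigma1_ex)
      apply (rule Sigma1_bex, (intro Delta0_rules)+)
      apply (rule Sigma1_dis, (intro Delta0_rules)+)
      done
    have all: "\<forall>n. A x n" if x: "x \<in> ofield X" for x
    proof (rule Pi02_induct[where A = A, OF TI Sigma1_A _ x])
      fix x assume "x \<in> ofield X" and IH: "\<And>y. oless X y x \<Longrightarrow> \<forall>n. A y n"
      show "\<forall>n. A x n" unfolding A
      proof (intro allI impI notI)
        fix p N a :: 'm assume e: "entry (f N) p (pair x a)" and st: "stab (p + 1) N"
        \<comment> \<open>The entry at the next position stabilizes too, and its exponent is smaller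
          than \<open>x\<close>: a counterexample below \<open>x\<close>.\<close>
        obtain d b' a' where d: "entry (f (N + d)) (p + 1) (pair b' a')" and st': "stab (p + 1 + 1) (N + d)"
          using ext[OF st[unfolded stab_def]] unfolding stab_def by blast
        obtain c where c: "entry (f N) p c" "entry (f (N + d)) p c"
          using st less_add_one[of p] unfolding stab_def by blast
        have "c = pair x a" using c(1) e pow_elem_seq[OF elem[of N]] seq_code_unique by blast
        then have "oless X b' x" using pow_elem_descends[OF elem _ d] c(2) by blast
        then show False using IH[of b'] d st' unfolding A by blast
      qed
    qed
    have "stab 0 0" unfolding stab_def by (simp add: not_less_zero)
    then obtain d b a where d: "entry (f (0 + d)) 0 (pair b a)" "stab (0 + 1) (0 + d)"
      using ext[of 0 0] unfolding stab_def by blast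
    then have "b \<in> ofield X" using pow_elem_ofield[OF elem] by blast
    from all[OF this] show False using d unfolding A by blast
  qed
  then show ?thesis unfolding well_ordered_def
    using opow_in_S[OF lo] Linear_order_opow[OF lo] by blast
qed

end


section \<open>From preservation of well-orders to induction\<close>

lemma (in rca) ex_least_not_Sigma1:
  assumes "Sigma1 S (\<lambda>e. \<not> P (e 0))" "P a" shows "\<exists>m. P m \<and> (\<forall>n<m. \<not> P n)"
proof -
  from least_not_Sigma1[OF assms] obtain m where "P m" "\<And>n. n < m \<Longrightarrow> \<not> P n" by blast
  then show ?thesis by blast
qed

lemma (in rca) ex_least_Sigma1:
  assumes "Sigma1 S (\<lambda>e. P (e 0))" "P a" shows "\<exists>m. P m \<and> (\<forall>n<m. \<not> P n)"
proof -
  from least_Sigma1[OF assms] obtain m where "P m" "\<And>n. n < m \<Longrightarrow> \<not> P n" by blast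
  then show ?thesis by blast
qed

lemma not_one_eq_zero: "a + 1 \<noteq> 0" for a :: "'m::discrete_ordered_semiring"
  using less_add_one_iff[of 0 a] zero_least[of a] by auto

text \<open>A failure of transfinite induction for \<open>\<forall>m. \<exists>k. T x m k\<close>.  A pair \<open>\<langle>x, m\<rangle>\<close> is refuted once a
  witness \<open>k\<close> with \<open>T x m k\<close> is found; unrefuted pairs are the candidates for places where the
  induction formula fails.\<close>

locale failure = rca S for S :: "'m::discrete_ordered_semiring set set" +
  fixes X :: "'m set" and T :: "'m \<Rightarrow> 'm \<Rightarrow> 'm \<Rightarrow> bool" and x0 m0 :: 'm
  assumes wo: "well_ordered S X" and Delta0_T: "Delta0 S (\<lambda>e Z. T (e 0) (e 1) (e 2))"
    and prog: "x \<in> ofield X \<Longrightarrow> (\<And>y. oless X y x \<Longrightarrow> \<forall>m. \<exists>k. T y m k) \<Longrightarrow> \<forall>m. \<exists>k. T x m k"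
    and x0: "x0 \<in> ofield X" and never: "\<not> T x0 m0 k"
begin

lemma X: "X \<in> S" and lo: "Linear_order (rel X)"
  using wo by (simp_all add: well_ordered_def)

definition refuted :: "'m \<Rightarrow> 'm \<Rightarrow> bool" where
  "refuted p s \<longleftrightarrow> (\<exists>k<s. \<exists>x\<le>p. \<exists>m\<le>p. p = pair x m \<and> T x m k)"

definition valid :: "'m \<Rightarrow> 'm \<Rightarrow> bool" where
  "valid x c \<longleftrightarrow> (\<exists>y\<le>c. \<exists>m\<le>c. c = pair y m \<and> oless X y x)"

definition cand :: "'m \<Rightarrow> 'm \<Rightarrow> 'm \<Rightarrow> bool" where
  "cand x s c \<longleftrightarrow> valid x c \<and> \<not> refuted c s"

text \<open>The least candidate below \<open>x\<close> exists at stage \<open>t\<close> and is still unrefuted at stage \<open>s\<close>.\<close>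

definition stab :: "'m \<Rightarrow> 'm \<Rightarrow> 'm \<Rightarrow> bool" where
  "stab x t s \<longleftrightarrow> (\<exists>c<t. cand x s c \<and> (\<forall>c'<c. \<not> cand x t c'))"

lemma refuted_pair: "refuted (pair x m) s \<longleftrightarrow> (\<exists>k<s. T x m k)"
  unfolding refuted_def by (auto simp: pair_inject le_pair1 le_pair2)

lemma valid_pair: "valid x (pair y m) \<longleftrightarrow> oless X y x"
  unfolding valid_def by (auto simp: pair_inject le_pair1 le_pair2)

lemma validE: "valid x c \<Longrightarrow> \<exists>y m. c = pair y m \<and> oless X y x"
  unfolding valid_def by blast

lemma Delta0_refuted: "tm_fun t \<Longrightarrow> tm_fun u \<Longrightarrow> Delta0 S (\<lambda>e Z. refuted (t e) (u e))"
proof -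
  have "Delta0 S (\<lambda>e Z. refuted (e 0) (e 1))" unfolding refuted_def
    by (intro Delta0_inst3[OF Delta0_T] Delta0_rules)
  then show "tm_fun t \<Longrightarrow> tm_fun u \<Longrightarrow> Delta0 S (\<lambda>e Z. refuted (t e) (u e))" by (rule Delta0_inst2)
qed

lemma Delta0_valid: "tm_fun t \<Longrightarrow> tm_fun u \<Longrightarrow> Delta0 S (\<lambda>e Z. valid (t e) (u e))"
proof -
  have "Delta0 S (\<lambda>e Z. valid (e 0) (e 1))" unfolding valid_def by (intro Delta0_oless X Delta0_rules)
  then show "tm_fun t \<Longrightarrow> tm_fun u \<Longrightarrow> Delta0 S (\<lambda>e Z. valid (t e) (u e))" by (rule Delta0_inst2)
qed

lemma Delta0_cand: "tm_fun t \<Longrightarrow> tm_fun u \<Longrightarrow> tm_fun v \<Longrightarrow> Delta0 S (\<lambda>e Z. cand (t e) (u e) (v e))"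
  unfolding cand_def by (intro Delta0_conj Delta0_not Delta0_valid Delta0_refuted)

lemma Delta0_stab: "tm_fun t \<Longrightarrow> tm_fun u \<Longrightarrow> tm_fun v \<Longrightarrow> Delta0 S (\<lambda>e Z. stab (t e) (u e) (v e))"
proof -
  have "Delta0 S (\<lambda>e Z. stab (e 0) (e 1) (e 2))" unfolding stab_def by (intro Delta0_cand Delta0_rules)
  then show "tm_fun t \<Longrightarrow> tm_fun u \<Longrightarrow> tm_fun v \<Longrightarrow> Delta0 S (\<lambda>e Z. stab (t e) (u e) (v e))" by (rule Delta0_inst3)
qed

lemma refuted_mono: "refuted p s \<Longrightarrow> s \<le> s' \<Longrightarrow> refuted p s'"
  unfolding refuted_def using less_le_trans by blast

lemma cand_antimono: "cand x s c \<Longrightarrow> s' \<le> s \<Longrightarrow> cand x s' c"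
  unfolding cand_def using refuted_mono by blast

lemma stab_antimono: "stab x t s \<Longrightarrow> s' \<le> s \<Longrightarrow> stab x t s'"
  unfolding stab_def using cand_antimono by blast

text \<open>Candidates only disappear. The least candidate at \<open>t'\<close> survives until
  \<open>t\<close>, and the one at \<open>t\<close> was already a candidate at \<open>t'\<close>, so
  the two coincide.\<close>

lemma stab_trans:
  assumes "stab x t' t" "stab x t s" "t' \<le> t" "t \<le> s" shows "stab x t' s"
proof -
  obtain c' where c': "c' < t'" "cand x t c'" "\<forall>c<c'. \<not> cand x t' c" using assms(1) unfolding stab_def by blast
  obtain c where c: "c < t" "cand x s c" "\<forall>c'<c. \<not> cand x t c'" using assms(2) unfolding stab_def by blast
  have "\<not> c' < c" using c'(2) c(3) by blast
  moreover have "cand x t' c" using cand_antimono[OF c(2)] assms(3,4) by simp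
  then have "\<not> c < c'" using c'(3) by blast
  ultimately have "c = c'" by simp
  then show ?thesis using c'(1,3) c(2) unfolding stab_def by blast
qed

text \<open>The order \<open>\<alpha>\<close> consists of a least element \<open>\<langle>0, 0\<rangle>\<close> and of elements \<open>\<langle>p + 1, t\<rangle>\<close> recording that
  at stage \<open>t\<close>, with \<open>p = \<langle>x, m\<rangle>\<close> still unrefuted, the least candidate below \<open>x\<close> changed.  It is an
  \<open>\<omega>\<close>-sum over \<open>p\<close> of reversed sets of stages, each of which is finite since \<open>T\<close> is progressive.\<close>

definition fld :: "'m \<Rightarrow> bool" where
  "fld a \<longleftrightarrow> a = pair 0 0 \<or> (\<exists>x\<le>a. \<exists>m\<le>a. \<exists>t\<le>a. a = pair (pair x m + 1) t \<and> pair x x \<in> X \<and>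
    \<not> refuted (pair x m) t \<and> (\<forall>t'<t. \<not> stab x t' t))"

definition fle :: "'m \<Rightarrow> 'm \<Rightarrow> bool" where
  "fle a b \<longleftrightarrow> (\<exists>q\<le>a. \<exists>t\<le>a. \<exists>q'\<le>b. \<exists>t'\<le>b. a = pair q t \<and> b = pair q' t' \<and> (q < q' \<or> q = q' \<and> t' \<le> t))"

definition \<alpha> :: "'m set" where
  "\<alpha> = {p. \<exists>a\<le>p. \<exists>b\<le>p. p = pair a b \<and> fld a \<and> fld b \<and> fle a b}"

lemma Delta0_fld: "tm_fun t \<Longrightarrow> Delta0 S (\<lambda>e Z. fld (t e))"
proof -
  have "Delta0 S (\<lambda>e Z. fld (e 0))" unfolding fld_def
    by (intro Delta0_refuted Delta0_stab X Delta0_rules)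
  then show "tm_fun t \<Longrightarrow> Delta0 S (\<lambda>e Z. fld (t e))" by (rule Delta0_inst1)
qed

lemma Delta0_fle: "tm_fun t \<Longrightarrow> tm_fun u \<Longrightarrow> Delta0 S (\<lambda>e Z. fle (t e) (u e))"
proof -
  have "Delta0 S (\<lambda>e Z. fle (e 0) (e 1))" unfolding fle_def by (intro Delta0_rules)
  then show "tm_fun t \<Longrightarrow> tm_fun u \<Longrightarrow> Delta0 S (\<lambda>e Z. fle (t e) (u e))" by (rule Delta0_inst2)
qed

lemma \<alpha>_in_S: "\<alpha> \<in> S"
  unfolding \<alpha>_def by (rule Delta0_comprehension) (intro Delta0_fld Delta0_fle Delta0_rules)

lemma fle_pair: "fle (pair q t) (pair q' t') \<longleftrightarrow> q < q' \<or> q = q' \<and> t' \<le> t"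
proof
  assume "fle (pair q t) (pair q' t')"
  then show "q < q' \<or> q = q' \<and> t' \<le> t" unfolding fle_def pair_inject by blast
next
  assume "q < q' \<or> q = q' \<and> t' \<le> t"
  then show "fle (pair q t) (pair q' t')"
    unfolding fle_def using le_pair1[of q t] le_pair2[of t q] le_pair1[of q' t'] le_pair2[of t' q'] by blast
qed

lemma fld_pair: "fld (pair q t) \<longleftrightarrow> q = 0 \<and> t = 0 \<or>
  (\<exists>x m. q = pair x m + 1 \<and> x \<in> ofield X \<and> \<not> refuted (pair x m) t \<and> (\<forall>t'<t. \<not> stab x t' t))"
proof -
  have "x \<le> pair (pair x m + 1) t" "m \<le> pair (pair x m + 1) t" for x m
    using le_pair1[of x m] le_pair2[of m x] le_pair1[of "pair x m + 1" t] le_add_same(1)[of "pair x m" 1]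
      order_trans by metis+
  then show ?thesis unfolding fld_def ofield_iff[OF lo] pair_inject using le_pair2[of t q] by blast
qed

lemma fldE: "fld a \<Longrightarrow> \<exists>q t. a = pair q t"
  unfolding fld_def by blast

lemma rel_\<alpha>: "(a, b) \<in> rel \<alpha> \<longleftrightarrow> fld a \<and> fld b \<and> fle a b"
  unfolding rel_iff \<alpha>_def mem_Collect_eq pair_inject using le_pair1[of a b] le_pair2[of b a] by blast

lemma Linear_order_\<alpha>: "Linear_order (rel \<alpha>)"
proof -
  have refl: "fle a a" if "fld a" for a using fldE[OF that] fle_pair by auto
  have F: "a \<in> Field (rel \<alpha>) \<longleftrightarrow> fld a" for a
    unfolding Field_def using rel_\<alpha> refl by blast
  show ?thesis unfolding linear_order_on_def partial_order_on_def preorder_on_def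
  proof (intro conjI)
    show "rel \<alpha> \<subseteq> Field (rel \<alpha>) \<times> Field (rel \<alpha>)" by (auto intro: FieldI1 FieldI2)
    show "refl_on (Field (rel \<alpha>)) (rel \<alpha>)" by (rule refl_onI) (simp add: F rel_\<alpha> refl)
    show "trans (rel \<alpha>)"
    proof (rule transI)
      fix a b c assume ab: "(a, b) \<in> rel \<alpha>" and bc: "(b, c) \<in> rel \<alpha>"
      then obtain q t q' t' q'' t'' where "a = pair q t" "b = pair q' t'" "c = pair q'' t''"
        unfolding rel_\<alpha> using fldE by meson
      then show "(a, c) \<in> rel \<alpha>" using ab bc unfolding rel_\<alpha> by (auto simp: fle_pair)
    qed
    show "antisym (rel \<alpha>)"
    proof (rule antisymI)
      fix a b assume ab: "(a, b) \<in> rel \<alpha>" and ba: "(b, a) \<in> rel \<alpha>"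
      then obtain q t q' t' where "a = pair q t" "b = pair q' t'" unfolding rel_\<alpha> using fldE by meson
      then show "a = b" using ab ba unfolding rel_\<alpha> by (auto simp: fle_pair)
    qed
    show "total_on (Field (rel \<alpha>)) (rel \<alpha>)"
    proof (rule total_onI)
      fix a b assume *: "a \<in> Field (rel \<alpha>)" "b \<in> Field (rel \<alpha>)"
      then obtain q t q' t' where "a = pair q t" "b = pair q' t'" unfolding F using fldE by meson
      then show "(a, b) \<in> rel \<alpha> \<or> (b, a) \<in> rel \<alpha>" using * unfolding F rel_\<alpha> by (auto simp: fle_pair)
    qed
  qed
qed

lemma oless_\<alpha>: "oless \<alpha> (pair q t) (pair q' t') \<longleftrightarrow>
  fld (pair q t) \<and> fld (pair q' t') \<and> (q < q' \<or> q = q' \<and> t' < t)"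
  unfolding oless_def rel_\<alpha> fle_pair pair_inject by auto

text \<open>Unboundedly many stages attached to one pair mean that it is never refuted.
  Progressivity then gives a permanent candidate below it. Once all smaller candidates have been
  refuted, the least candidate is settled and no further change is recorded.\<close>

lemma fld_eventually:
  assumes "\<And>i. \<exists>t\<ge>i. fld (pair q t)" shows False
proof -
  \<comment> \<open>A positive stage excludes \<open>q = 0\<close>, whose only element is the least
    one.\<close>
  obtain t where "1 \<le> t" "fld (pair q t)" using assms by blast
  have "q \<noteq> 0"
  proof
    assume "q = 0"
    then have "t = 0" using \<open>fld (pair q t)\<close> not_one_eq_zero unfolding fld_pair by metis
    with \<open>1 \<le> t\<close> show False by simp
  qed
  then obtain p where q: "q = p + 1" using zero_or_succ by blast
  obtain x m where p: "p = pair x m" and x: "x \<in> ofield X"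
    using \<open>fld (pair q t)\<close> unfolding fld_pair q using not_one_eq_zero by auto
  have inf: "\<exists>t\<ge>i. \<not> refuted p t \<and> (\<forall>t'<t. \<not> stab x t' t)" for i
  proof -
    obtain t where "i \<le> t" "fld (pair q t)" using assms by blast
    then show ?thesis unfolding fld_pair q p using not_one_eq_zero by (auto simp: pair_inject)
  qed
  have "\<not> T x m k" for k
  proof
    assume "T x m k"
    then have "refuted p (k + 1)" unfolding p refuted_pair using less_add_one by blast
    then show False using inf[of "k + 1"] refuted_mono by blast
  qed
  then have "\<not> (\<forall>m. \<exists>k. T x m k)" by blast
  then obtain y m' where y: "oless X y x" "\<And>k. \<not> T y m' k" using prog[OF x] by blast
  have "valid x (pair y m') \<and> (\<forall>s. \<not> refuted (pair y m') s)"
    unfolding valid_pair refuted_pair using y by blast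
  moreover have "Sigma1 S (\<lambda>e. \<not> (valid x (e 0) \<and> (\<forall>s. \<not> refuted (e 0) s)))"
  proof -
    have "Sigma1 S (\<lambda>e. \<not> valid x (e 0) \<or> (\<exists>s. refuted (e 0) s))"
      by (intro Sigma1_disj Sigma1_ex Sigma1_Delta0[OF Delta0_not[OF Delta0_valid]] Sigma1_Delta0[OF Delta0_refuted] tm_fun_var tm_fun_const)
    then show ?thesis by simp
  qed
  ultimately obtain c where c: "valid x c" "\<And>s. \<not> refuted c s"
    and least: "\<And>c'. c' < c \<Longrightarrow> \<not> (valid x c' \<and> (\<forall>s. \<not> refuted c' s))"
    using ex_least_not_Sigma1[where P = "\<lambda>c. valid x c \<and> (\<forall>s. \<not> refuted c s)"] by blast
  have "Delta0 S (\<lambda>e Z. \<not> valid x (e 0) \<or> refuted (e 0) (e 1))"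
    by (intro Delta0_disj Delta0_not Delta0_valid Delta0_refuted tm_fun_var tm_fun_const)
  \<comment> \<open>The least permanent candidate is \<open>c\<close>, so each smaller number is
    invalid or gets refuted; collection bounds the stages needed.\<close>
  from collection[where R = "\<lambda>c s. \<not> valid x c \<or> refuted c s" and k = c, OF this]
  obtain b where b: "\<forall>c'<c. \<exists>s<b. \<not> valid x c' \<or> refuted c' s" using least by blast
  \<comment> \<open>Past \<open>b\<close> all smaller candidates are gone, and \<open>stab\<close>
    also asks that \<open>c\<close> be below the stage.\<close>
  define t0 where "t0 = b + c + 1"
  have bc: "b \<le> b + c" "c \<le> b + c" by (rule le_add_same)+
  have t0: "b \<le> t0" "c < t0"
    unfolding t0_def less_add_one_iff using order_trans[OF bc(1) le_add_same(1)] bc(2) by blast+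
  have "\<not> cand x t0 c'" if c': "c' < c" for c'
  proof -
    obtain s where "s < b" "\<not> valid x c' \<or> refuted c' s" using b c' by blast
    then show ?thesis unfolding cand_def using refuted_mono[of c' s t0] t0(1) by (auto intro: less_imp_le)
  qed
  then have stab: "stab x t0 s" for s unfolding stab_def cand_def using c t0(2) by blast
  obtain t where "t0 + 1 \<le> t" "\<forall>t'<t. \<not> stab x t' t" using inf by blast
  then have "t0 < t" by (simp add: add_one_le_iff)
  then show False using stab \<open>\<forall>t'<t. \<not> stab x t' t\<close> by blast
qed

text \<open>Once the least occurring first component is reached it stays fixed. From then on the
  stages strictly increase and are unbounded.\<close>

lemma well_ordered_\<alpha>: "well_ordered S \<alpha>"
proof -
  have False if F: "F \<in> S" "fun_code F"
    and F_desc: "\<forall>i y z. pair i y \<in> F \<and> pair (i + 1) z \<in> F \<longrightarrow> oless \<alpha> z y" for F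
  proof -
    obtain g where Fg: "F = graph g" using fun_code_imp_graph[OF F(2)] by blast
    then have g: "graph g \<in> S" using F(1) by simp
    have desc: "oless \<alpha> (g (i + 1)) (g i)" for i using F_desc unfolding Fg pair_in_graph by blast
    then have fld: "fld (g i)" for i unfolding oless_def rel_\<alpha> by blast
    have "Sigma1 S (\<lambda>e. g (e 0) = pair (e 1) (e 2))"
      by (rule Sigma1_graph[OF g tm_fun_var, where P = "\<lambda>e u. u = pair (e 1) (e 2)"]) (intro Sigma1_Delta0 Delta0_rules)
    note Sigma1_g = Sigma1_inst3[where R = "\<lambda>i q t. g i = pair q t", OF this]
    have "Sigma1 S (\<lambda>e. \<exists>i t. g i = pair (e 0) t)" by (intro Sigma1_ex Sigma1_g tm_fun_var)
    moreover obtain q0 t0 where "g 0 = pair q0 t0" using fldE[OF fld] by blast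
    ultimately obtain q where "\<exists>i t. g i = pair q t" and least: "\<And>q'. q' < q \<Longrightarrow> \<not> (\<exists>i t. g i = pair q' t)"
      using ex_least_Sigma1[where P = "\<lambda>q. \<exists>i t. g i = pair q t"] by blast
    then obtain i0 t1 where i0: "g i0 = pair q t1" by blast
    have "\<exists>t. g (i0 + i) = pair q t \<and> i \<le> t" for i
    proof (rule Sigma1_induct[where P = "\<lambda>i. \<exists>t. g (i0 + i) = pair q t \<and> i \<le> t"])
      show "Sigma1 S (\<lambda>e. \<exists>t. g (i0 + e 0) = pair q t \<and> e 0 \<le> t)"
        by (intro Sigma1_ex Sigma1_conj Sigma1_g Sigma1_Delta0[OF Delta0_le] tm_fun.intros)
      show "\<exists>t. g (i0 + 0) = pair q t \<and> 0 \<le> t" using i0 by (simp add: zero_least pair_inject)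
    next
      fix i assume "\<exists>t. g (i0 + i) = pair q t \<and> i \<le> t"
      then obtain t where t: "g (i0 + i) = pair q t" "i \<le> t" by blast
      obtain q' t' where q': "g (i0 + (i + 1)) = pair q' t'" using fldE[OF fld] by blast
      have "oless \<alpha> (pair q' t') (pair q t)" using desc[of "i0 + i"] t q' by (simp add: add.assoc)
      then have "q' < q \<or> q' = q \<and> t < t'" unfolding oless_\<alpha> by blast
      then have "q' = q" "t < t'" using least q' by blast+
      then have "i + 1 \<le> t'" using t(2) by (simp add: add_one_le_iff)
      then show "\<exists>t. g (i0 + (i + 1)) = pair q t \<and> i + 1 \<le> t" using q' \<open>q' = q\<close> by blast
    qed
    then have "\<exists>t\<ge>i. fld (pair q t)" for i using fld by metis
    then show False by (rule fld_eventually)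
  qed
  then show ?thesis unfolding well_ordered_def using \<alpha>_in_S Linear_order_\<alpha> by blast
qed

text \<open>At stage \<open>s\<close> one follows least candidates downwards from \<open>\<langle>x0, m0\<rangle>\<close>.  Pairs are shifted by
  one, \<open>0\<close> signalling that no candidate is left.\<close>

definition nxt :: "'m \<Rightarrow> 'm \<Rightarrow> 'm \<Rightarrow> bool" where
  "nxt s x q \<longleftrightarrow> q = 0 \<and> (\<forall>c<s. \<not> cand x s c) \<or> (\<exists>c<s. q = c + 1 \<and> cand x s c \<and> (\<forall>c'<c. \<not> cand x s c'))"

text \<open>The alternative \<open>t = s\<close> is the default when no earlier stage qualifies, in
  particular when there is no usable candidate: the current stage then counts as a change.\<close>

definition last_change :: "'m \<Rightarrow> 'm \<Rightarrow> 'm \<Rightarrow> bool" where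
  "last_change s x t \<longleftrightarrow> t \<le> s \<and> (stab x t s \<or> t = s) \<and> (\<forall>t'<t. \<not> stab x t' s)"

text \<open>The exponent is only \<open>x\<close>; the coefficient carries the whole pair, since
  refuting this pair is what cuts off its summand of stages in \<open>\<alpha>\<close>.\<close>

definition node :: "'m \<Rightarrow> 'm \<Rightarrow> 'm \<Rightarrow> 'm \<Rightarrow> 'm \<Rightarrow> bool" where
  "node \<sigma> i x m t \<longleftrightarrow> entry \<sigma> i (pair x (pair (pair x m + 1) t))"

definition link :: "'m \<Rightarrow> 'm \<Rightarrow> 'm \<Rightarrow> 'm \<Rightarrow> 'm \<Rightarrow> bool" where
  "link s \<sigma> l i x \<longleftrightarrow>
    (i + 1 < l \<longrightarrow> (\<exists>x'<\<sigma>. \<exists>m'<\<sigma>. \<exists>t'<\<sigma>. node \<sigma> (i + 1) x' m' t' \<and> nxt s x (pair x' m' + 1))) \<and>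
    (i + 1 = l \<longrightarrow> nxt s x 0)"

definition chain :: "'m \<Rightarrow> 'm \<Rightarrow> bool" where
  "chain s \<sigma> \<longleftrightarrow> (\<exists>l\<le>\<sigma>. seq_code \<sigma> l \<and> 0 < l \<and> (\<exists>t<\<sigma>. node \<sigma> 0 x0 m0 t) \<and>
    (\<forall>i<l. \<exists>x<\<sigma>. \<exists>m<\<sigma>. \<exists>t<\<sigma>. node \<sigma> i x m t \<and> last_change s x t \<and> link s \<sigma> l i x))"

lemma Delta0_nxt: "tm_fun t \<Longrightarrow> tm_fun u \<Longrightarrow> tm_fun v \<Longrightarrow> Delta0 S (\<lambda>e Z. nxt (t e) (u e) (v e))"
proof -
  have "Delta0 S (\<lambda>e Z. nxt (e 0) (e 1) (e 2))" unfolding nxt_def by (intro Delta0_cand Delta0_rules)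
  then show "tm_fun t \<Longrightarrow> tm_fun u \<Longrightarrow> tm_fun v \<Longrightarrow> Delta0 S (\<lambda>e Z. nxt (t e) (u e) (v e))" by (rule Delta0_inst3)
qed

lemma Delta0_last_change: "tm_fun t \<Longrightarrow> tm_fun u \<Longrightarrow> tm_fun v \<Longrightarrow> Delta0 S (\<lambda>e Z. last_change (t e) (u e) (v e))"
proof -
  have "Delta0 S (\<lambda>e Z. last_change (e 0) (e 1) (e 2))" unfolding last_change_def by (intro Delta0_stab Delta0_rules)
  then show "tm_fun t \<Longrightarrow> tm_fun u \<Longrightarrow> tm_fun v \<Longrightarrow> Delta0 S (\<lambda>e Z. last_change (t e) (u e) (v e))" by (rule Delta0_inst3)
qed

lemma Delta0_chain: "tm_fun t \<Longrightarrow> tm_fun u \<Longrightarrow> Delta0 S (\<lambda>e Z. chain (t e) (u e))"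
proof -
  have "Delta0 S (\<lambda>e Z. chain (e 0) (e 1))" unfolding chain_def link_def node_def
    by (intro Delta0_nxt Delta0_last_change Delta0_seq_code Delta0_entry Delta0_rules)
  then show "tm_fun t \<Longrightarrow> tm_fun u \<Longrightarrow> Delta0 S (\<lambda>e Z. chain (t e) (u e))" by (rule Delta0_inst2)
qed

lemma nxt_unique: "nxt s x q \<Longrightarrow> nxt s x q' \<Longrightarrow> q = q'"
  unfolding nxt_def by (metis neqE)

lemma nxt_ex: "\<exists>q. nxt s x q"
proof (cases "\<exists>c<s. cand x s c")
  case True
  then obtain c0 where c0: "c0 < s" "cand x s c0" by blast
  have "Delta0 S (\<lambda>e Z. cand x s (e 0))" by (intro Delta0_cand tm_fun_var tm_fun_const)
  from ex_least_Delta0[where P = "cand x s", OF this c0(2)]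
  obtain c where c: "cand x s c" "\<forall>c'<c. \<not> cand x s c'" by blast
  moreover have "c < s" using c(2) c0 by (meson not_le le_less_trans)
  ultimately show ?thesis unfolding nxt_def by blast
next
  case False
  then show ?thesis unfolding nxt_def by blast
qed

lemma nxt_succ: "nxt s x (c + 1) \<Longrightarrow> cand x s c"
  unfolding nxt_def using not_one_eq_zero by auto

lemma last_change_unique: "last_change s x t \<Longrightarrow> last_change s x t' \<Longrightarrow> t = t'"
  unfolding last_change_def by (metis neqE not_le)

lemma last_change_ex: "\<exists>t. last_change s x t"
proof -
  have "Delta0 S (\<lambda>e Z. stab x (e 0) s \<or> e 0 = s)" by (intro Delta0_stab Delta0_rules)
  from ex_least_Delta0[where P = "\<lambda>t. stab x t s \<or> t = s", OF this, of s]
  obtain t where t: "stab x t s \<or> t = s" "\<forall>t'<t. \<not> (stab x t' s \<or> t' = s)" by blast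
  moreover have "\<not> s < t" using t(2) by blast
  then have "t \<le> s" by simp
  ultimately show ?thesis unfolding last_change_def by blast
qed

text \<open>This places the recorded stage in the field of \<open>\<alpha>\<close>: an earlier
  stable stage would persist up to \<open>s\<close> by transitivity.\<close>

lemma last_change_no_stab:
  assumes "last_change s x t" "t' < t" shows "\<not> stab x t' t"
proof
  assume st: "stab x t' t"
  from assms(1) have "t \<le> s" "stab x t s \<or> t = s" "\<not> stab x t' s"
    using assms(2) unfolding last_change_def by blast+
  then show False using stab_trans[OF st] st assms(2) by (metis less_imp_le)
qed

lemma last_change_mono:
  assumes "last_change s x t" "last_change (s + 1) x t'" shows "t \<le> t'"
proof (rule ccontr)
  assume "\<not> t \<le> t'"
  then have t': "t' < t" by simp
  have "t \<le> s" using assms(1) unfolding last_change_def by blast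
  then have "t' \<noteq> s + 1" using t' less_add_one[of s] by (metis less_trans not_le)
  then have "stab x t' (s + 1)" using assms(2) unfolding last_change_def by blast
  then have "stab x t' s" by (rule stab_antimono) (simp add: zero_least)
  then show False using assms(1) t' unfolding last_change_def by blast
qed

text \<open>As \<open>t\<close> is at most \<open>s\<close>, the default value \<open>s + 1\<close>
  is excluded at the second stage. So the candidate settled at \<open>t\<close> is still unrefuted
  at \<open>s + 1\<close> and is the next one at both stages.\<close>

lemma last_change_same:
  assumes "last_change s x t" "last_change (s + 1) x t"
  shows "\<exists>c. nxt s x (c + 1) \<and> nxt (s + 1) x (c + 1)"
proof -
  have ts: "t \<le> s" using assms(1) unfolding last_change_def by blast
  then have "t \<noteq> s + 1" using less_add_one[of s] by (metis not_le)
  then have "stab x t (s + 1)" using assms(2) unfolding last_change_def by blast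
  then obtain c where c: "c < t" "cand x (s + 1) c" "\<forall>c'<c. \<not> cand x t c'" unfolding stab_def by blast
  have s1: "s \<le> s + 1" by (simp add: zero_least)
  note s = s1 order_trans[OF ts s1]
  have "c < s" "c < s + 1" using c(1) ts s(2) by simp_all
  moreover have "cand x s c" using cand_antimono[OF c(2) s(1)] .
  moreover have "\<forall>c'<c. \<not> cand x s c'" "\<forall>c'<c. \<not> cand x (s + 1) c'"
    using c(3) cand_antimono ts s(2) by blast+
  ultimately show ?thesis using c(2) unfolding nxt_def by blast
qed

lemma node_less:
  assumes "node \<sigma> i x m t" shows "x < \<sigma> \<and> m < \<sigma> \<and> t < \<sigma>"
proof -
  have "x < \<sigma>" "pair (pair x m + 1) t < \<sigma>"
    using entry_less[OF assms[unfolded node_def]] le_pair1 le_pair2 by (meson le_less_trans)+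
  moreover have "pair x m + 1 \<le> pair (pair x m + 1) t" "t \<le> pair (pair x m + 1) t" by (rule le_pair1 le_pair2)+
  moreover have "m \<le> pair x m + 1" using le_pair2[of m x] le_add_same(1)[of "pair x m" 1] by (rule order_trans)
  ultimately show ?thesis by (meson le_less_trans order_trans)
qed

text \<open>Following the least candidates is primitive recursion at the fixed stage
  \<open>s\<close>. It reaches 0, since otherwise the exponents would descend in \<open>X\<close>
  forever; the part before the first 0 is then coded as a sequence.\<close>

lemma chain_exists: "\<exists>\<sigma>. chain s \<sigma>"
proof -
  \<comment> \<open>Totalized: numbers that are not shifted pairs, in particular 0, are sent to
    0.\<close>
  define step where "step q q' \<longleftrightarrow> (\<exists>x\<le>q. \<exists>m\<le>q. q = pair x m + 1 \<and> nxt s x q') \<or>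
    \<not> (\<exists>x\<le>q. \<exists>m\<le>q. q = pair x m + 1) \<and> q' = 0" for q q'
  have step_pair: "step (pair x m + 1) q' \<longleftrightarrow> nxt s x q'" for x m q'
  proof -
    have "x \<le> pair x m + 1" "m \<le> pair x m + 1"
      using le_pair1[of x m] le_pair2[of m x] le_add_same(1)[of "pair x m" 1] order_trans by metis+
    then show ?thesis unfolding step_def by (auto simp: pair_inject)
  qed
  have step_ex1: "\<exists>!q'. step q q'" for q
  proof (cases "\<exists>x m. q = pair x m + 1")
    case True
    then obtain x m where "q = pair x m + 1" by blast
    then show ?thesis using nxt_ex nxt_unique step_pair by metis
  next
    case False
    then have "step q q' \<longleftrightarrow> q' = 0" for q' unfolding step_def by blast
    then show ?thesis by simp
  qed
  define nx where "nx q = (THE q'. step q q')" for q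
  have nx: "nx q = q' \<longleftrightarrow> step q q'" for q q'
    unfolding nx_def using step_ex1[of q] by (metis the1_equality)
  have "graph nx \<in> S"
  proof (rule graph_in_S)
    show "Sigma1 S (\<lambda>e. nx (e 0) = e 1)" unfolding nx step_def
      by (rule Sigma1_Delta0) (intro Delta0_nxt Delta0_rules)
  qed
  then obtain h where h: "h 0 = pair x0 m0 + 1" "\<And>n. h (n + 1) = nx (h n)" "graph h \<in> S"
    using primitive_recursion[of nx "pair x0 m0 + 1"] by blast
  have h_form: "h j = 0 \<or> (\<exists>x m. h j = pair x m + 1)" for j
  proof (cases "j = 0")
    case True
    then show ?thesis using h(1) by blast
  next
    case False
    then obtain i where i: "j = i + 1" using zero_or_succ by blast
    have "step (h i) (h j)" using h(2)[of i] nx[of "h i" "h j"] i by simp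
    then have "h j = 0 \<or> (\<exists>x c. h j = c + 1 \<and> cand x s c)" unfolding step_def nxt_def by blast
    then show ?thesis unfolding cand_def using validE by blast
  qed
  have h_step: "nxt s x (h (j + 1))" if "h j = pair x m + 1" for j x m
    using h(2)[of j] nx step_pair that by metis
  have Sigma1_h: "Sigma1 S (\<lambda>e. h (e 0) = pair (e 1) (e 2) + 1)"
    by (rule Sigma1_graph[OF h(3) tm_fun_var, where P = "\<lambda>e u. u = pair (e 1) (e 2) + 1"]) (intro Sigma1_Delta0 Delta0_rules)
  note Sigma1_h = Sigma1_inst3[where R = "\<lambda>j x m. h j = pair x m + 1", OF this]
  \<comment> \<open>The default 0 keeps \<open>xf\<close> total past the end of the search.\<close>
  define xf where "xf j = (if h j = 0 then 0 else (THE x. \<exists>m. h j = pair x m + 1))" for j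
  have xf: "xf j = x" if "h j = pair x m + 1" for j x m
  proof -
    have "(THE x. \<exists>m. h j = pair x m + 1) = x"
      by (rule the_equality) (use that in \<open>auto simp: pair_inject\<close>)
    then show ?thesis unfolding xf_def using that by (simp add: not_one_eq_zero)
  qed
  have Sigma1_h0: "Sigma1 S (\<lambda>e. h (e 0) = 0)"
    by (rule Sigma1_graph[OF h(3) tm_fun_var, where P = "\<lambda>e u. u = 0"]) (intro Sigma1_Delta0 Delta0_rules)
  have xf_iff: "xf j = x \<longleftrightarrow> h j = 0 \<and> x = 0 \<or> (\<exists>m. h j = pair x m + 1)" for j x
  proof (cases "h j = 0")
    case True
    then show ?thesis using not_one_eq_zero by (auto simp: xf_def)
  next
    case False
    then show ?thesis using h_form[of j] xf[of j] by auto
  qed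
  have xf_S: "graph xf \<in> S"
  proof (rule graph_in_S)
    show "Sigma1 S (\<lambda>e. xf (e 0) = e 1)" unfolding xf_iff
      by (rule Sigma1_disj, rule Sigma1_conj, rule Sigma1_h0, rule Sigma1_Delta0, intro Delta0_rules) (intro Sigma1_ex Sigma1_h tm_fun_var)
  qed
  have xf_desc: "oless X (xf (j + 1)) (xf j)" if nz: "h j \<noteq> 0" "h (j + 1) \<noteq> 0" for j
  proof -
    obtain x m where x: "h j = pair x m + 1" using nz(1) h_form by blast
    obtain x' m' where x': "h (j + 1) = pair x' m' + 1" using nz(2) h_form by blast
    have "cand x s (pair x' m')" using h_step[OF x] nxt_succ unfolding x' by blast
    then show ?thesis using xf[OF x] xf[OF x'] unfolding cand_def valid_pair by simp
  qed
  have "\<exists>l. h l = 0"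
  proof (rule ccontr)
    assume "\<not> (\<exists>l. h l = 0)"
    then have "oless X (xf (j + 1)) (xf j)" for j using xf_desc by blast
    then show False using well_orderedD[OF wo xf_S] by blast
  qed
  then obtain l0 where "h l0 = 0" by blast
  then have l0: "pair l0 0 \<in> graph h" by (simp add: pair_in_graph)
  have "Delta0 S (\<lambda>e Z. pair (e 0) 0 \<in> graph h)" by (rule Delta0_mem[OF h(3)]) (intro tm_fun_pair tm_fun_var tm_fun_const)
  from ex_least_Delta0[where P = "\<lambda>l. pair l 0 \<in> graph h", OF this l0]
  obtain l where "pair l 0 \<in> graph h" "\<forall>j<l. pair j 0 \<notin> graph h" by blast
  then have l: "h l = 0" "\<forall>j<l. h j \<noteq> 0" unfolding pair_in_graph by metis+
  have "l \<noteq> 0" using l(1) h(1) not_one_eq_zero by metis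
  then have l_pos: "0 < l" using zero_least[of l] by simp
  define tf where "tf x = (THE t. last_change s x t)" for x
  have tf: "tf x = t \<longleftrightarrow> last_change s x t" for x t
    unfolding tf_def using last_change_ex[of s x] last_change_unique by (metis the_equality)
  define u where "u i = pair (xf i) (pair (h i) (tf (xf i)))" for i
  have u: "u i = pair x (pair (pair x m + 1) (tf x))" if "h i = pair x m + 1" for i x m
    unfolding u_def xf[OF that] that ..
  have tf_S: "graph tf \<in> S"
    by (rule graph_in_S) (unfold tf, intro Sigma1_Delta0 Delta0_last_change tm_fun_var tm_fun_const)
  have "graph u \<in> S"
  proof (rule graph_in_S)
    show "Sigma1 S (\<lambda>e. u (e 0) = e 1)" unfolding u_def
      by (rule Sigma1_graph[OF xf_S tm_fun_var, where P = "\<lambda>e x. pair x (pair (h (e 0)) (tf x)) = e 1"],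
          rule Sigma1_graph[OF h(3) tm_fun_var, where P = "\<lambda>e q. pair (e 0) (pair q (tf (e 0))) = e (Suc 1)"],
          rule Sigma1_graph[OF tf_S tm_fun_var, where P = "\<lambda>e t. pair (e (Suc 0)) (pair (e 0) t) = e (Suc (Suc 1))"])
        (intro Sigma1_Delta0 Delta0_rules)
  qed
  then have "{p. p \<in> graph u \<and> (\<exists>i\<le>p. \<exists>y\<le>p. p = pair i y \<and> i < l)} \<in> S"
    by (intro Delta0_comprehension[where P = "\<lambda>p. p \<in> graph u \<and> (\<exists>i\<le>p. \<exists>y\<le>p. p = pair i y \<and> i < l)"] Delta0_rules)
  moreover have "{p. p \<in> graph u \<and> (\<exists>i\<le>p. \<exists>y\<le>p. p = pair i y \<and> i < l)} = {pair i (u i) | i. i < l}"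
    using le_pair1 le_pair2 by (auto simp: graph_def pair_inject)
  ultimately obtain \<sigma> where \<sigma>: "seq_code \<sigma> l" "\<And>i a. entry \<sigma> i a \<longleftrightarrow> i < l \<and> a = u i"
    using seq_from_graph[of u l] by auto
  have e0: "node \<sigma> 0 x0 m0 (tf x0)" unfolding node_def using \<sigma>(2) l_pos u[OF h(1)] by simp
  have "\<exists>x<\<sigma>. \<exists>m<\<sigma>. \<exists>t<\<sigma>. node \<sigma> i x m t \<and> last_change s x t \<and> link s \<sigma> l i x" if i: "i < l" for i
  proof -
    obtain x m where x: "h i = pair x m + 1" using l(2) i h_form by blast
    have e: "node \<sigma> i x m (tf x)" unfolding node_def using \<sigma>(2) i u[OF x] by simp
    have "\<exists>x'<\<sigma>. \<exists>m'<\<sigma>. \<exists>t'<\<sigma>. node \<sigma> (i + 1) x' m' t' \<and> nxt s x (pair x' m' + 1)" if i1: "i + 1 < l"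
    proof -
      obtain x' m' where x': "h (i + 1) = pair x' m' + 1" using l(2) i1 h_form by blast
      have e': "node \<sigma> (i + 1) x' m' (tf x')" unfolding node_def using \<sigma>(2) i1 u[OF x'] by simp
      have "nxt s x (pair x' m' + 1)" using h_step[OF x] x' by simp
      then show ?thesis using e' node_less[OF e'] by blast
    qed
    moreover have "nxt s x 0" if "i + 1 = l" using h_step[OF x] l(1) that by simp
    ultimately have "link s \<sigma> l i x" unfolding link_def by blast
    moreover have "last_change s x (tf x)" using tf by blast
    ultimately show ?thesis using e node_less[OF e] by blast
  qed
  then have "chain s \<sigma>" unfolding chain_def
    using \<sigma>(1) seq_code_le[OF \<sigma>(1)] l_pos e0 node_less[OF e0] by blast
  then show ?thesis by blast
qed

lemma chain_facts:
  assumes "chain s \<sigma>" "seq_code \<sigma> l"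
  shows "0 < l" "\<exists>t. node \<sigma> 0 x0 m0 t"
    "i < l \<Longrightarrow> \<exists>x m t. node \<sigma> i x m t \<and> last_change s x t \<and> link s \<sigma> l i x"
proof -
  obtain l' where l': "seq_code \<sigma> l'" "0 < l'" "\<exists>t. node \<sigma> 0 x0 m0 t"
    "\<forall>i<l'. \<exists>x<\<sigma>. \<exists>m<\<sigma>. \<exists>t<\<sigma>. node \<sigma> i x m t \<and> last_change s x t \<and> link s \<sigma> l' i x"
    using assms(1) unfolding chain_def by blast
  have "l' = l" using seq_code_length l'(1) assms(2) by blast
  then show "0 < l" "\<exists>t. node \<sigma> 0 x0 m0 t" using l' by simp_all
  assume "i < l"
  then show "\<exists>x m t. node \<sigma> i x m t \<and> last_change s x t \<and> link s \<sigma> l i x"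
    using l'(4) unfolding \<open>l' = l\<close> by blast
qed

lemma linkD:
  assumes "link s \<sigma> l i x"
  shows "i + 1 < l \<Longrightarrow> \<exists>x' m' t'. node \<sigma> (i + 1) x' m' t' \<and> nxt s x (pair x' m' + 1)"
    and "i + 1 = l \<Longrightarrow> nxt s x 0"
  using assms unfolding link_def by blast+

lemma node_eq:
  assumes "seq_code \<sigma> l" "node \<sigma> i x m t" "node \<sigma> i x' m' t'"
  shows "x' = x \<and> m' = m \<and> t' = t"
  using seq_code_unique[OF assms(1) assms(2,3)[unfolded node_def]] by (simp add: pair_inject)

lemma chain_link:
  assumes "chain s \<sigma>" "seq_code \<sigma> l" "node \<sigma> i x m t"
  shows "last_change s x t \<and> link s \<sigma> l i x"
proof -
  have "i < l" using seq_code_entry[OF assms(2) assms(3)[unfolded node_def]] .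
  then show ?thesis using chain_facts(3)[OF assms(1,2)] node_eq[OF assms(2,3)] by blast
qed

lemma chain_elements:
  assumes "chain s \<sigma>" "seq_code \<sigma> l" "node \<sigma> i x m t"
  shows "x \<in> ofield X" "\<not> refuted (pair x m) s" "last_change s x t"
proof -
  have i: "i < l" using seq_code_entry[OF assms(2) assms(3)[unfolded node_def]] .
  note cf = chain_facts[OF assms(1,2)]
  show "last_change s x t" using chain_link[OF assms] by blast
  have "x \<in> ofield X \<and> \<not> refuted (pair x m) s"
  proof (cases "i = 0")
    case True
    then have "x0 = x \<and> m0 = m" using cf(2) node_eq[OF assms(2,3)] by blast
    then show ?thesis using x0 never refuted_pair by blast
  next
    case False
    then obtain j where j: "i = j + 1" using zero_or_succ by blast
    have "j < l" using i j less_add_one less_trans by metis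
    then obtain y where "link s \<sigma> l j y" using cf(3) by blast
    then obtain x' m' t' where x': "node \<sigma> (j + 1) x' m' t'" "nxt s y (pair x' m' + 1)"
      using linkD(1) i unfolding j by blast
    then have "x' = x \<and> m' = m" using node_eq[OF assms(2,3)] unfolding j by blast
    then have "cand y s (pair x m)" using x'(2) nxt_succ by blast
    then show ?thesis unfolding cand_def valid_pair using oless_ofield(1) by blast
  qed
  then show "x \<in> ofield X" "\<not> refuted (pair x m) s" by blast+
qed

lemma chain_fld:
  assumes "chain s \<sigma>" "seq_code \<sigma> l" "node \<sigma> i x m t"
  shows "fld (pair (pair x m + 1) t)"
proof -
  note ce = chain_elements[OF assms]
  have "t \<le> s" using ce(3) unfolding last_change_def by blast
  then have "\<not> refuted (pair x m) t" using ce(2) refuted_mono by blast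
  then show ?thesis unfolding fld_pair using ce(1) last_change_no_stab[OF ce(3)] by blast
qed

lemma chain_pow_elem:
  assumes "chain s \<sigma>" shows "pow_elem \<alpha> X \<sigma>"
proof -
  obtain l where l: "seq_code \<sigma> l" using assms unfolding chain_def by blast
  note cf = chain_facts[OF assms l]
  \<comment> \<open>The adjoined element \<open>pair 0 0\<close> lies below all others, which makes
    every recorded stage an admissible coefficient.\<close>
  have least: "\<not> least_in \<alpha> (pair (pair x m + 1) t)" for x m t
  proof
    assume "least_in \<alpha> (pair (pair x m + 1) t)"
    moreover have "fld (pair 0 0)" unfolding fld_pair by simp
    then have "pair 0 0 \<in> ofield \<alpha>" unfolding ofield_iff[OF Linear_order_\<alpha>] rel_iff[symmetric] rel_\<alpha> fle_pair by simp
    ultimately have "(pair (pair x m + 1) t, pair 0 0) \<in> rel \<alpha>" unfolding least_in_def by blast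
    then show False unfolding rel_\<alpha> fle_pair using not_less_zero not_one_eq_zero by metis
  qed
  have elem: "a \<in> ofield \<alpha>" if "fld a" for a
    unfolding ofield_iff[OF Linear_order_\<alpha>] rel_iff[symmetric] rel_\<alpha> using that fldE[OF that] fle_pair by auto
  show ?thesis unfolding pow_elem_def
  proof (rule exI[of _ l], intro conjI allI impI)
    show "seq_code \<sigma> l" by (rule l)
  next
    fix i assume "i < l"
    then obtain x m t where e: "node \<sigma> i x m t" using cf(3) by blast
    then show "\<exists>b a. entry \<sigma> i (pair b a) \<and> b \<in> ofield X \<and> a \<in> ofield \<alpha> \<and> \<not> least_in \<alpha> a"
      using chain_elements(1)[OF assms l e] elem[OF chain_fld[OF assms l e]] least unfolding node_def by blast
  next
    fix i b a b' a' assume *: "i + 1 < l \<and> entry \<sigma> i (pair b a) \<and> entry \<sigma> (i + 1) (pair b' a')"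
    then have "i < l" using less_add_one less_trans by metis
    then obtain x m t where x: "node \<sigma> i x m t" "link s \<sigma> l i x" using cf(3) by blast
    obtain x' m' t' where x': "node \<sigma> (i + 1) x' m' t'" "nxt s x (pair x' m' + 1)"
      using linkD(1)[OF x(2)] * by blast
    have "b = x" "b' = x'" using seq_code_unique[OF l] * x(1) x'(1) pair_inject unfolding node_def by metis+
    moreover have "oless X x' x" using nxt_succ[OF x'(2)] unfolding cand_def valid_pair by blast
    ultimately show "oless X b' b" by simp
  qed
qed

text \<open>The first node that differs keeps its exponent and pair and records a later stage. Later
  stages are smaller in \<open>\<alpha>\<close>, so the chain descends there, whatever
  follows.\<close>

lemma chain_descends:
  assumes \<sigma>: "chain s \<sigma>" and \<tau>: "chain (s + 1) \<tau>"
  shows "pow_less \<alpha> X \<tau> \<sigma>"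
proof -
  obtain l where l: "seq_code \<sigma> l" using \<sigma> unfolding chain_def by blast
  obtain k where k: "seq_code \<tau> k" using \<tau> unfolding chain_def by blast
  note cf = chain_facts[OF \<sigma> l] and cf' = chain_facts[OF \<tau> k]
  note item = item_eq_Some[OF l] item_eq_Some[OF k]
  \<comment> \<open>If the chains were equal, their last node would record the same stage twice and
    thus have a next candidate, although the chain ended for lack of one.\<close>
  have "\<exists>i. item \<sigma> i \<noteq> item \<tau> i"
  proof (rule ccontr)
    assume "\<not> (\<exists>i. item \<sigma> i \<noteq> item \<tau> i)"
    then have same: "entry \<sigma> i c \<longleftrightarrow> entry \<tau> i c" for i c using item by metis
    obtain i where i: "l = i + 1" using cf(1) zero_or_succ[of l] by blast
    have "i < l" unfolding i by (rule less_add_one)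
    then obtain x m t where x: "node \<sigma> i x m t" "link s \<sigma> l i x" using cf(3) by blast
    then have "node \<tau> i x m t" using same unfolding node_def by blast
    from last_change_same[OF chain_elements(3)[OF \<sigma> l x(1)] chain_elements(3)[OF \<tau> k this]]
    obtain c where "nxt s x (c + 1)" by blast
    from nxt_unique[OF this] show False using linkD(2)[OF x(2)] i not_one_eq_zero by blast
  qed
  then obtain i0 where i0: "item \<sigma> i0 \<noteq> item \<tau> i0" by blast
  have "Delta0 S (\<lambda>e Z. \<not> (\<forall>c<\<sigma> + \<tau>. entry \<sigma> (e 0) c \<longleftrightarrow> entry \<tau> (e 0) c))" by (intro Delta0_entry Delta0_rules)
  then have "Delta0 S (\<lambda>e Z. item \<sigma> (e 0) \<noteq> item \<tau> (e 0))"
    unfolding item_eq_iff[OF l k] entry_agree_bounded[OF \<alpha>_in_S Linear_order_\<alpha> X lo] .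
  from ex_least_Delta0[where P = "\<lambda>i. item \<sigma> i \<noteq> item \<tau> i", OF this i0]
  obtain n where n: "item \<sigma> n \<noteq> item \<tau> n" "\<forall>j<n. item \<sigma> j = item \<tau> j" by blast
  \<comment> \<open>The roots share their pair. Any later node is the next candidate below a common
    predecessor, whose unchanged stage fixes that candidate.\<close>
  have "\<exists>x m t t'. node \<sigma> n x m t \<and> node \<tau> n x m t'"
  proof (cases "n = 0")
    case True
    then show ?thesis using cf(2) cf'(2) by blast
  next
    case False
    then obtain i where i: "n = i + 1" using zero_or_succ by blast
    have "i < n" unfolding i by (rule less_add_one)
    then have same: "entry \<sigma> i c \<longleftrightarrow> entry \<tau> i c" for c using item n(2) by metis
    have "item \<sigma> n \<noteq> None \<or> item \<tau> n \<noteq> None" using n(1) by metis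
    then have "n < l \<or> n < k" using item_eq_None[OF l] item_eq_None[OF k] not_le by metis
    then have "i < l \<or> i < k" using \<open>i < n\<close> less_trans by blast
    then obtain c where "entry \<sigma> i c" using seq_code_ex[OF l] seq_code_ex[OF k] same by blast
    then have "i < l" using seq_code_entry[OF l] by blast
    then obtain x m t where x: "node \<sigma> i x m t" using cf(3) by blast
    then have x': "node \<tau> i x m t" using same unfolding node_def by blast
    from last_change_same[OF chain_elements(3)[OF \<sigma> l x] chain_elements(3)[OF \<tau> k x']]
    obtain c where c: "nxt s x (c + 1)" "nxt (s + 1) x (c + 1)" by blast
    have next_node: "\<exists>y m' t'. node \<rho> n y m' t' \<and> c = pair y m'"
      if \<rho>: "link r \<rho> j i x" "i < j" "nxt r x (c + 1)" for r \<rho> j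
    proof -
      have "i + 1 \<noteq> j" using linkD(2)[OF \<rho>(1)] nxt_unique[OF \<rho>(3)] not_one_eq_zero by blast
      then have "i + 1 < j" using \<rho>(2) add_one_le_iff[of i j] by simp
      from linkD(1)[OF \<rho>(1) this] show ?thesis
        using nxt_unique[OF \<rho>(3)] unfolding i by (metis add_right_cancel)
    qed
    have "i < k" using seq_code_entry[OF k x'[unfolded node_def]] .
    from next_node[OF _ this c(2)] next_node[OF _ \<open>i < l\<close> c(1)] show ?thesis
      using chain_link[OF \<sigma> l x] chain_link[OF \<tau> k x'] pair_inject by metis
  qed
  then obtain x m t t' where e: "node \<sigma> n x m t" and e': "node \<tau> n x m t'" by blast
  have "t \<le> t'" by (rule last_change_mono[OF chain_elements(3)[OF \<sigma> l e] chain_elements(3)[OF \<tau> k e']])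
  moreover have it: "item \<tau> n = Some (pair x (pair (pair x m + 1) t'))"
    "item \<sigma> n = Some (pair x (pair (pair x m + 1) t))"
    using item e e' unfolding node_def by blast+
  then have "t \<noteq> t'" using n(1) by metis
  ultimately have "t < t'" by simp
  then have "oless \<alpha> (pair (pair x m + 1) t') (pair (pair x m + 1) t)"
    using chain_fld[OF \<sigma> l e] chain_fld[OF \<tau> k e'] by (simp add: oless_\<alpha>)
  then have "item_lt \<alpha> X (item \<tau> n) (item \<sigma> n)" by (simp add: item_lt_def it entry_lt_pair)
  moreover have "\<forall>j<n. item \<tau> j = item \<sigma> j" using n(2) by simp
  ultimately show ?thesis
    unfolding pow_less_iff[OF chain_pow_elem[OF \<tau>] chain_pow_elem[OF \<sigma>]] by blast
qed

lemma not_well_ordered_opow: "\<not> well_ordered S (opow \<alpha> X)"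
proof
  assume wo': "well_ordered S (opow \<alpha> X)"
  \<comment> \<open>Choosing the least code of a chain makes the sequence of chains a function with
    a bounded graph.\<close>
  have ex1: "\<exists>!\<sigma>. chain s \<sigma> \<and> (\<forall>\<sigma>'<\<sigma>. \<not> chain s \<sigma>')" for s
  proof -
    obtain \<sigma>0 where \<sigma>0: "chain s \<sigma>0" using chain_exists by blast
    have "Delta0 S (\<lambda>e Z. chain s (e 0))" by (intro Delta0_chain tm_fun_var tm_fun_const)
    from ex_least_Delta0[where P = "chain s", OF this \<sigma>0]
    show ?thesis by (metis neqE)
  qed
  define f where "f s = (THE \<sigma>. chain s \<sigma> \<and> (\<forall>\<sigma>'<\<sigma>. \<not> chain s \<sigma>'))" for s
  have f: "f s = \<sigma> \<longleftrightarrow> chain s \<sigma> \<and> (\<forall>\<sigma>'<\<sigma>. \<not> chain s \<sigma>')" for s \<sigma>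
  proof
    assume "f s = \<sigma>"
    then show "chain s \<sigma> \<and> (\<forall>\<sigma>'<\<sigma>. \<not> chain s \<sigma>')"
      using theI'[OF ex1[of s]] unfolding f_def by metis
  next
    assume \<sigma>: "chain s \<sigma> \<and> (\<forall>\<sigma>'<\<sigma>. \<not> chain s \<sigma>')"
    show "f s = \<sigma>" unfolding f_def by (rule the1_equality[OF ex1 \<sigma>])
  qed
  have c: "chain s (f s)" for s using f[of s "f s"] by blast
  have "graph f \<in> S"
    by (rule graph_in_S) (unfold f, intro Sigma1_Delta0 Delta0_chain Delta0_rules)
  moreover have "oless (opow \<alpha> X) (f (s + 1)) (f s)" for s
    unfolding oless_opow[OF \<alpha>_in_S Linear_order_\<alpha> X lo]
    using chain_pow_elem[OF c] chain_descends[OF c c] by blast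
  ultimately show False using well_orderedD[OF wo'] by blast
qed

end

theorem (in rca) preserves_wo_imp_induction:
  assumes X: "well_ordered S X" and pres: "\<And>\<alpha>. well_ordered S \<alpha> \<Longrightarrow> well_ordered S (opow \<alpha> X)"
  shows "Pi02_transfinite_induction S X"
  unfolding Pi02_transfinite_induction_def
proof (intro allI impI ballI, elim conjE)
  fix Q e E x0
  assume "Pi02 Q" and E: "range E \<subseteq> S" and x0: "x0 \<in> ofield X"
    and prog: "\<forall>x\<in>ofield X. (\<forall>y. oless X y x \<longrightarrow> sat (push y e) E Q) \<longrightarrow> sat (push x e) E Q"
  then obtain \<theta> where \<theta>: "bounded_fm \<theta>" "Q = Forall (Exists \<theta>)" unfolding Pi02_def by blast
  define T where "T y m k = sat (push k (push m (push y e))) E \<theta>" for y m k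
  have sat_Q: "sat (push y e) E Q \<longleftrightarrow> (\<forall>m. \<exists>k. T y m k)" for y by (simp add: \<theta>(2) T_def)
  show "sat (push x0 e) E Q"
  proof (rule ccontr)
    assume "\<not> sat (push x0 e) E Q"
    then obtain m0 where m0: "\<And>k. \<not> T x0 m0 k" unfolding sat_Q by blast
    have Delta0_T: "Delta0 S (\<lambda>e Z. T (e 0) (e 1) (e 2))" unfolding T_def
    proof (rule Delta0_sat_fixed[OF \<theta>(1) E])
      show "tm_fun (\<lambda>e'. push (e' 2) (push (e' 1) (push (e' 0) e)) i)" for i by (intro tm_fun_push tm_fun_var tm_fun_const)
    qed
    interpret failure S X T x0 m0
    proof unfold_locales
      show "\<forall>m. \<exists>k. T x m k" if "x \<in> ofield X" "\<And>y. oless X y x \<Longrightarrow> \<forall>m. \<exists>k. T y m k" for x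
        using prog that unfolding sat_Q by blast
    qed (fact X Delta0_T x0 m0)+
    show False using not_well_ordered_opow pres[OF well_ordered_\<alpha>] by blast
  qed
qed

theorem theorem5:
  fixes S :: "'m::discrete_ordered_semiring set set" and X :: "'m set"
  assumes "RCA0 S" and "well_ordered S X"
  shows "(SETR S X \<longleftrightarrow> Pi02_transfinite_induction S X) \<and>
    (Pi02_transfinite_induction S X \<longleftrightarrow> (\<forall>\<alpha>. well_ordered S \<alpha> \<longrightarrow> well_ordered S (opow \<alpha> X)))"
proof -
  interpret rca S by unfold_locales (rule assms(1))
  have X: "X \<in> S" "Linear_order (rel X)" using assms(2) by (simp_all add: well_ordered_def)
  show ?thesis
    using SETR_imp_induction[OF X(1) _ X(2)] induction_imp_SETR[OF X]
      induction_imp_preserves_wo[OF _ assms(2)] preserves_wo_imp_induction[OF assms(2)] by blast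
qed

end
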